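(* Let $\lambda_1,\dots,\lambda_\ell\in\partial\mathbb{D}$ be distinct. A CMV matrix $\mathcal{C}$ with Verblunsky coefficients $\{\alpha_n\}_{n=0}^\infty\subset\mathbb{D}$ and $\rho_n=(1-|\alpha_n|^2)^{1/2}$ has $$\sigma_{\mathrm{ess}}(\mathcal{C})=\{\lambda_1,\dots,\lambda_\ell\}$$ if and only if the following three conditions hold: (i) $\displaystyle\lim_{n\to\infty}\rho_n\rho_{n+1}\cdots\rho_{n+\ell-1}=0$. (ii) If $1\le k\le\ell$ and $n_j\to\infty$ is a sequence such that $$\rho_{n_j}\to0,\qquad\rho_{n_j+k}\to0,\qquad\alpha_{n_j+m}\to\tilde\alpha_m\quad(m=0,1,2,\dots,k),$$ with $|\tilde\alpha_m|\ne1$ for $m=1,\dots,k-1$ (so that $|\tilde\alpha_0|=|\tilde\alpha_k|=1$), then the $k\times k$ matrix $$\tilde{\mathcal{C}}=\bigl[\Theta(\tilde\alpha_1)\oplus\Theta(\tilde\alpha_3)\oplus\cdots\oplus\Theta(\tilde\alpha_{k-1})\bigr]\bigl[-\tilde\alpha_0\mathbf{1}\oplus\Theta(\tilde\alpha_2)\oplus\cdots\oplus\Theta(\tilde\alpha_{k-2})\oplus\overline{\tilde\alpha_k}\,\mathbf{1}\bigr]$$ if $k$ is even, and $$\tilde{\mathcal{C}}=\bigl[\Theta(\tilde\alpha_1)\oplus\Theta(\tilde\alpha_3)\oplus\cdots\oplus\Theta(\tilde\alpha_{k-2})\oplus\overline{\tilde\alpha_k}\,\mathbf{1}\bigr]\bigl[-\tilde\alpha_0\mathbf{1}\oplus\Theta(\tilde\alpha_2)\oplus\cdots\oplus\Theta(\tilde\alpha_{k-1})\bigr]$$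 if $k$ is odd, has as its eigenvalues $k$ (distinct) elements among $\lambda_1,\dots,\lambda_\ell$. (iii) Each of $\lambda_1,\dots,\lambda_\ell$ occurs as an eigenvalue of some $\tilde{\mathcal{C}}$ of the form described in (ii).
   Context: $\mathbb{D}=\{z\in\mathbb{C}:|z|<1\}$, $\partial\mathbb{D}$ is the unit circle, and $\mathbf{1}$ denotes the $1\times1$ unit matrix. For $\alpha\in\overline{\mathbb{D}}$ put $\Theta(\alpha)=\begin{pmatrix}\bar\alpha&\rho\\ \rho&-\alpha\end{pmatrix}$, $\rho=(1-|\alpha|^2)^{1/2}$. For $\{\alpha_j\}_{j=0}^\infty\subset\mathbb{D}$, with $\Theta_j=\Theta(\alpha_j)$, $\mathcal{L}=\Theta_0\oplus\Theta_2\oplus\Theta_4\oplus\cdots$ and $\mathcal{M}=\mathbf{1}\oplus\Theta_1\oplus\Theta_3\oplus\cdots$, the CMV matrix is the unitary operator $\mathcal{C}=\mathcal{L}\mathcal{M}$ on $\ell^2(\{0,1,2,\dots\})$. In (ii), for $k=1$ the formula reads $\tilde{\mathcal{C}}=[\overline{\tilde\alpha_1}]\,[-\tilde\alpha_0]$, and for $k=2$ it reads $\Theta(\tilde\alpha_1)\,[-\tilde\alpha_0\mathbf{1}\oplus\overline{\tilde\alpha_2}\,\mathbf{1}]$. $\sigma_{\mathrm{ess}}$ denotes essential spectrum. *)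

theory Defs
  imports Complex_Main "Jordan_Normal_Form.Spectral_Radius"
begin

definition rho :: "complex \<Rightarrow> real" where
  "rho a = sqrt (1 - (cmod a)\<^sup>2)"

definition Theta :: "complex \<Rightarrow> complex mat" where
  "Theta a = mat_of_rows_list 2
     [[cnj a,              complex_of_real (rho a)],
      [complex_of_real (rho a), - a              ]]"

section \<open>The space of square-summable sequences and the essential spectrum\<close>

definition ell2 :: "(nat \<Rightarrow> complex) set" where
  "ell2 = {x. summable (\<lambda>n. (cmod (x n))\<^sup>2)}"

definition ell2_norm :: "(nat \<Rightarrow> complex) \<Rightarrow> real" where
  "ell2_norm x = sqrt (\<Sum>n. (cmod (x n))\<^sup>2)"

definition lin_span :: "(nat \<Rightarrow> complex) set \<Rightarrow> (nat \<Rightarrow> complex) set" where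
  "lin_span F = {x. \<exists>c. x = (\<lambda>n. \<Sum>f\<in>F. c f * f n)}"

definition ell2_closed :: "(nat \<Rightarrow> complex) set \<Rightarrow> bool" where
  "ell2_closed S \<longleftrightarrow>
     (\<forall>f y. (\<forall>j. f j \<in> S) \<and> y \<in> ell2 \<and>
        (\<lambda>j::nat. ell2_norm (\<lambda>n. f j n - y n)) \<longlonglongrightarrow> 0 \<longrightarrow> y \<in> S)"

text \<open>A bounded operator on \<open>ell2\<close> is represented by a map on sequences whose values outside
  \<open>ell2\<close> are irrelevant.  It is Fredholm if its kernel has finite dimension and its range is
  closed and has finite codimension.\<close>

definition ell2_fredholm :: "((nat \<Rightarrow> complex) \<Rightarrow> (nat \<Rightarrow> complex)) \<Rightarrow> bool" where
  "ell2_fredholm T \<longleftrightarrow>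
     (\<exists>F. finite F \<and> F \<subseteq> ell2 \<and> {x \<in> ell2. T x = (\<lambda>n. 0)} \<subseteq> lin_span F) \<and>
     ell2_closed (T ` ell2) \<and>
     (\<exists>F. finite F \<and> F \<subseteq> ell2 \<and>
        (\<forall>y\<in>ell2. \<exists>x\<in>ell2. \<exists>z\<in>lin_span F. y = (\<lambda>n. T x n + z n)))"

definition ess_spectrum :: "((nat \<Rightarrow> complex) \<Rightarrow> (nat \<Rightarrow> complex)) \<Rightarrow> complex set" where
  "ess_spectrum T = {z. \<not> ell2_fredholm (\<lambda>x n. T x n - z * x n)}"

section \<open>CMV matrices\<close>

text \<open>Infinite matrices are functions of a row and a column index, both starting at \<open>0\<close>.\<close>

definition dsum2 :: "(nat \<Rightarrow> complex mat) \<Rightarrow> nat \<Rightarrow> nat \<Rightarrow> complex" where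
  "dsum2 B i j = (if i div 2 = j div 2 then B (i div 2) $$ (i mod 2, j mod 2) else 0)"

definition one_dsum :: "(nat \<Rightarrow> nat \<Rightarrow> complex) \<Rightarrow> nat \<Rightarrow> nat \<Rightarrow> complex" where
  "one_dsum A i j =
     (if i = 0 \<and> j = 0 then 1 else if i = 0 \<or> j = 0 then 0 else A (i - 1) (j - 1))"

definition cmv_L :: "(nat \<Rightarrow> complex) \<Rightarrow> nat \<Rightarrow> nat \<Rightarrow> complex" where
  "cmv_L \<alpha> = dsum2 (\<lambda>m. Theta (\<alpha> (2 * m)))"

definition cmv_M :: "(nat \<Rightarrow> complex) \<Rightarrow> nat \<Rightarrow> nat \<Rightarrow> complex" where
  "cmv_M \<alpha> = one_dsum (dsum2 (\<lambda>m. Theta (\<alpha> (2 * m + 1))))"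

text \<open>Every row of \<open>cmv_L\<close> and \<open>cmv_M\<close> has at most two nonzero entries, so for these matrices
  the series below is a finite sum.\<close>

definition mat_op :: "(nat \<Rightarrow> nat \<Rightarrow> complex) \<Rightarrow> (nat \<Rightarrow> complex) \<Rightarrow> nat \<Rightarrow> complex" where
  "mat_op A x i = (\<Sum>j. A i j * x j)"

definition cmv :: "(nat \<Rightarrow> complex) \<Rightarrow> (nat \<Rightarrow> complex) \<Rightarrow> (nat \<Rightarrow> complex)" where
  "cmv \<alpha> = mat_op (cmv_L \<alpha>) \<circ> mat_op (cmv_M \<alpha>)"

section \<open>The finite limit matrices\<close>

definition unit1 :: "complex \<Rightarrow> complex mat" where
  "unit1 c = c \<cdot>\<^sub>m 1\<^sub>m 1"

text \<open>Only \<open>a 0, \<dots>, a k\<close> matter.  The odd (even) indices strictly between \<open>0\<close> and \<open>k\<close>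
  label the \<open>2 \<times> 2\<close> blocks of the first (second) factor.\<close>

definition C_tilde :: "nat \<Rightarrow> (nat \<Rightarrow> complex) \<Rightarrow> complex mat" where
  "C_tilde k a =
     (let odds = map (\<lambda>m. Theta (a m)) (filter odd [1..<k]);
          evens = map (\<lambda>m. Theta (a m)) (filter even [1..<k])
      in if even k
         then diag_block_mat odds
                * diag_block_mat ([unit1 (- a 0)] @ evens @ [unit1 (cnj (a k))])
         else diag_block_mat (odds @ [unit1 (cnj (a k))])
                * diag_block_mat ([unit1 (- a 0)] @ evens))"

definition limit_data ::
    "(nat \<Rightarrow> complex) \<Rightarrow> nat \<Rightarrow> (nat \<Rightarrow> nat) \<Rightarrow> (nat \<Rightarrow> complex) \<Rightarrow> bool" where
  "limit_data \<alpha> k n a \<longleftrightarrow>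
     filterlim n at_top sequentially \<and>
     (\<lambda>j. rho (\<alpha> (n j))) \<longlonglongrightarrow> 0 \<and>
     (\<lambda>j. rho (\<alpha> (n j + k))) \<longlonglongrightarrow> 0 \<and>
     (\<forall>m\<le>k. (\<lambda>j. \<alpha> (n j + m)) \<longlonglongrightarrow> a m) \<and>
     (\<forall>m\<in>{1..<k}. cmod (a m) \<noteq> 1)"

end

theory Submission
  imports Defs "HOL-Analysis.Inner_Product" "HOL-Analysis.Elementary_Metric_Spaces"
    "HOL-Computational_Algebra.Fundamental_Theorem_Algebra"
begin

text \<open>The essential spectrum is the set of \<open>z\<close> that admit approximate eigenvectors supported
  arbitrarily far out (\<open>weyl\<close>).  If \<open>z\<close> is not of this kind, then \<open>T = C - z\<close> is bounded below far out, so
  \<open>T\<^sup>* T\<close> plus a coordinate projection is coercive, hence onto; since \<open>T\<close> is normal, its range has finite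
  codimension.

  If all such \<open>z\<close> lie in a finite set \<open>\<Lambda>\<close> and \<open>p\<close> is the monic polynomial with simple roots \<open>\<Lambda>\<close>, then
  \<open>p(C)\<close> is small far out: almost maximizing vectors of \<open>p(C)\<close> would otherwise be approximate
  eigenvectors of \<open>p(C)\<^sup>* p(C)\<close>, and factoring the corresponding polynomial in \<open>C\<close> gives an approximate
  eigenvalue of \<open>C\<close> at which \<open>p\<close> does not vanish.  A matrix element of \<open>p(C)\<close>, after multiplication by a
  unitary operator, is a product of \<open>card \<Lambda>\<close> consecutive \<open>\<rho>\<close>; this gives (i), and, applied to a finite
  block, the simplicity of the spectrum in (ii).

  Conversely, under (i) the coefficients with small \<open>\<rho>\<close> cut the operator into blocks of length at most \<open>l\<close>.
  An approximate eigenvector far out has a good restriction to some block, and by compactness such blocks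
  converge to a limit matrix with eigenvalue \<open>z\<close>; eigenvectors of limit matrices in turn are transplanted
  to approximate eigenvectors.\<close>

section \<open>The Hilbert space of square-summable sequences\<close>

text \<open>No adjoint operator and no spectral theorem enters. The inner product of
  \<open>l2\<close> is the real part of the usual one, complex scalars act through
  \<open>cscale\<close>, roots of complex polynomials stand in for a functional calculus, and a
  contraction fixed point inverts the coercive operator. The smallness of p(C) is stated for an
  isometry with a decreasing family of subspaces because it is needed twice: for the tails, where it
  concerns the behaviour far out, and for a constant family, the sequences supported on one finite
  block, where it says that p(C) vanishes on the block. The kernel of C - z has dimension at most
  one even among all sequences, so the failure of the Fredholm property at an approximate eigenvalue
  has to be found in the range, which turns out not to be closed. The passage to limits meets one
  obstacle: a window between two coefficients with small \<open>rho\<close> may contain further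
  coefficients whose limits are unimodular, while condition (ii) admits none. The limit window has
  to be shortened to a piece between neighbouring unimodular limits on which the eigenvector does
  not vanish.\<close>

lemma ell2_add:
  assumes "x \<in> ell2" "y \<in> ell2"
  shows "(\<lambda>n. x n + y n) \<in> ell2"
proof -
  have "(cmod (a + b))\<^sup>2 \<le> 2 * (cmod a)\<^sup>2 + 2 * (cmod b)\<^sup>2" for a b :: complex
  proof -
    have "(cmod (a + b))\<^sup>2 \<le> (cmod a + cmod b)\<^sup>2"
      by (simp add: norm_triangle_ineq power_mono)
    also have "\<dots> \<le> 2 * (cmod a)\<^sup>2 + 2 * (cmod b)\<^sup>2"
      using sum_squares_bound[of "cmod a" "cmod b"] by (simp add: power2_sum)
    finally show ?thesis .
  qed
  moreover have "summable (\<lambda>n. 2 * (cmod (x n))\<^sup>2 + 2 * (cmod (y n))\<^sup>2)"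
    using assms by (auto simp: ell2_def intro: summable_add summable_mult)
  ultimately show ?thesis
    unfolding ell2_def by (auto intro: summable_comparison_test')
qed

lemma ell2_scale: "x \<in> ell2 \<Longrightarrow> (\<lambda>n. c * x n) \<in> ell2"
  by (auto simp: ell2_def norm_mult power_mult_distrib intro: summable_mult)

lemma ell2_zero: "(\<lambda>n. 0) \<in> ell2"
  by (simp add: ell2_def)

lemma ell2_minus: "x \<in> ell2 \<Longrightarrow> y \<in> ell2 \<Longrightarrow> (\<lambda>n. x n - y n) \<in> ell2"
  using ell2_add[of x "\<lambda>n. (-1) * y n"] ell2_scale[of y "-1"] by simp

lemma ell2_summable_inner:
  assumes "x \<in> ell2" "y \<in> ell2"
  shows "summable (\<lambda>n. inner (x n) (y n))"
proof -
  have "norm (inner a b) \<le> (cmod a)\<^sup>2 + (cmod b)\<^sup>2" for a b :: complex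
  proof -
    have "norm (inner a b) \<le> cmod a * cmod b"
      by (simp add: Cauchy_Schwarz_ineq2)
    also have "\<dots> \<le> (cmod a)\<^sup>2 + (cmod b)\<^sup>2"
      using sum_squares_bound[of "cmod a" "cmod b"] mult_nonneg_nonneg[of "cmod a" "cmod b"]
        norm_ge_zero[of a] norm_ge_zero[of b] by linarith
    finally show ?thesis .
  qed
  moreover have "summable (\<lambda>n. (cmod (x n))\<^sup>2 + (cmod (y n))\<^sup>2)"
    using assms by (auto simp: ell2_def intro: summable_add)
  ultimately show ?thesis
    by (auto intro: summable_comparison_test')
qed

typedef l2 = ell2 morphisms coord Abs_l2
  using ell2_zero by auto

setup_lifting type_definition_l2

instantiation l2 :: real_inner
begin

lift_definition zero_l2 :: l2 is "\<lambda>n. 0" by (rule ell2_zero)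
lift_definition plus_l2 :: "l2 \<Rightarrow> l2 \<Rightarrow> l2" is "\<lambda>x y n. x n + y n" by (rule ell2_add)
lift_definition minus_l2 :: "l2 \<Rightarrow> l2 \<Rightarrow> l2" is "\<lambda>x y n. x n - y n" by (rule ell2_minus)
lift_definition uminus_l2 :: "l2 \<Rightarrow> l2" is "\<lambda>x n. - x n"
  by (simp add: ell2_def)
lift_definition scaleR_l2 :: "real \<Rightarrow> l2 \<Rightarrow> l2" is "\<lambda>r x n. complex_of_real r * x n"
  by (rule ell2_scale)
lift_definition inner_l2 :: "l2 \<Rightarrow> l2 \<Rightarrow> real" is "\<lambda>x y. \<Sum>n. inner (x n) (y n)" .

definition norm_l2 :: "l2 \<Rightarrow> real" where "norm_l2 x = sqrt (inner x x)"
definition dist_l2 :: "l2 \<Rightarrow> l2 \<Rightarrow> real" where "dist_l2 x y = norm (x - y)"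
definition sgn_l2 :: "l2 \<Rightarrow> l2" where "sgn_l2 x = scaleR (inverse (norm x)) x"
definition uniformity_l2 :: "(l2 \<times> l2) filter"
  where "uniformity_l2 = (INF e\<in>{0 <..}. principal {(x, y). dist x y < e})"
definition open_l2 :: "l2 set \<Rightarrow> bool"
  where "open_l2 U \<longleftrightarrow> (\<forall>x\<in>U. \<forall>\<^sub>F (x', y) in uniformity. x' = x \<longrightarrow> y \<in> U)"

instance
proof
  fix a b c :: l2 and r s :: real
  show "a + b + c = a + (b + c)" by transfer (simp add: ac_simps)
  show "a + b = b + a" by transfer (simp add: ac_simps)
  show "0 + a = a" by transfer simp
  show "- a + a = 0" by transfer simp
  show "a - b = a + - b" by transfer simp
  show "r *\<^sub>R (a + b) = r *\<^sub>R a + r *\<^sub>R b" by transfer (simp add: algebra_simps)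
  show "(r + s) *\<^sub>R a = r *\<^sub>R a + s *\<^sub>R a" by transfer (simp add: algebra_simps)
  show "r *\<^sub>R s *\<^sub>R a = (r * s) *\<^sub>R a" by transfer (simp add: mult.assoc)
  show "1 *\<^sub>R a = a" by transfer simp
  show "dist a b = norm (a - b)" by (rule dist_l2_def)
  show "sgn a = inverse (norm a) *\<^sub>R a" by (rule sgn_l2_def)
  show "norm a = sqrt (inner a a)" by (rule norm_l2_def)
  show "inner a b = inner b a" by transfer (simp add: inner_commute)
  show "inner (a + b) c = inner a c + inner b c"
    by transfer (simp add: inner_add_left suminf_add ell2_summable_inner)
  show "inner (r *\<^sub>R a) b = r * inner a b"
    by transfer (simp add: suminf_mult[symmetric] ell2_summable_inner flip: scaleR_conv_of_real)
  show "0 \<le> inner a a"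
    by transfer (simp add: suminf_nonneg ell2_summable_inner)
  show "inner a a = 0 \<longleftrightarrow> a = 0"
    by transfer (auto simp: suminf_eq_zero_iff ell2_summable_inner fun_eq_iff)
qed (fact uniformity_l2_def open_l2_def)+

end

lemma coord_ell2 [simp]: "coord x \<in> ell2" using coord by simp

lemma coord_zero [simp]: "coord 0 n = 0" by transfer simp
lemma coord_add [simp]: "coord (x + y) n = coord x n + coord y n" by transfer simp
lemma coord_diff [simp]: "coord (x - y) n = coord x n - coord y n" by transfer simp
lemma coord_uminus [simp]: "coord (- x) n = - coord x n" by transfer simp
lemma coord_scaleR [simp]: "coord (r *\<^sub>R x) n = r *\<^sub>R coord x n"
  by transfer (simp add: scaleR_conv_of_real)
lemma coord_Abs [simp]: "x \<in> ell2 \<Longrightarrow> coord (Abs_l2 x) = x" by (rule Abs_l2_inverse)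

lemma l2_eqI: "(\<And>n. coord x n = coord y n) \<Longrightarrow> x = y"
  by (metis coord_inject ext)

lemma coord_sum [simp]: "coord (\<Sum>i\<in>A. f i) n = (\<Sum>i\<in>A. coord (f i) n)"
  by (induction A rule: infinite_finite_induct) auto

lemma summable_coord: "summable (\<lambda>n. (cmod (coord x n))\<^sup>2)"
  using coord_ell2[of x] by (simp only: ell2_def mem_Collect_eq)

lemma norm_l2_sq: "(norm (x::l2))\<^sup>2 = (\<Sum>n. (cmod (coord x n))\<^sup>2)"
  unfolding power2_norm_eq_inner by transfer (simp add: power2_norm_eq_inner)

lemma norm_l2_ell2_norm: "norm x = ell2_norm (coord x)"
  unfolding ell2_norm_def norm_l2_sq[symmetric] by simp

lemma sum_coord_le: "finite A \<Longrightarrow> (\<Sum>n\<in>A. (cmod (coord x n))\<^sup>2) \<le> (norm x)\<^sup>2"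
  unfolding norm_l2_sq by (intro sum_le_suminf summable_coord) auto

lemma norm_coord_le: "cmod (coord x n) \<le> norm x"
  using sum_coord_le[of "{n}" x] by (simp add: power2_le_iff_abs_le)

lemma ell2_bounded_partial_sums:
  assumes "\<And>N. (\<Sum>n<N. (cmod (x n))\<^sup>2) \<le> B"
  shows "x \<in> ell2" "(norm (Abs_l2 x))\<^sup>2 \<le> B"
proof -
  have "summable (\<lambda>n. (cmod (x n))\<^sup>2)"
  proof (rule bounded_imp_summable)
    show "(\<Sum>k\<le>n. (cmod (x k))\<^sup>2) \<le> B" for n
      using assms[of "Suc n"] by (simp add: lessThan_Suc_atMost)
  qed simp
  then show *: "x \<in> ell2" by (simp add: ell2_def)
  show "(norm (Abs_l2 x))\<^sup>2 \<le> B"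
    unfolding norm_l2_sq using * assms
    by (auto simp: ell2_def intro!: suminf_le_const)
qed

lemma norm_l2_leI:
  assumes "\<And>N. (\<Sum>n<N. (cmod (coord x n))\<^sup>2) \<le> B\<^sup>2" "0 \<le> B"
  shows "norm x \<le> B"
proof -
  have "(norm x)\<^sup>2 \<le> B\<^sup>2"
    using ell2_bounded_partial_sums(2)[OF assms(1)] by (simp add: coord_inverse)
  then show ?thesis using assms(2) by (rule power2_le_imp_le)
qed

instance l2 :: banach
proof
  fix X :: "nat \<Rightarrow> l2" assume X: "Cauchy X"
  have "Cauchy (\<lambda>m. coord (X m) n)" for n
  proof (rule metric_CauchyI)
    fix e :: real assume "e > 0"
    then obtain M where M: "\<And>i j. i \<ge> M \<Longrightarrow> j \<ge> M \<Longrightarrow> dist (X i) (X j) < e"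
      using metric_CauchyD[OF X] by blast
    have "dist (coord (X i) n) (coord (X j) n) < e" if "i \<ge> M" "j \<ge> M" for i j
      using M[OF that] norm_coord_le[of "X i - X j" n] by (simp add: dist_norm)
    then show "\<exists>M. \<forall>m\<ge>M. \<forall>k\<ge>M. dist (coord (X m) n) (coord (X k) n) < e" by blast
  qed
  then have "\<exists>l. (\<lambda>m. coord (X m) n) \<longlonglongrightarrow> l" for n
    using Cauchy_convergent convergent_def by blast
  then obtain y where y: "\<And>n. (\<lambda>m. coord (X m) n) \<longlonglongrightarrow> y n" by metis
  \<comment> \<open>In every finite partial sum the index k can be sent to infinity; the resulting
    bound is uniform in N and gives both that the limit lies in \<open>ell2\<close> and that the
    convergence holds in norm.\<close>
  have key: "\<exists>M. \<forall>m\<ge>M. \<forall>N. (\<Sum>n<N. (cmod (coord (X m) n - y n))\<^sup>2) \<le> e\<^sup>2" if "e > 0" for e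
  proof -
    obtain M where M: "\<And>i j. i \<ge> M \<Longrightarrow> j \<ge> M \<Longrightarrow> dist (X i) (X j) < e"
      using metric_CauchyD[OF X \<open>e > 0\<close>] by blast
    have "(\<Sum>n<N. (cmod (coord (X m) n - y n))\<^sup>2) \<le> e\<^sup>2" if "m \<ge> M" for m N
    proof (rule LIMSEQ_le_const2)
      show "(\<lambda>k. \<Sum>n<N. (cmod (coord (X m) n - coord (X k) n))\<^sup>2)
              \<longlonglongrightarrow> (\<Sum>n<N. (cmod (coord (X m) n - y n))\<^sup>2)"
        by (intro tendsto_intros y)
      have "(\<Sum>n<N. (cmod (coord (X m) n - coord (X k) n))\<^sup>2) \<le> e\<^sup>2" if "k \<ge> M" for k
      proof -
        have "norm (X m - X k) \<le> e" using M[OF \<open>m \<ge> M\<close> that] by (simp add: dist_norm)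
        then have "(norm (X m - X k))\<^sup>2 \<le> e\<^sup>2" by (simp add: power_mono)
        then show ?thesis using sum_coord_le[of "{..<N}" "X m - X k"] by simp
      qed
      then show "\<exists>M. \<forall>k\<ge>M. (\<Sum>n<N. (cmod (coord (X m) n - coord (X k) n))\<^sup>2) \<le> e\<^sup>2" by blast
    qed
    then show ?thesis by blast
  qed
  obtain m where "\<And>N. (\<Sum>n<N. (cmod (coord (X m) n - y n))\<^sup>2) \<le> 1\<^sup>2"
    using key[of 1] by auto
  then have "(\<lambda>n. coord (X m) n - y n) \<in> ell2" by (rule ell2_bounded_partial_sums)
  from ell2_minus[OF coord_ell2[of "X m"] this] have y_ell2: "y \<in> ell2" by simp
  have "X \<longlonglongrightarrow> Abs_l2 y"
  proof (rule metric_LIMSEQ_I)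
    fix r :: real assume "r > 0"
    then obtain M where M: "\<And>m N. m \<ge> M \<Longrightarrow> (\<Sum>n<N. (cmod (coord (X m) n - y n))\<^sup>2) \<le> (r/2)\<^sup>2"
      using key[of "r/2"] by auto
    have "dist (X m) (Abs_l2 y) < r" if "m \<ge> M" for m
    proof -
      have "norm (X m - Abs_l2 y) \<le> r/2"
        using M[OF that] y_ell2 \<open>r > 0\<close> by (intro norm_l2_leI) auto
      then show ?thesis using \<open>r > 0\<close> by (simp add: dist_norm)
    qed
    then show "\<exists>no. \<forall>n\<ge>no. dist (X n) (Abs_l2 y) < r" by blast
  qed
  then show "convergent X" by (auto simp: convergent_def)
qed

lift_definition cscale :: "complex \<Rightarrow> l2 \<Rightarrow> l2" (infixr "*\<^sub>C" 75) is "\<lambda>c x n. c * x n"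
  by (rule ell2_scale)

lemma coord_cscale [simp]: "coord (c *\<^sub>C x) n = c * coord x n" by transfer simp

lemma cscale_simps [simp]:
  "c *\<^sub>C (x + y) = c *\<^sub>C x + c *\<^sub>C y" "c *\<^sub>C (x - y) = c *\<^sub>C x - c *\<^sub>C y"
  "c *\<^sub>C d *\<^sub>C x = (c * d) *\<^sub>C x" "1 *\<^sub>C x = x" "0 *\<^sub>C x = 0" "c *\<^sub>C 0 = 0"
  "c *\<^sub>C (- x) = - (c *\<^sub>C x)" "(- c) *\<^sub>C x = - (c *\<^sub>C x)"
  by (auto intro!: l2_eqI simp: algebra_simps)

lemma cscale_add_left: "(c + d) *\<^sub>C x = c *\<^sub>C x + d *\<^sub>C x"
  by (auto intro!: l2_eqI simp: algebra_simps)

lemma cscale_diff_left: "(c - d) *\<^sub>C x = c *\<^sub>C x - d *\<^sub>C x"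
  by (auto intro!: l2_eqI simp: algebra_simps)

lemma cscale_of_real: "complex_of_real r *\<^sub>C x = r *\<^sub>R x"
  by (auto intro!: l2_eqI simp: scaleR_conv_of_real)

lemma norm_cscale [simp]: "norm (c *\<^sub>C x) = cmod c * norm x"
proof -
  have "(norm (c *\<^sub>C x))\<^sup>2 = (cmod c * norm x)\<^sup>2"
    by (simp add: norm_l2_sq power_mult_distrib norm_mult suminf_mult summable_coord)
  then show ?thesis by (simp add: power2_eq_iff_nonneg)
qed

text \<open>\<open>inner\<close> is the real part of the Hermitian product, so moving a complex
  factor to the other side still conjugates it.\<close>

lemma inner_cscale: "inner (c *\<^sub>C x) y = inner x (cnj c *\<^sub>C y)"
  by transfer (simp add: inner_complex_def algebra_simps)

definition unitv :: "nat \<Rightarrow> l2" where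
  "unitv n = Abs_l2 (\<lambda>i. if i = n then 1 else 0)"

lemma ell2_finite_support: "finite {i. x i \<noteq> 0} \<Longrightarrow> x \<in> ell2"
  unfolding ell2_def by (auto intro!: summable_finite[of "{i. x i \<noteq> 0}"])

lemma coord_unitv [simp]: "coord (unitv n) i = (if i = n then 1 else 0)"
  unfolding unitv_def by (subst coord_Abs) (auto intro: ell2_finite_support)

lemma norm_unitv [simp]: "norm (unitv n) = 1"
proof -
  have "(norm (unitv n))\<^sup>2 = (\<Sum>i. if i = n then 1 else 0)"
    unfolding norm_l2_sq by (rule arg_cong[where f = suminf]) auto
  also have "\<dots> = 1" using suminf_finite[of "{n}" "\<lambda>i. if i = n then 1 else 0 :: real"] by simp
  finally show ?thesis using norm_ge_zero[of "unitv n"] by (simp add: power2_eq_1_iff)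
qed

lift_definition trunc :: "nat \<Rightarrow> l2 \<Rightarrow> l2" is "\<lambda>N x i. if i < N then x i else 0"
  by (rule ell2_finite_support) (simp add: Collect_conj_eq)

lemma coord_trunc [simp]: "coord (trunc N x) i = (if i < N then coord x i else 0)"
  by transfer simp

lemma trunc_tendsto: "(\<lambda>N. trunc N x) \<longlonglongrightarrow> x"
proof (rule metric_LIMSEQ_I)
  fix r :: real assume "r > 0"
  obtain M where M: "\<And>N. N \<ge> M \<Longrightarrow> norm (\<Sum>n. (cmod (coord x (n + N)))\<^sup>2) < r\<^sup>2"
    using suminf_exist_split[OF _ summable_coord[of x], of "r\<^sup>2"] \<open>r > 0\<close> by auto
  have "dist (trunc N x) x < r" if "N \<ge> M" for N
  proof -
    have "(norm (x - trunc N x))\<^sup>2 = (\<Sum>n. (cmod (coord (x - trunc N x) (n + N)))\<^sup>2)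
             + (\<Sum>n<N. (cmod (coord (x - trunc N x) n))\<^sup>2)"
      unfolding norm_l2_sq by (rule suminf_split_initial_segment) (rule summable_coord)
    also have "\<dots> < r\<^sup>2" using M[OF that] by simp
    finally show ?thesis using \<open>r > 0\<close>
      by (metis dist_commute dist_norm less_le power2_less_imp_less)
  qed
  then show "\<exists>no. \<forall>n\<ge>no. dist (trunc n x) x < r" by blast
qed

section \<open>CMV operators\<close>

lemma rho_sq: "cmod a \<le> 1 \<Longrightarrow> (rho a)\<^sup>2 = 1 - (cmod a)\<^sup>2"
  by (simp add: rho_def power_le_one)

lemma rho_nonneg: "cmod a \<le> 1 \<Longrightarrow> 0 \<le> rho a"
  by (simp add: rho_def power_le_one)

lemma rho_le_1: "cmod a \<le> 1 \<Longrightarrow> rho a \<le> 1"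
  by (simp add: rho_def)

lemma rho_eq_0_iff: "rho a = 0 \<longleftrightarrow> cmod a = 1"
  using norm_ge_zero[of a] by (auto simp: rho_def power2_eq_1_iff simp del: norm_ge_zero)

lemma rho_cnj [simp]: "rho (cnj a) = rho a"
  by (simp add: rho_def)

lemma tendsto_rho: "(f \<longlongrightarrow> a) F \<Longrightarrow> ((\<lambda>x. rho (f x)) \<longlongrightarrow> rho a) F"
  unfolding rho_def by (intro tendsto_intros)

text \<open>\<open>layer \<alpha> c\<close> is the direct sum of the \<open>\<Theta>(\<alpha>\<^sub>m)\<close> with \<open>m \<equiv> c\<close> modulo 2, where \<open>\<Theta>(\<alpha>\<^sub>m)\<close> acts on the coordinates
  \<open>m\<close> and \<open>m + 1\<close>; so \<open>L\<close> is \<open>layer \<alpha> 0\<close> and \<open>M\<close> is \<open>layer \<alpha> 1\<close>.  The general version with independent \<open>a\<close>, \<open>r\<close>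
  and corner entry \<open>b\<close> includes the differences of two layers.\<close>

definition glay :: "complex \<Rightarrow> (nat \<Rightarrow> complex) \<Rightarrow> (nat \<Rightarrow> real) \<Rightarrow> nat \<Rightarrow> (nat \<Rightarrow> complex) \<Rightarrow> nat \<Rightarrow> complex" where
  "glay b a r c x i =
     (if even (i + c) then cnj (a i) * x i + r i * x (Suc i)
      else if i = 0 then b * x 0 else r (i - 1) * x (i - 1) - a (i - 1) * x i)"

definition layer :: "(nat \<Rightarrow> complex) \<Rightarrow> nat \<Rightarrow> (nat \<Rightarrow> complex) \<Rightarrow> nat \<Rightarrow> complex" where
  "layer \<alpha> = glay 1 \<alpha> (\<lambda>i. rho (\<alpha> i))"

text \<open>The block with rows \<open>(cnj a, r)\<close> and \<open>(r, - a)\<close> is a multiple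
  of a unitary matrix for every real r, related to a or not. Differences of two layers can therefore
  be estimated in the same way as a single layer.\<close>

lemma pair_identity:
  fixes a x y :: complex and r :: real
  shows "(cmod (cnj a * x + r * y))\<^sup>2 + (cmod (r * x - a * y))\<^sup>2
       = ((cmod a)\<^sup>2 + r\<^sup>2) * ((cmod x)\<^sup>2 + (cmod y)\<^sup>2)"
  unfolding cmod_power2 by (simp add: power2_eq_square algebra_simps)

text \<open>The cut at \<open>c mod 2 + 2 * m\<close> splits no block: for odd c the corner entry at
  0 stands alone and the blocks start at 1.\<close>

lemma glay_partial_sum:
  assumes "\<And>i. (cmod (a i))\<^sup>2 + (r i)\<^sup>2 \<le> K" "(cmod b)\<^sup>2 \<le> K"
  shows "(\<Sum>n < c mod 2 + 2 * m. (cmod (glay b a r c x n))\<^sup>2)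
           \<le> K * (\<Sum>n < c mod 2 + 2 * m. (cmod (x n))\<^sup>2)"
proof (induction m)
  case 0
  show ?case
    using assms(2) by (cases "even c") (auto simp: glay_def norm_mult power_mult_distrib
        mult_right_mono mod_2_eq_odd)
next
  case (Suc m)
  let ?N = "c mod 2 + 2 * m"
  have ev: "even (?N + c)" by presburger
  have "(cmod (glay b a r c x ?N))\<^sup>2 + (cmod (glay b a r c x (Suc ?N)))\<^sup>2
      = ((cmod (a ?N))\<^sup>2 + (r ?N)\<^sup>2) * ((cmod (x ?N))\<^sup>2 + (cmod (x (Suc ?N)))\<^sup>2)"
    unfolding glay_def using ev by (simp add: pair_identity)
  also have "\<dots> \<le> K * ((cmod (x ?N))\<^sup>2 + (cmod (x (Suc ?N)))\<^sup>2)"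
    by (intro mult_right_mono assms) auto
  finally show ?case using Suc.IH by (simp add: algebra_simps)
qed

lemma
  fixes x :: l2
  assumes a: "\<And>i. (cmod (a i))\<^sup>2 + (r i)\<^sup>2 \<le> K\<^sup>2" and b: "cmod b \<le> K"
  shows ell2_glay: "glay b a r c (coord x) \<in> ell2"
    and norm_glay: "norm (Abs_l2 (glay b a r c (coord x))) \<le> K * norm x"
proof -
  have K: "0 \<le> K" using b norm_ge_zero[of b] by linarith
  have *: "(\<Sum>n<N. (cmod (glay b a r c (coord x) n))\<^sup>2) \<le> (K * norm x)\<^sup>2" for N
  proof -
    let ?M = "c mod 2 + 2 * N"
    have "(\<Sum>n<N. (cmod (glay b a r c (coord x) n))\<^sup>2) \<le> (\<Sum>n<?M. (cmod (glay b a r c (coord x) n))\<^sup>2)"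
      by (intro sum_mono2) auto
    also have "\<dots> \<le> K\<^sup>2 * (\<Sum>n<?M. (cmod (coord x n))\<^sup>2)"
      using a b by (intro glay_partial_sum) (auto simp: power_mono)
    also have "\<dots> \<le> K\<^sup>2 * (norm x)\<^sup>2"
      by (intro mult_left_mono sum_coord_le) auto
    finally show ?thesis by (simp add: power_mult_distrib)
  qed
  then show 1: "glay b a r c (coord x) \<in> ell2" by (rule ell2_bounded_partial_sums)
  show "norm (Abs_l2 (glay b a r c (coord x))) \<le> K * norm x"
    by (rule norm_l2_leI) (use 1 * K in auto)
qed

lemma layer_even: "even (i + c) \<Longrightarrow> layer \<alpha> c x i = cnj (\<alpha> i) * x i + complex_of_real (rho (\<alpha> i)) * x (Suc i)"
  by (simp add: layer_def glay_def)

lemma layer_odd: "odd (i + c) \<Longrightarrow> 0 < i \<Longrightarrow>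
    layer \<alpha> c x i = complex_of_real (rho (\<alpha> (i - 1))) * x (i - 1) - \<alpha> (i - 1) * x i"
  by (simp add: layer_def glay_def)

lemma layer_0: "odd c \<Longrightarrow> layer \<alpha> c x 0 = x 0"
  by (simp add: layer_def glay_def)

lemma layer_add: "layer \<alpha> c (\<lambda>n. x n + y n) = (\<lambda>i. layer \<alpha> c x i + layer \<alpha> c y i)"
  by (auto simp: layer_def glay_def algebra_simps)

lemma layer_scale: "layer \<alpha> c (\<lambda>n. s * x n) = (\<lambda>i. s * layer \<alpha> c x i)"
  by (auto simp: layer_def glay_def algebra_simps)

lemma layer_zero: "layer \<alpha> c (\<lambda>n. 0) = (\<lambda>n. 0)"
  by (auto simp: layer_def glay_def)

text \<open>\<open>Theta a\<close> is symmetric and, for \<open>cmod a \<le> 1\<close>, unitary; so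
  its inverse is its entrywise conjugate \<open>Theta (cnj a)\<close>.\<close>

lemma layer_inverse:
  assumes "\<And>i. cmod (\<alpha> i) \<le> 1"
  shows "layer (\<lambda>i. cnj (\<alpha> i)) c (layer \<alpha> c x) = x"
proof
  fix i
  have *: "complex_of_real (rho a) * (rho a) = 1 - a * cnj a" if "cmod a \<le> 1" for a
  proof -
    have "complex_of_real (rho a) * (rho a) = complex_of_real ((rho a)\<^sup>2)"
      by (simp add: power2_eq_square)
    also have "\<dots> = 1 - complex_of_real ((cmod a)\<^sup>2)" using rho_sq[OF that] by simp
    also have "\<dots> = 1 - a * cnj a" by (simp only: complex_norm_square)
    finally show ?thesis .
  qed
  show "layer (\<lambda>i. cnj (\<alpha> i)) c (layer \<alpha> c x) i = x i"
  proof (cases "even (i + c)")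
    case True
    have "layer (\<lambda>i. cnj (\<alpha> i)) c (layer \<alpha> c x) i
        = (\<alpha> i * cnj (\<alpha> i) + complex_of_real (rho (\<alpha> i)) * rho (\<alpha> i)) * x i"
      using True by (simp add: layer_def glay_def algebra_simps)
    then show ?thesis using *[OF assms[of i]] by simp
  next
    case False
    show ?thesis
    proof (cases i)
      case 0 then show ?thesis using False by (simp add: layer_0)
    next
      case (Suc j)
      have "layer (\<lambda>i. cnj (\<alpha> i)) c (layer \<alpha> c x) i
          = (\<alpha> j * cnj (\<alpha> j) + complex_of_real (rho (\<alpha> j)) * rho (\<alpha> j)) * x i"
        using False Suc by (simp add: layer_def glay_def algebra_simps)
      then show ?thesis using *[OF assms[of j]] by simp
    qed
  qed
qed

text \<open>\<open>rho\<close> vanishes at p and q, so no row in \<open>{p<..q}\<close> sees a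
  coordinate outside. The coefficients must agree from p on, because the entry
  \<open>- \<beta> p\<close> may sit in row p + 1; the vectors only have to agree after p. The shift
  s is even because the rows alternate in type.\<close>

lemma layer_local:
  assumes "cmod (\<beta> p) = 1" "cmod (\<beta> q) = 1" "p < i" "i \<le> q" "even s" "s \<le> p"
    and "\<And>m. p \<le> m \<Longrightarrow> m \<le> q \<Longrightarrow> \<beta>' (m - s) = \<beta> m"
    and "\<And>m. p < m \<Longrightarrow> m \<le> q \<Longrightarrow> x' (m - s) = x m"
  shows "layer \<beta> c x i = layer \<beta>' c x' (i - s)"
proof -
  have r: "rho (\<beta> p) = 0" "rho (\<beta> q) = 0" using assms by (simp_all add: rho_eq_0_iff)
  have par: "even (i - s + c) \<longleftrightarrow> even (i + c)" using assms by auto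
  show ?thesis
  proof (cases "even (i + c)")
    case True
    have "rho (\<beta> i) * x (Suc i) = rho (\<beta>' (i - s)) * x' (Suc (i - s))"
    proof (cases "i = q")
      case True then show ?thesis using assms(3,4,6,7) r by simp
    next
      case False
      then show ?thesis using assms(3,4,6) assms(7)[of i] assms(8)[of "Suc i"] by (simp add: Suc_diff_le)
    qed
    moreover have "even (i - s + c)" using True par by simp
    ultimately show ?thesis
      using assms(3,4) assms(7,8)[of i] unfolding layer_even[OF True] by (subst layer_even) auto
  next
    case False
    have "rho (\<beta> (i-1)) * x (i-1) = rho (\<beta>' (i - s - 1)) * x' (i - s - 1)"
    proof (cases "i - 1 = p")
      case True
      then have "i = Suc p" using assms(3) by simp
      then have "i - s - 1 = p - s" using assms(6) by simp
      then show ?thesis using True assms(3,4) assms(7)[of p] r by simp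
    next
      case False
      then have "p < i - 1" "i - 1 \<le> q" using assms(3,4) by auto
      then show ?thesis using assms(7,8)[of "i - 1"] by (simp add: diff_right_commute)
    qed
    moreover have "\<beta>' (i - s - 1) = \<beta> (i - 1)"
      using assms(3,4) assms(7)[of "i - 1"] by (simp add: diff_right_commute)
    moreover have "0 < i" and pos: "0 < i - s" using assms(3,6) by auto
    moreover have odd: "odd (i - s + c)" using False par by simp
    ultimately show ?thesis
      using assms(3,4) assms(8)[of i] unfolding layer_odd[OF odd pos]
      by (subst layer_odd) (use False in auto)
  qed
qed

definition Layer :: "(nat \<Rightarrow> complex) \<Rightarrow> nat \<Rightarrow> l2 \<Rightarrow> l2" where
  "Layer \<alpha> c x = Abs_l2 (layer \<alpha> c (coord x))"

definition Cmv :: "(nat \<Rightarrow> complex) \<Rightarrow> l2 \<Rightarrow> l2" where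
  "Cmv \<alpha> x = Layer \<alpha> 0 (Layer \<alpha> 1 x)"

definition Cmv_inv :: "(nat \<Rightarrow> complex) \<Rightarrow> l2 \<Rightarrow> l2" where
  "Cmv_inv \<alpha> x = Layer (\<lambda>i. cnj (\<alpha> i)) 1 (Layer (\<lambda>i. cnj (\<alpha> i)) 0 x)"

context
  fixes \<alpha> :: "nat \<Rightarrow> complex"
  assumes le1: "\<And>i. cmod (\<alpha> i) \<le> 1"
begin

lemma coord_Layer: "coord (Layer \<alpha> c x) = layer \<alpha> c (coord x)"
  and norm_Layer_le: "norm (Layer \<alpha> c x) \<le> norm x"
proof -
  have *: "(cmod (\<alpha> i))\<^sup>2 + (rho (\<alpha> i))\<^sup>2 \<le> 1\<^sup>2" for i
    using le1 by (simp add: rho_sq)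
  show "coord (Layer \<alpha> c x) = layer \<alpha> c (coord x)"
    unfolding Layer_def layer_def using ell2_glay[OF *, of 1] by (subst coord_Abs) auto
  show "norm (Layer \<alpha> c x) \<le> norm x"
    unfolding Layer_def layer_def using norm_glay[OF *, of 1] by auto
qed

lemma Layer_add: "Layer \<alpha> c (x + y) = Layer \<alpha> c x + Layer \<alpha> c y"
proof -
  have "coord (x + y) = (\<lambda>n. coord x n + coord y n)" by auto
  then show ?thesis by (intro l2_eqI) (simp add: coord_Layer layer_add)
qed

lemma Layer_cscale: "Layer \<alpha> c (s *\<^sub>C x) = s *\<^sub>C Layer \<alpha> c x"
proof -
  have "coord (s *\<^sub>C x) = (\<lambda>n. s * coord x n)" by auto
  then show ?thesis by (intro l2_eqI) (simp add: coord_Layer layer_scale)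
qed

end

text \<open>A new context, so that the facts of the previous one can be applied to the conjugate
  coefficients as well.\<close>

context
  fixes \<alpha> :: "nat \<Rightarrow> complex"
  assumes le1: "\<And>i. cmod (\<alpha> i) \<le> 1"
begin

lemma cnj_le1: "cmod (cnj (\<alpha> i)) \<le> 1" using le1 by simp

lemma Layer_inverse: "Layer (\<lambda>i. cnj (\<alpha> i)) c (Layer \<alpha> c x) = x"
  "Layer \<alpha> c (Layer (\<lambda>i. cnj (\<alpha> i)) c x) = x"
  using layer_inverse[of \<alpha> c "coord x"] layer_inverse[of "\<lambda>i. cnj (\<alpha> i)" c "coord x"] le1
  by (auto intro!: l2_eqI simp: coord_Layer)

lemma norm_Layer: "norm (Layer \<alpha> c x) = norm x"
  using norm_Layer_le[of \<alpha>, OF le1, where c = c and x = x]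
    norm_Layer_le[of "\<lambda>i. cnj (\<alpha> i)", OF cnj_le1, where c = c and x = "Layer \<alpha> c x"]
  by (simp add: Layer_inverse)

lemma Cmv_add: "Cmv \<alpha> (x + y) = Cmv \<alpha> x + Cmv \<alpha> y"
  by (simp add: Cmv_def Layer_add le1)

lemma Cmv_cscale: "Cmv \<alpha> (s *\<^sub>C x) = s *\<^sub>C Cmv \<alpha> x"
  by (simp add: Cmv_def Layer_cscale le1)

lemma norm_Cmv: "norm (Cmv \<alpha> x) = norm x"
  by (simp add: Cmv_def norm_Layer)

lemma Cmv_inverse: "Cmv \<alpha> (Cmv_inv \<alpha> x) = x" "Cmv_inv \<alpha> (Cmv \<alpha> x) = x"
  by (simp_all add: Cmv_def Cmv_inv_def Layer_inverse)

lemma coord_Cmv: "coord (Cmv \<alpha> x) = layer \<alpha> 0 (layer \<alpha> 1 (coord x))"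
  by (simp add: Cmv_def coord_Layer le1)

end

text \<open>The corner entries 1 cancel and the difference is again a \<open>glay\<close>, with
  corner 0. Closeness of \<open>rho\<close> is a separate hypothesis because \<open>rho\<close> is
  not Lipschitz at the unit circle.\<close>

lemma Layer_perturb:
  assumes "\<And>i. cmod (\<alpha> i) \<le> 1" "\<And>i. cmod (\<beta> i) \<le> 1"
    and "\<And>i. cmod (\<alpha> i - \<beta> i) \<le> d" "\<And>i. \<bar>rho (\<alpha> i) - rho (\<beta> i)\<bar> \<le> d"
  shows "norm (Layer \<alpha> c x - Layer \<beta> c x) \<le> 2 * d * norm x"
proof -
  have d: "0 \<le> d" using order_trans[OF norm_ge_zero assms(3)] by blast
  have *: "(cmod (\<alpha> i - \<beta> i))\<^sup>2 + (rho (\<alpha> i) - rho (\<beta> i))\<^sup>2 \<le> (2 * d)\<^sup>2" for i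
  proof -
    have "(cmod (\<alpha> i - \<beta> i))\<^sup>2 \<le> d\<^sup>2" using assms(3) by (simp add: power_mono)
    moreover have "(rho (\<alpha> i) - rho (\<beta> i))\<^sup>2 \<le> d\<^sup>2"
      using assms(4)[of i] d power_mono[of "\<bar>rho (\<alpha> i) - rho (\<beta> i)\<bar>" d 2] by simp
    moreover have "(2 * d)\<^sup>2 = 4 * d\<^sup>2" by (simp add: power_mult_distrib)
    ultimately show ?thesis using zero_le_power2[of d] by linarith
  qed
  have "Layer \<alpha> c x - Layer \<beta> c x
      = Abs_l2 (glay 0 (\<lambda>i. \<alpha> i - \<beta> i) (\<lambda>i. rho (\<alpha> i) - rho (\<beta> i)) c (coord x))"
    by (intro l2_eqI, subst coord_Abs, rule ell2_glay[OF *])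
       (use d in \<open>auto simp: coord_Layer assms layer_def glay_def algebra_simps\<close>)
  then show ?thesis using norm_glay[OF *] d by simp
qed

lemma Cmv_perturb:
  assumes "\<And>i. cmod (\<alpha> i) \<le> 1" "\<And>i. cmod (\<beta> i) \<le> 1"
    and "\<And>i. cmod (\<alpha> i - \<beta> i) \<le> d" "\<And>i. \<bar>rho (\<alpha> i) - rho (\<beta> i)\<bar> \<le> d"
  shows "norm (Cmv \<alpha> x - Cmv \<beta> x) \<le> 4 * d * norm x"
proof -
  have *: "Layer \<alpha> 0 u - Layer \<alpha> 0 v = Layer \<alpha> 0 (u - v)" for u v
    using Layer_add[OF assms(1), where c = 0 and x = "u - v" and y = v] by simp
  have "Cmv \<alpha> x - Cmv \<beta> x = Layer \<alpha> 0 (Layer \<alpha> 1 x - Layer \<beta> 1 x)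
      + (Layer \<alpha> 0 (Layer \<beta> 1 x) - Layer \<beta> 0 (Layer \<beta> 1 x))"
    unfolding Cmv_def *[symmetric] by simp
  also have "norm \<dots> \<le> 2 * d * norm x + 2 * d * norm x"
    using Layer_perturb[OF assms, where c = 1 and x = x]
      Layer_perturb[OF assms, where c = 0 and x = "Layer \<beta> 1 x"]
    by (intro norm_triangle_le add_mono) (simp_all add: norm_Layer assms(1,2))
  finally show ?thesis by simp
qed

section \<open>The CMV matrix as a product of two layers\<close>

lemma mat_op_two_terms:
  assumes "\<And>j. j \<notin> {p, q} \<Longrightarrow> A i j = 0" "p \<noteq> q"
  shows "mat_op A x i = A i p * x p + A i q * x q"
  unfolding mat_op_def using assms by (subst suminf_finite[of "{p, q}"]) auto

lemma Theta_entries [simp]: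
  "Theta a $$ (0, 0) = cnj a" "Theta a $$ (0, Suc 0) = rho a"
  "Theta a $$ (Suc 0, 0) = rho a" "Theta a $$ (Suc 0, Suc 0) = - a"
  by (simp_all add: Theta_def mat_of_rows_list_def)

lemma dim_Theta [simp]: "dim_row (Theta a) = 2" "dim_col (Theta a) = 2"
  by (simp_all add: Theta_def mat_of_rows_list_def)

lemma mat_op_cmv_L: "mat_op (cmv_L \<alpha>) x = layer \<alpha> 0 x"
proof
  fix i
  have "mat_op (cmv_L \<alpha>) x i = cmv_L \<alpha> i (2 * (i div 2)) * x (2 * (i div 2))
      + cmv_L \<alpha> i (Suc (2 * (i div 2))) * x (Suc (2 * (i div 2)))"
    by (rule mat_op_two_terms) ((simp add: cmv_L_def dsum2_def, presburger), presburger)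
  also have "\<dots> = layer \<alpha> 0 x i"
    by (cases "even i") (auto elim!: evenE oddE simp: cmv_L_def dsum2_def layer_def glay_def)
  finally show "mat_op (cmv_L \<alpha>) x i = layer \<alpha> 0 x i" .
qed

lemma mat_op_cmv_M: "mat_op (cmv_M \<alpha>) x = layer \<alpha> 1 x"
proof
  fix i
  show "mat_op (cmv_M \<alpha>) x i = layer \<alpha> 1 x i"
  proof (cases i)
    case 0
    have "mat_op (cmv_M \<alpha>) x i = cmv_M \<alpha> i 0 * x 0 + cmv_M \<alpha> i 1 * x 1"
      by (rule mat_op_two_terms) (auto simp: 0 cmv_M_def one_dsum_def)
    then show ?thesis by (simp add: 0 cmv_M_def one_dsum_def layer_0)
  next
    case (Suc k)
    let ?b = "Suc (2 * (k div 2))"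
    have "mat_op (cmv_M \<alpha>) x i = cmv_M \<alpha> i ?b * x ?b + cmv_M \<alpha> i (Suc ?b) * x (Suc ?b)"
      by (rule mat_op_two_terms) ((simp add: Suc cmv_M_def one_dsum_def dsum2_def, presburger), presburger)
    also have "\<dots> = layer \<alpha> 1 x i"
      by (cases "even k") (auto elim!: evenE oddE simp: Suc cmv_M_def one_dsum_def dsum2_def layer_def glay_def)
    finally show ?thesis .
  qed
qed

lemma cmv_layer: "cmv \<alpha> x = layer \<alpha> 0 (layer \<alpha> 1 x)"
  by (simp add: cmv_def mat_op_cmv_L mat_op_cmv_M)

lemma coord_Cmv_cmv: "(\<And>i. cmod (\<alpha> i) \<le> 1) \<Longrightarrow> coord (Cmv \<alpha> x) = cmv \<alpha> (coord x)"
  by (simp add: coord_Cmv cmv_layer)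

definition tail :: "nat \<Rightarrow> l2 set" where
  "tail N = {x. \<forall>i<N. coord x i = 0}"

lemma Layer_tail:
  assumes "\<And>i. cmod (\<alpha> i) \<le> 1" "x \<in> tail (Suc N)"
  shows "Layer \<alpha> c x \<in> tail N"
  using assms(2) by (auto simp: tail_def coord_Layer assms(1) layer_def glay_def)

text \<open>A layer couples neighbouring coordinates only, so each of the two layers costs one site;
  this is the 2 in the assumption \<open>U_S\<close> below.\<close>

lemma Cmv_tail:
  assumes "\<And>i. cmod (\<alpha> i) \<le> 1" "x \<in> tail (N + 2)"
  shows "Cmv \<alpha> x \<in> tail N"
  unfolding Cmv_def using assms by (intro Layer_tail) auto

section \<open>Polynomials of an isometry\<close>

text \<open>Horner's scheme; the recursion over \<open>pCons\<close> makes induction on polynomials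
  available.\<close>

definition polyop :: "(l2 \<Rightarrow> l2) \<Rightarrow> complex poly \<Rightarrow> l2 \<Rightarrow> l2" where
  "polyop U p = fold_coeffs (\<lambda>a f x. a *\<^sub>C x + U (f x)) p (\<lambda>x. 0)"

locale filtered_isometry =
  fixes U :: "l2 \<Rightarrow> l2" and S :: "nat \<Rightarrow> l2 set"
  assumes U_add: "U (x + y) = U x + U y"
    and U_cscale: "U (c *\<^sub>C x) = c *\<^sub>C U x"
    and norm_U: "norm (U x) = norm x"
    and S_add: "x \<in> S N \<Longrightarrow> y \<in> S N \<Longrightarrow> x + y \<in> S N"
    and S_cscale: "x \<in> S N \<Longrightarrow> c *\<^sub>C x \<in> S N"
    and S_antimono: "M \<le> N \<Longrightarrow> S N \<subseteq> S M"
    and U_S: "x \<in> S (N + 2) \<Longrightarrow> U x \<in> S N"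
begin

definition approx_spec :: "complex \<Rightarrow> bool" where
  "approx_spec z \<longleftrightarrow> (\<forall>N. \<forall>e>0. \<exists>x\<in>S N. norm x = 1 \<and> norm (U x - z *\<^sub>C x) < e)"

lemma U_zero: "U 0 = 0"
  using norm_U[of 0] by simp

lemma U_uminus: "U (- x) = - U x"
  using U_cscale[of "-1" x] by simp

lemma U_diff: "U (x - y) = U x - U y"
  using U_add[of x "- y"] by (simp add: U_uminus)

text \<open>Polarization, from comparing the norms of \<open>U (x + y)\<close> and
  \<open>x + y\<close>.\<close>

lemma inner_U: "inner (U x) (U y) = inner x y"
proof -
  have "(norm (U (x + y)))\<^sup>2 = (norm (x + y))\<^sup>2" by (simp add: norm_U)
  moreover have "inner (U x) (U x) = inner x x" for x
    using norm_U[of x] by (simp add: norm_eq_sqrt_inner)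
  ultimately show ?thesis
    by (simp add: U_add power2_norm_eq_inner inner_add inner_commute)
qed

lemma norm_Upow: "norm ((U ^^ n) x) = norm x"
  by (induction n) (simp_all add: norm_U)

lemma approx_spec_norm: "approx_spec z \<Longrightarrow> cmod z = 1"
proof (rule ccontr)
  assume "approx_spec z" "cmod z \<noteq> 1"
  then obtain x where x: "norm x = 1" "norm (U x - z *\<^sub>C x) < \<bar>1 - cmod z\<bar>"
    unfolding approx_spec_def by (metis zero_less_abs_iff eq_iff_diff_eq_0)
  have "\<bar>norm (U x) - norm (z *\<^sub>C x)\<bar> \<le> norm (U x - z *\<^sub>C x)"
    by (rule norm_triangle_ineq3)
  with x show False by (simp add: norm_U)
qed

lemma polyop_0 [simp]: "polyop U 0 x = 0"
  by (simp add: polyop_def)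

lemma polyop_pCons [simp]: "polyop U (pCons a p) x = a *\<^sub>C x + U (polyop U p x)"
  by (cases "a = 0 \<and> p = 0") (auto simp: polyop_def U_zero)

lemma polyop_1 [simp]: "polyop U 1 x = x"
  by (simp add: one_pCons U_zero)

lemma polyop_add_right: "polyop U p (x + y) = polyop U p x + polyop U p y"
  by (induction p) (simp_all add: U_add)

lemma polyop_cscale: "polyop U p (c *\<^sub>C x) = c *\<^sub>C polyop U p x"
  by (induction p) (simp_all add: U_cscale mult.commute)

lemma polyop_U: "polyop U p (U x) = U (polyop U p x)"
  by (induction p) (simp_all add: U_cscale U_add U_zero)

lemma polyop_diff_right: "polyop U p (x - y) = polyop U p x - polyop U p y"
  using polyop_add_right[of p "x - y" y] by (simp add: algebra_simps)

lemma polyop_add: "polyop U (p + q) x = polyop U p x + polyop U q x"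
proof (induction p q rule: poly_induct2)
  case (pCons a p b q)
  then show ?case by (simp add: cscale_add_left U_add)
qed simp

lemma polyop_smult: "polyop U (Polynomial.smult c p) x = c *\<^sub>C polyop U p x"
  by (induction p) (simp_all add: U_cscale)

lemma polyop_diff: "polyop U (p - q) x = polyop U p x - polyop U q x"
  using polyop_add[of "p - q" q x] by (simp add: algebra_simps)

lemma polyop_mult: "polyop U (p * q) x = polyop U p (polyop U q x)"
  by (induction p) (simp_all add: polyop_add polyop_smult)

lemma polyop_monom: "polyop U (monom c n) x = c *\<^sub>C (U ^^ n) x"
  by (induction n) (simp_all add: monom_0 monom_Suc U_zero U_cscale)

lemma S_zero: "x \<in> S N \<Longrightarrow> 0 \<in> S N"
  using S_cscale[of x N 0] by simp

lemma polyop_S: "x \<in> S (N + 2 * degree p) \<Longrightarrow> polyop U p x \<in> S N"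
proof (induction p arbitrary: N)
  case 0
  then show ?case using S_zero by auto
next
  case (pCons a p)
  have x: "x \<in> S N" using pCons.prems S_antimono[of N] by (meson in_mono le_add1)
  show ?case
  proof (cases "p = 0")
    case True
    then show ?thesis using x by (auto intro!: S_cscale simp: U_zero)
  next
    case False
    then have "polyop U p x \<in> S (N + 2)" using pCons.prems by (intro pCons.IH) auto
    then show ?thesis using x by (auto intro!: S_cscale S_add U_S)
  qed
qed

lemma polyop_bounded: "\<exists>B\<ge>0. \<forall>x. norm (polyop U p x) \<le> B * norm x"
proof (induction p)
  case 0
  show ?case by (intro exI[of _ 0]) simp
next
  case (pCons a p)
  then obtain B where B: "B \<ge> 0" "\<And>x. norm (polyop U p x) \<le> B * norm x" by blast
  have "norm (polyop U (pCons a p) x) \<le> (cmod a + B) * norm x" for x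
    using B(2)[of x] norm_triangle_ineq[of "a *\<^sub>C x" "U (polyop U p x)"]
    by (simp add: norm_U algebra_simps)
  then show ?case using B(1) by (intro exI[of _ "cmod a + B"]) auto
qed

text \<open>Roots are split off one by one. If \<zeta> is not an approximate eigenvalue, U - \<zeta>
  is bounded below far out, so the smallness of g(U) x passes to the cofactor h(U) x. This must end
  at an approximate eigenvalue, because a nonzero constant is never small.\<close>

lemma approx_root:
  assumes "g \<noteq> 0" "\<And>N e. 0 < e \<Longrightarrow> \<exists>x\<in>S N. norm x = 1 \<and> norm (polyop U g x) < e"
  shows "\<exists>\<zeta>. poly g \<zeta> = 0 \<and> approx_spec \<zeta>"
  using assms
proof (induction "degree g" arbitrary: g)
  case 0
  then obtain c where c: "g = [:c:]" "c \<noteq> 0" by (metis degree_eq_zeroE pCons_0_0)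
  obtain x where "norm x = 1" "norm (polyop U g x) < cmod c"
    using "0.prems"(2)[of "cmod c" 0] c by auto
  then show ?case using c by (simp add: U_zero)
next
  case (Suc d)
  then have "\<not> constant (poly g)" by (simp add: constant_degree)
  then obtain \<zeta> where \<zeta>: "poly g \<zeta> = 0" using fundamental_theorem_of_algebra by blast
  show ?case
  proof (cases "approx_spec \<zeta>")
    case True
    then show ?thesis using \<zeta> by blast
  next
    case False
    then obtain N0 e0 where e0: "e0 > 0" "\<And>x. x \<in> S N0 \<Longrightarrow> norm x = 1 \<Longrightarrow> e0 \<le> norm (U x - \<zeta> *\<^sub>C x)"
      unfolding approx_spec_def by (meson not_le)
    have e0': "e0 * norm x \<le> norm (U x - \<zeta> *\<^sub>C x)" if "x \<in> S N0" for x
    proof (cases "x = 0")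
      case False
      let ?c = "complex_of_real (1 / norm x)"
      have "e0 \<le> norm (U (?c *\<^sub>C x) - \<zeta> *\<^sub>C ?c *\<^sub>C x)"
        using False that by (intro e0 S_cscale) (simp_all add: norm_divide)
      also have "U (?c *\<^sub>C x) - \<zeta> *\<^sub>C ?c *\<^sub>C x = ?c *\<^sub>C (U x - \<zeta> *\<^sub>C x)"
        by (simp add: U_cscale mult.commute)
      finally show ?thesis using False by (simp add: norm_divide field_simps del: cscale_simps)
    qed simp
    obtain h where h: "g = [:-\<zeta>, 1:] * h" using \<zeta> by (metis dvdE poly_eq_0_iff_dvd)
    have "h \<noteq> 0" using h Suc.prems(1) by auto
    have deg: "degree h = d" using Suc.hyps(2) h \<open>h \<noteq> 0\<close> by (simp add: degree_mult_eq del: mult_pCons_left)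
    have "\<exists>x\<in>S N. norm x = 1 \<and> norm (polyop U h x) < e" if "0 < e" for N e
    proof -
      \<comment> \<open>h(U) may lower the index by \<open>2 * d\<close>; the margin keeps h(U) x in
        \<open>S N0\<close>, where U - \<zeta> is bounded below.\<close>
      obtain x where x: "x \<in> S (max N (N0 + 2 * d))" "norm x = 1" "norm (polyop U g x) < e0 * e"
        using Suc.prems(2)[of "e0 * e"] \<open>0 < e\<close> e0 by auto
      have "x \<in> S N" "x \<in> S (N0 + 2 * d)"
        using x(1) S_antimono by (meson in_mono max.cobounded1 max.cobounded2)+
      then have "e0 * norm (polyop U h x) \<le> norm (U (polyop U h x) - \<zeta> *\<^sub>C polyop U h x)"
        by (intro e0' polyop_S) (simp add: deg)
      also have "\<dots> = norm (polyop U g x)"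
        unfolding h polyop_mult by (simp add: U_zero)
      also have "\<dots> < e0 * e" by (rule x)
      finally show ?thesis using \<open>x \<in> S N\<close> x(2) e0(1) by auto
    qed
    then obtain z where "poly h z = 0" "approx_spec z"
      using Suc.hyps(1)[of h] deg \<open>h \<noteq> 0\<close> by blast
    then show ?thesis using h by auto
  qed
qed

text \<open>For an isometry \<open>p(U)\<^sup>* = \<kappa> U\<^bsup>-n\<^esup> p(U)\<close> if all \<open>n\<close> roots of the monic polynomial \<open>p\<close> are unimodular;
  stated without the inverse of \<open>U\<close>.\<close>

lemma polyop_adjoint:
  assumes "finite \<Lambda>" "\<And>z. z \<in> \<Lambda> \<Longrightarrow> cmod z = 1"
  shows "\<exists>\<kappa>. cmod \<kappa> = 1 \<and> (\<forall>x y. inner (\<kappa> *\<^sub>C polyop U (\<Prod>z\<in>\<Lambda>. [:-z, 1:]) y) ((U ^^ card \<Lambda>) x)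
            = inner y (polyop U (\<Prod>z\<in>\<Lambda>. [:-z, 1:]) x))"
  using assms
proof (induction \<Lambda>)
  case empty
  show ?case by (intro exI[of _ 1]) simp
next
  case (insert z \<Lambda>)
  let ?P = "\<Prod>z\<in>\<Lambda>. [:-z, 1:]"
  obtain \<kappa> where \<kappa>: "cmod \<kappa> = 1"
    "\<And>x y. inner (\<kappa> *\<^sub>C polyop U ?P y) ((U ^^ card \<Lambda>) x) = inner y (polyop U ?P x)"
    using insert by blast
  have z: "cnj z * z = 1" using insert.prems[of z] complex_norm_square[of z] by (simp add: mult.commute)
  have P': "polyop U (\<Prod>z\<in>insert z \<Lambda>. [:-z, 1:]) x = U (polyop U ?P x) - z *\<^sub>C polyop U ?P x" for x
    using insert.hyps by (simp add: polyop_mult U_zero del: mult_pCons_left)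
  have pow: "(U ^^ n) (U x - z *\<^sub>C x) = U ((U ^^ n) x) - z *\<^sub>C (U ^^ n) x" for n x
    by (induction n) (simp_all add: U_diff U_cscale)
  \<comment> \<open>Each root contributes a factor \<open>- cnj z\<close>: the adjoint of U - z is
    the inverse of U times 1 - cnj z U, and for unimodular z the latter is - cnj z (U - z).\<close>
  have "inner ((- cnj z * \<kappa>) *\<^sub>C polyop U (\<Prod>z\<in>insert z \<Lambda>. [:-z, 1:]) y) ((U ^^ card (insert z \<Lambda>)) x)
      = inner y (polyop U (\<Prod>z\<in>insert z \<Lambda>. [:-z, 1:]) x)" for x y
  proof -
    define w where "w = \<kappa> *\<^sub>C polyop U ?P y"
    define u where "u = (U ^^ card \<Lambda>) x"
    have "(- cnj z * \<kappa>) *\<^sub>C polyop U (\<Prod>z\<in>insert z \<Lambda>. [:-z, 1:]) y = w - cnj z *\<^sub>C U w"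
    proof -
      have "(- cnj z * \<kappa>) *\<^sub>C z *\<^sub>C v = - (\<kappa> *\<^sub>C v)" for v
        using z by (simp add: mult.assoc mult.commute[of \<kappa> z]) (simp flip: mult.assoc)
      then show ?thesis unfolding P' w_def by (simp only: cscale_simps U_cscale) simp
    qed
    then have "inner ((- cnj z * \<kappa>) *\<^sub>C polyop U (\<Prod>z\<in>insert z \<Lambda>. [:-z, 1:]) y) ((U ^^ card (insert z \<Lambda>)) x)
        = inner (w - cnj z *\<^sub>C U w) (U u)" using insert.hyps by (simp add: u_def)
    also have "\<dots> = inner w (U u) - inner w (z *\<^sub>C u)"
      by (simp add: inner_diff_left inner_cscale U_cscale[symmetric] inner_U)
    also have "\<dots> = inner w ((U ^^ card \<Lambda>) (U x - z *\<^sub>C x))"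
      by (simp add: inner_diff_right u_def pow)
    also have "\<dots> = inner y (polyop U (\<Prod>z\<in>insert z \<Lambda>. [:-z, 1:]) x)"
      unfolding w_def \<kappa>(2) P' by (simp add: polyop_diff_right polyop_U polyop_cscale)
    finally show ?thesis .
  qed
  moreover have "cmod (- cnj z * \<kappa>) = 1" using \<kappa>(1) insert.prems[of z] by (simp add: norm_mult)
  ultimately show ?case by blast
qed

text \<open>Let \<open>\<beta>\<close> be the asymptotic norm of \<open>p(U)\<close> and suppose \<open>\<beta> > 0\<close>.  On almost maximizing unit vectors
  \<open>p(U)\<^sup>* p(U) - \<beta>\<^sup>2\<close> is small; up to a power of \<open>U\<close> it is the polynomial \<open>g(U)\<close> below, so some root of \<open>g\<close>
  is an approximate eigenvalue, but \<open>g\<close> has no root in \<open>\<Lambda>\<close>.\<close>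

theorem polyop_small:
  assumes fin: "finite \<Lambda>" and ne: "\<Lambda> \<noteq> {}" and unit: "\<And>z. z \<in> \<Lambda> \<Longrightarrow> cmod z = 1"
    and spec: "\<And>z. approx_spec z \<Longrightarrow> z \<in> \<Lambda>" and "0 < e"
  shows "\<exists>N. \<forall>x\<in>S N. norm (polyop U (\<Prod>z\<in>\<Lambda>. [:-z, 1:]) x) \<le> e * norm x"
proof -
  define P where "P = (\<Prod>z\<in>\<Lambda>. [:-z, 1:])"
  define T where "T = polyop U P"
  define B where "B = {b. 0 \<le> b \<and> (\<exists>N. \<forall>x\<in>S N. norm (T x) \<le> b * norm x)}"
  define \<beta> where "\<beta> = Inf B"
  obtain b0 where "b0 \<in> B" using polyop_bounded[of P] unfolding B_def T_def by blast
  have bdd: "bdd_below B" by (auto simp: B_def)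
  have "0 \<le> \<beta>" unfolding \<beta>_def using \<open>b0 \<in> B\<close> by (intro cInf_greatest) (auto simp: B_def)
  have "\<beta> = 0"
  proof (rule ccontr)
    assume "\<beta> \<noteq> 0"
    with \<open>0 \<le> \<beta>\<close> have "\<beta> > 0" by simp
    obtain \<kappa> where \<kappa>: "cmod \<kappa> = 1"
      "\<And>x y. inner (\<kappa> *\<^sub>C T y) ((U ^^ card \<Lambda>) x) = inner y (T x)"
      using polyop_adjoint[OF fin unit] unfolding T_def P_def by blast
    define g where "g = Polynomial.smult \<kappa> (P * P) - monom (complex_of_real (\<beta>\<^sup>2)) (card \<Lambda>)"
    have g_root: "poly g z \<noteq> 0" if "z \<in> \<Lambda>" for z
    proof -
      have "poly P z = 0" unfolding P_def poly_prod using fin that by (intro prod_zero) auto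
      moreover have "z \<noteq> 0" using unit[OF that] by auto
      ultimately show ?thesis using \<open>\<beta> > 0\<close> by (simp add: g_def poly_monom)
    qed
    have degP: "degree P = card \<Lambda>"
      unfolding P_def by (subst degree_prod_eq_sum_degree) auto
    have Pg: "polyop U g x = \<kappa> *\<^sub>C T (T x) - \<beta>\<^sup>2 *\<^sub>R (U ^^ card \<Lambda>) x" for x
      by (simp add: g_def T_def polyop_diff polyop_smult polyop_mult polyop_monom cscale_of_real del: of_real_power)
    have "\<exists>x\<in>S N. norm x = 1 \<and> norm (polyop U g x) < e" if "0 < e" for N e
    proof -
      \<comment> \<open>For the almost maximizing x chosen below this expression bounds
        \<open>(norm (polyop U g x))\<^sup>2\<close>; its terms come from T (T x), from the mixed
        term and from the power of U. At \<delta> = 0 they cancel, so a small \<delta>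
        suffices.\<close>
      have "((\<lambda>\<delta>. (\<beta> + \<delta>) ^ 4 - 2 * (\<beta>\<^sup>2 * (\<beta> - \<delta>)\<^sup>2) + \<beta> ^ 4) \<longlongrightarrow>
          (\<beta> + 0) ^ 4 - 2 * (\<beta>\<^sup>2 * (\<beta> - 0)\<^sup>2) + \<beta> ^ 4) (at_right 0)"
        by (intro tendsto_intros)
      moreover have "(\<beta> + 0) ^ 4 - 2 * (\<beta>\<^sup>2 * (\<beta> - 0)\<^sup>2) + \<beta> ^ 4 < e\<^sup>2"
        using \<open>0 < e\<close> by (simp add: power2_eq_square power4_eq_xxxx)
      ultimately have "\<forall>\<^sub>F \<delta> in at_right 0. (\<beta> + \<delta>) ^ 4 - 2 * (\<beta>\<^sup>2 * (\<beta> - \<delta>)\<^sup>2) + \<beta> ^ 4 < e\<^sup>2"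
        by (rule order_tendstoD(2))
      moreover have "\<forall>\<^sub>F \<delta> in at_right 0. \<delta> \<in> {0<..<\<beta>}"
        using \<open>\<beta> > 0\<close> by (rule eventually_at_right_real)
      ultimately have "\<forall>\<^sub>F \<delta> in at_right 0. (\<beta> + \<delta>) ^ 4 - 2 * (\<beta>\<^sup>2 * (\<beta> - \<delta>)\<^sup>2) + \<beta> ^ 4 < e\<^sup>2 \<and> \<delta> \<in> {0<..<\<beta>}"
        by (rule eventually_conj)
      then have "\<exists>\<delta>. (\<beta> + \<delta>) ^ 4 - 2 * (\<beta>\<^sup>2 * (\<beta> - \<delta>)\<^sup>2) + \<beta> ^ 4 < e\<^sup>2 \<and> \<delta> \<in> {0<..<\<beta>}"
        by (rule eventually_happens'[OF trivial_limit_at_right_real])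
      then obtain \<delta> where \<delta>: "(\<beta> + \<delta>) ^ 4 - 2 * (\<beta>\<^sup>2 * (\<beta> - \<delta>)\<^sup>2) + \<beta> ^ 4 < e\<^sup>2" "0 < \<delta>" "\<delta> < \<beta>"
        unfolding greaterThanLessThan_iff by (elim exE conjE)
      obtain b where b: "b \<in> B" "b < \<beta> + \<delta>"
        using cInf_lessD[of B "\<beta> + \<delta>"] \<open>b0 \<in> B\<close> \<delta>(2) unfolding \<beta>_def by auto
      then obtain N0 where N0: "0 \<le> b" "\<And>x. x \<in> S N0 \<Longrightarrow> norm (T x) \<le> b * norm x" by (auto simp: B_def)
      \<comment> \<open>Far enough out that x lies in \<open>S N\<close>, and that T x, which may
        lose \<open>2 * card \<Lambda>\<close> in the index, still lies in \<open>S N0\<close>,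
        where the bound b holds.\<close>
      define M where "M = max N (N0 + 2 * card \<Lambda>)"
      have "\<beta> - \<delta> \<notin> B"
      proof
        assume "\<beta> - \<delta> \<in> B"
        then have "\<beta> \<le> \<beta> - \<delta>" unfolding \<beta>_def using bdd by (intro cInf_lower)
        then show False using \<delta>(2,3) by simp
      qed
      then have "\<not> (\<forall>x\<in>S M. norm (T x) \<le> (\<beta> - \<delta>) * norm x)" using \<delta>(2,3) by (auto simp: B_def)
      then obtain x0 where x0: "x0 \<in> S M" "norm (T x0) > (\<beta> - \<delta>) * norm x0"
        by (meson not_le)
      then have "x0 \<noteq> 0" by (auto simp: T_def polyop_cscale[of P 0 0, simplified])
      define x where "x = complex_of_real (1 / norm x0) *\<^sub>C x0"
      have x: "norm x = 1" "x \<in> S M" "norm (T x) > \<beta> - \<delta>"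
        using x0 \<open>x0 \<noteq> 0\<close> by (simp_all add: x_def S_cscale norm_divide T_def polyop_cscale field_simps del: of_real_divide)
      have S: "x \<in> S N" "x \<in> S N0" "x \<in> S (N0 + 2 * card \<Lambda>)"
        using x(2) S_antimono unfolding M_def
        by (meson in_mono max.cobounded1 max.cobounded2 le_add1 order_trans)+
      have "T x \<in> S N0" unfolding T_def using S(3) degP by (intro polyop_S) simp
      have Tx: "norm (T x) \<le> \<beta> + \<delta>" using N0(2)[OF S(2)] x(1) b by simp
      have "norm (T (T x)) \<le> b * norm (T x)" using \<open>T x \<in> S N0\<close> by (rule N0(2))
      also have "\<dots> \<le> (\<beta> + \<delta>) * (\<beta> + \<delta>)" using Tx b N0(1) by (intro mult_mono) auto
      finally have TT: "(norm (T (T x)))\<^sup>2 \<le> (\<beta> + \<delta>) ^ 4"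
        using power_mono[of "norm (T (T x))" "(\<beta> + \<delta>) * (\<beta> + \<delta>)" 2] by (simp add: power4_eq_xxxx power2_eq_square mult.assoc)
      have "(norm (polyop U g x))\<^sup>2 = (norm (\<kappa> *\<^sub>C T (T x)))\<^sup>2 + (norm (\<beta>\<^sup>2 *\<^sub>R (U ^^ card \<Lambda>) x))\<^sup>2
          - 2 * inner (\<kappa> *\<^sub>C T (T x)) (\<beta>\<^sup>2 *\<^sub>R (U ^^ card \<Lambda>) x)"
        unfolding Pg power2_norm_eq_inner by (simp add: inner_diff inner_commute)
      \<comment> \<open>The adjoint relation, taken with y = T x.\<close>
      also have "inner (\<kappa> *\<^sub>C T (T x)) (\<beta>\<^sup>2 *\<^sub>R (U ^^ card \<Lambda>) x) = \<beta>\<^sup>2 * (norm (T x))\<^sup>2"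
        by (simp add: \<kappa>(2) power2_norm_eq_inner)
      also have "(norm (\<kappa> *\<^sub>C T (T x)))\<^sup>2 = (norm (T (T x)))\<^sup>2" by (simp add: \<kappa>(1))
      also have "(norm (\<beta>\<^sup>2 *\<^sub>R (U ^^ card \<Lambda>) x))\<^sup>2 = \<beta> ^ 4" by (simp add: norm_Upow x(1))
      finally have eq: "(norm (polyop U g x))\<^sup>2 = (norm (T (T x)))\<^sup>2 + \<beta> ^ 4 - 2 * (\<beta>\<^sup>2 * (norm (T x))\<^sup>2)" .
      have "(\<beta> - \<delta>)\<^sup>2 \<le> (norm (T x))\<^sup>2" using x(3) \<delta>(2,3) by (intro power_mono) auto
      then have "\<beta>\<^sup>2 * (\<beta> - \<delta>)\<^sup>2 \<le> \<beta>\<^sup>2 * (norm (T x))\<^sup>2" by (intro mult_left_mono) auto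
      moreover have "a < d" if "a = b + c - 2 * t" "b \<le> f" "h \<le> t" "f - 2 * h + c < d"
        for a b c d f h t :: real using that by linarith
      ultimately have "(norm (polyop U g x))\<^sup>2 < e\<^sup>2" using eq TT \<delta>(1) by blast
      then have "norm (polyop U g x) < e" using \<open>0 < e\<close> by (auto dest: power2_less_imp_less)
      then show ?thesis using x S by blast
    qed
    moreover have "g \<noteq> 0" using g_root ne by auto
    ultimately obtain \<zeta> where "poly g \<zeta> = 0" "approx_spec \<zeta>" using approx_root by blast
    then show False using spec g_root by blast
  qed
  then obtain b where "b \<in> B" "b < e"
    using cInf_lessD[of B e] \<open>b0 \<in> B\<close> \<open>0 < e\<close> unfolding \<beta>_def by auto
  then obtain N where "\<And>x. x \<in> S N \<Longrightarrow> norm (T x) \<le> b * norm x" by (auto simp: B_def)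
  then have "\<forall>x\<in>S N. norm (T x) \<le> e * norm x"
    using \<open>b < e\<close> by (meson mult_right_mono norm_ge_zero order_trans less_imp_le)
  then show ?thesis unfolding T_def P_def by blast
qed

end

context filtered_isometry
begin

lemma U_sum: "U (\<Sum>i\<in>A. f i) = (\<Sum>i\<in>A. U (f i))"
  by (induction A rule: infinite_finite_induct) (simp_all add: U_zero U_add)

lemma polyop_altdef: "polyop U p x = (\<Sum>i\<le>degree p. coeff p i *\<^sub>C (U ^^ i) x)"
proof (induction p)
  case (pCons a p)
  show ?case
  proof (cases "p = 0")
    case False
    then show ?thesis
      using pCons.IH by (simp add: sum.atMost_Suc_shift U_sum U_cscale del: sum.atMost_Suc)
  qed (simp add: U_zero)
qed simp

end

section \<open>Polynomials of the CMV operator and products of consecutive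
  \<open>rho\<close>\<close>

lemma filtered_isometry_Cmv:
  assumes "\<And>i. cmod (\<alpha> i) \<le> 1"
  shows "filtered_isometry (Cmv \<alpha>) tail"
proof
  show "Cmv \<alpha> x \<in> tail N" if "x \<in> tail (N + 2)" for x N
    using assms that by (rule Cmv_tail)
  show "tail N \<subseteq> tail M" if "M \<le> N" for M N
    using that by (auto simp: tail_def)
qed (simp_all add: Cmv_add Cmv_cscale norm_Cmv assms, auto simp: tail_def)

lemma layer_parity: "even c = even d \<Longrightarrow> layer \<beta> c = layer \<beta> d"
  by (intro ext) (simp add: layer_def glay_def)

lemma Layer_parity: "even c = even d \<Longrightarrow> Layer \<beta> c = Layer \<beta> d"
  using layer_parity[of c d \<beta>] by (intro ext) (simp add: Layer_def)

text \<open>Words in the letters \<open>L\<close>, \<open>M\<close> and in their inverses.  Cancelling \<open>m\<close> letters from the left turns the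
  powers \<open>C\<^sup>i\<close>, \<open>i \<le> m\<close>, into words of length \<open>\<bar>2 i - m\<bar>\<close>, of which exactly one, depending on the parity of
  \<open>n\<close>, moves the \<open>n\<close>-th unit vector as far as site \<open>n + m\<close>.\<close>

primrec word :: "(nat \<Rightarrow> complex) \<Rightarrow> nat \<Rightarrow> nat \<Rightarrow> l2 \<Rightarrow> l2" where
  "word \<beta> s 0 x = x"
| "word \<beta> s (Suc r) x = Layer \<beta> (s + r) (word \<beta> s r x)"

context
  fixes \<beta> :: "nat \<Rightarrow> complex"
  assumes le1: "\<And>i. cmod (\<beta> i) \<le> 1"
begin

lemma word_add: "word \<beta> s r (x + y) = word \<beta> s r x + word \<beta> s r y"
  by (induction r) (simp_all add: Layer_add le1)

lemma word_cscale: "word \<beta> s r (c *\<^sub>C x) = c *\<^sub>C word \<beta> s r x"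
  by (induction r) (simp_all add: Layer_cscale le1)

lemma word_sum: "word \<beta> s r (\<Sum>i\<in>A. f i) = (\<Sum>i\<in>A. word \<beta> s r (f i))"
  using word_cscale[of s r 0 0]
  by (induction A rule: infinite_finite_induct) (simp_all add: word_add)

lemma norm_word: "norm (word \<beta> s r x) = norm x"
  by (induction r) (simp_all add: norm_Layer le1)

lemma Cmv_pow_word: "(Cmv \<beta> ^^ i) x = word \<beta> 1 (2 * i) x"
  by (induction i) (simp_all add: Cmv_def Layer_parity[of "Suc (Suc _)" 0] Layer_parity[of "Suc (2 * _)" 1])

text \<open>C^i begins on the left with L, and the indices alternate in both words, so each new
  inverse letter meets the layer of its own parity until C^i is used up. Since 2 i is even, the
  letters left over form an inverse word that again starts with parity 0.\<close>

lemma word_cancel: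
  "word (\<lambda>i. cnj (\<beta> i)) 0 m (word \<beta> 1 (2 * i) x)
     = (if m \<le> 2 * i then word \<beta> 1 (2 * i - m) x else word (\<lambda>i. cnj (\<beta> i)) 0 (m - 2 * i) x)"
proof (induction m)
  case 0
  show ?case by simp
next
  case (Suc m)
  consider "m < 2 * i" | "m = 2 * i" | "m > 2 * i" by linarith
  then show ?case
  proof cases
    case 1
    then obtain r where r: "2 * i - m = Suc r" by (metis Suc_diff_Suc)
    have "even (Suc r) = even m" using 1 by (simp flip: r)
    then have "word (\<lambda>i. cnj (\<beta> i)) 0 (Suc m) (word \<beta> 1 (2 * i) x)
        = Layer (\<lambda>i. cnj (\<beta> i)) m (Layer \<beta> m (word \<beta> 1 r x))"
      using Suc.IH 1 r Layer_parity[of "Suc r" m \<beta>] by simp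
    also have "\<dots> = word \<beta> 1 r x" by (simp add: Layer_inverse le1)
    also have "r = 2 * i - Suc m" using r by simp
    finally show ?thesis using 1 by simp
  next
    case 2
    then show ?thesis using Suc.IH by (simp add: Layer_parity[of "2 * i" 0])
  next
    case 3
    then show ?thesis using Suc.IH Layer_parity[of m "m - 2 * i" "\<lambda>i. cnj (\<beta> i)"]
      by (simp add: Suc_diff_le)
  qed
qed

text \<open>In the layer of parity c the site n is paired with n + 1 exactly if n + c is even. Only
  then does the front of the support move, and it picks up the factor
  \<open>rho (\<beta> n)\<close>.\<close>

lemma Layer_head:
  assumes "\<And>i. i > n \<Longrightarrow> coord x i = 0" "i > n"
  shows "odd (n + c) \<Longrightarrow> coord (Layer \<beta> c x) i = 0"
    and "i > Suc n \<Longrightarrow> coord (Layer \<beta> c x) i = 0"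
    and "even (n + c) \<Longrightarrow> coord (Layer \<beta> c x) (Suc n) = rho (\<beta> n) * coord x n"
  using assms by (cases "i = Suc n"; auto simp: coord_Layer le1 layer_def glay_def)+

text \<open>With the right initial parity every letter moves the front by one site, since the front
  and the index of the next letter grow together.\<close>

lemma word_unitv:
  assumes "even (n + s)"
  shows "(\<forall>i>n + r. coord (word \<beta> s r (unitv n)) i = 0)
    \<and> coord (word \<beta> s r (unitv n)) (n + r) = (\<Prod>i<r. rho (\<beta> (n + i)))"
proof (induction r)
  case (Suc r)
  have "even (n + r + (s + r))" using assms by simp
  then have "coord (word \<beta> s (Suc r) (unitv n)) (Suc (n + r)) = rho (\<beta> (n + r)) * (\<Prod>i<r. rho (\<beta> (n + i)))"
    using Suc Layer_head(3)[of "n + r" "word \<beta> s r (unitv n)" "Suc (n + r)" "s + r"] by simp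
  moreover have "coord (word \<beta> s (Suc r) (unitv n)) i = 0" if "i > n + Suc r" for i
    using Suc Layer_head(2)[of "n + r" "word \<beta> s r (unitv n)" i] that by simp
  ultimately show ?case by (simp add: mult.commute)
qed simp

text \<open>With the wrong parity the first letter leaves the front in place, and each later one
  moves it by at most one site.\<close>

lemma word_unitv':
  assumes "odd (n + s)"
  shows "\<forall>i>n + (r - 1). coord (word \<beta> s r (unitv n)) i = 0"
proof (induction r)
  case (Suc r)
  show ?case
  proof (cases r)
    case 0
    then show ?thesis using Layer_head(1)[of n "unitv n" _ s] assms by auto
  next
    case (Suc q)
    then show ?thesis using Suc.IH Layer_head(2)[of "n + q" "word \<beta> s r (unitv n)"] by auto
  qed
qed simp

end

text \<open>After the isometric cancellation the coordinate n + m sees a single power of C: C^0 for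
  even n, where the constant coefficient counts, and C^m for odd n, where the leading one counts.
  Both have modulus 1, so the entry has the modulus of the product.\<close>

lemma prod_rho_le_norm_polyop:
  assumes le1: "\<And>i. cmod (\<beta> i) \<le> 1" and "lead_coeff p = 1" "cmod (coeff p 0) = 1"
  shows "(\<Prod>i<degree p. rho (\<beta> (n + i))) \<le> norm (polyop (Cmv \<beta>) p (unitv n))"
proof -
  interpret filtered_isometry "Cmv \<beta>" tail using le1 by (rule filtered_isometry_Cmv)
  define m where "m = degree p"
  let ?c = "\<lambda>i. cnj (\<beta> i)"
  define Z where "Z i = (if m \<le> 2 * i then word \<beta> 1 (2 * i - m) (unitv n) else word ?c 0 (m - 2 * i) (unitv n))" for i
  have cle1: "cmod (?c i) \<le> 1" for i using le1 by simp
  have eq: "word ?c 0 m (polyop (Cmv \<beta>) p (unitv n)) = (\<Sum>i\<le>m. coeff p i *\<^sub>C Z i)"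
    unfolding polyop_altdef m_def[symmetric] word_sum[OF cle1] word_cscale[OF cle1]
      Cmv_pow_word[OF le1] word_cancel[OF le1] Z_def ..
  have "cmod (coord (\<Sum>i\<le>m. coeff p i *\<^sub>C Z i) (n + m)) = (\<Prod>i<m. rho (\<beta> (n + i)))"
  proof (cases "even n")
    case True
    have "coord (Z i) (n + m) = 0" if "0 < i" "i \<le> m" for i
    proof (cases "m \<le> 2 * i")
      case True
      then have "n + m > n + (2 * i - m - 1)" using that by simp
      then show ?thesis using True word_unitv'[OF le1, of n 1 "2 * i - m"] \<open>even n\<close> by (simp add: Z_def)
    next
      case False
      then show ?thesis using word_unitv[OF cle1, of n 0 "m - 2 * i"] \<open>even n\<close> that by (simp add: Z_def)
    qed
    then have "coord (\<Sum>i\<le>m. coeff p i *\<^sub>C Z i) (n + m) = (\<Sum>i\<in>{0}. coeff p i * coord (Z i) (n + m))"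
      unfolding coord_sum coord_cscale by (intro sum.mono_neutral_right) auto
    moreover have "coord (Z 0) (n + m) = (\<Prod>i<m. rho (\<beta> (n + i)))"
      using word_unitv[OF cle1, of n 0 m] \<open>even n\<close> by (auto simp: Z_def)
    ultimately show ?thesis using assms(3) le1
      by (simp add: norm_mult prod_norm[symmetric] rho_nonneg)
  next
    case False
    have "coord (Z i) (n + m) = 0" if "i < m" for i
    proof (cases "m \<le> 2 * i")
      case True
      then show ?thesis using word_unitv[OF le1, of n 1 "2 * i - m"] \<open>odd n\<close> that by (simp add: Z_def)
    next
      case False
      then have "n + m > n + (m - 2 * i - 1)" using that by simp
      then show ?thesis using False word_unitv'[OF cle1, of n 0 "m - 2 * i"] \<open>odd n\<close> by (simp add: Z_def)
    qed
    then have "coord (\<Sum>i\<le>m. coeff p i *\<^sub>C Z i) (n + m) = (\<Sum>i\<in>{m}. coeff p i * coord (Z i) (n + m))"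
      unfolding coord_sum coord_cscale by (intro sum.mono_neutral_right) auto
    moreover have "coord (Z m) (n + m) = (\<Prod>i<m. rho (\<beta> (n + i)))"
      using word_unitv[OF le1, of n 1 m] \<open>odd n\<close> by (simp add: Z_def)
    ultimately show ?thesis using assms(2) le1
      by (simp add: norm_mult prod_norm[symmetric] rho_nonneg m_def)
  qed
  moreover have "norm (polyop (Cmv \<beta>) p (unitv n)) = norm (\<Sum>i\<le>m. coeff p i *\<^sub>C Z i)"
    using norm_word[of ?c, OF cle1, where s = 0 and r = m and x = "polyop (Cmv \<beta>) p (unitv n)"] unfolding eq by simp
  ultimately show ?thesis
    using norm_coord_le[of "\<Sum>i\<le>m. coeff p i *\<^sub>C Z i" "n + m"] by (simp only: m_def)
qed

section \<open>Compactness on a fixed finite window\<close>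

lemma bounded_family_convergent_subsequence:
  fixes f :: "nat \<Rightarrow> nat \<Rightarrow> complex"
  assumes "\<And>j i. cmod (f j i) \<le> B"
  shows "\<exists>r l. strict_mono r \<and> (\<forall>i<m. (\<lambda>j. f (r j) i) \<longlonglongrightarrow> l i)"
proof (induction m)
  case 0
  show ?case by (intro exI[of _ id]) (simp add: strict_mono_def)
next
  case (Suc m)
  then obtain r l where r: "strict_mono r" "\<And>i. i < m \<Longrightarrow> (\<lambda>j. f (r j) i) \<longlonglongrightarrow> l i" by blast
  obtain s :: "nat \<Rightarrow> nat" and l' where s: "strict_mono s" "\<And>e. 0 < e \<Longrightarrow> \<exists>N. \<forall>j\<ge>N. cmod (f (r (s j)) m - l') < e"
    using Bolzano_Weierstrass_complex_disc[of "\<lambda>j. f (r j) m" B] assms by blast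
  then have lim: "(\<lambda>j. f (r (s j)) m) \<longlonglongrightarrow> l'" by (intro LIMSEQ_I) auto
  have "(\<lambda>j. f ((r \<circ> s) j) i) \<longlonglongrightarrow> (l(m := l')) i" if "i < Suc m" for i
  proof (cases "i = m")
    case True then show ?thesis using lim by simp
  next
    case False
    then show ?thesis using LIMSEQ_subseq_LIMSEQ[OF r(2)[of i] s(1)] that by (simp add: o_def)
  qed
  then show ?case using strict_mono_o[OF r(1) s(1)] by blast
qed

lemma tendsto_layer:
  assumes "\<And>i. ((\<lambda>j. \<gamma> j i) \<longlongrightarrow> \<beta> i) F" "\<And>i. ((\<lambda>j. x j i) \<longlongrightarrow> u i) F"
  shows "((\<lambda>j. layer (\<gamma> j) c (x j) i) \<longlongrightarrow> layer \<beta> c u i) F"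
  unfolding layer_def glay_def
  by (cases "even (i + c)"; cases "i = 0") (simp_all, (intro tendsto_intros assms tendsto_rho)+)

text \<open>The sum of squares over the finite window \<open>{P<..Q}\<close> passes to the limit and
  stays 1, so the limit vector is not zero.\<close>

lemma limit_eigenvector:
  fixes \<gamma> y :: "nat \<Rightarrow> nat \<Rightarrow> complex"
  assumes \<gamma>: "\<And>j i. cmod (\<gamma> j i) \<le> 1" "\<And>j i. i > Q \<Longrightarrow> \<gamma> j i = 0"
    and y: "\<And>j i. i \<notin> {P<..Q} \<Longrightarrow> y j i = 0" "\<And>j. (\<Sum>i\<in>{P<..Q}. (cmod (y j i))\<^sup>2) = 1"
    and res: "\<And>i. i \<in> {P<..Q} \<Longrightarrow> (\<lambda>j. layer (\<gamma> j) 0 (layer (\<gamma> j) 1 (y j)) i - z * y j i) \<longlonglongrightarrow> 0"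
  obtains r \<beta> u where "strict_mono r" "\<And>i. (\<lambda>j. \<gamma> (r j) i) \<longlonglongrightarrow> \<beta> i"
    "\<And>i. i \<notin> {P<..Q} \<Longrightarrow> u i = 0" "u \<noteq> (\<lambda>i. 0)"
    "\<And>i. i \<in> {P<..Q} \<Longrightarrow> layer \<beta> 0 (layer \<beta> 1 u) i = z * u i"
proof -
  obtain r \<beta>0 where r: "strict_mono r" "\<And>i. i < Suc Q \<Longrightarrow> (\<lambda>j. \<gamma> (r j) i) \<longlonglongrightarrow> \<beta>0 i"
    using bounded_family_convergent_subsequence[of \<gamma> 1 "Suc Q"] \<gamma> by blast
  have ybd: "cmod (y (r j) i) \<le> 1" for j i
  proof (cases "i \<in> {P<..Q}")
    case True
    have "(cmod (y (r j) i))\<^sup>2 \<le> (\<Sum>i\<in>{P<..Q}. (cmod (y (r j) i))\<^sup>2)"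
      using True by (intro member_le_sum) auto
    then show ?thesis using y(2) by (simp add: power_le_one_iff)
  qed (simp add: y)
  obtain s u0 where s: "strict_mono s" "\<And>i. i < Suc Q \<Longrightarrow> (\<lambda>j. y (r (s j)) i) \<longlonglongrightarrow> u0 i"
    using bounded_family_convergent_subsequence[of "\<lambda>j. y (r j)" 1 "Suc Q"] ybd by blast
  \<comment> \<open>Beyond Q everything is constantly 0, so convergence has to be arranged for
    finitely many coordinates only.\<close>
  define \<beta> where "\<beta> i = (if i < Suc Q then \<beta>0 i else 0)" for i
  define u where "u i = (if i < Suc Q then u0 i else 0)" for i
  have \<beta>: "(\<lambda>j. \<gamma> ((r \<circ> s) j) i) \<longlonglongrightarrow> \<beta> i" for i
    using LIMSEQ_subseq_LIMSEQ[OF r(2)[of i] s(1)] \<gamma>(2)[of i] by (auto simp: \<beta>_def o_def)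
  have u: "(\<lambda>j. y ((r \<circ> s) j) i) \<longlonglongrightarrow> u i" for i
    using s(2)[of i] y(1)[of i] by (auto simp: u_def)
  have rs: "strict_mono (r \<circ> s)" using r(1) s(1) by (rule strict_mono_o)
  show thesis
  proof
    show "strict_mono (r \<circ> s)" by (rule rs)
    show "(\<lambda>j. \<gamma> ((r \<circ> s) j) i) \<longlonglongrightarrow> \<beta> i" for i by (rule \<beta>)
    show "u i = 0" if "i \<notin> {P<..Q}" for i
      using u[of i] y(1)[OF that] by (simp add: LIMSEQ_const_iff)
    have "(\<lambda>j. \<Sum>i\<in>{P<..Q}. (cmod (y ((r \<circ> s) j) i))\<^sup>2) \<longlonglongrightarrow> (\<Sum>i\<in>{P<..Q}. (cmod (u i))\<^sup>2)"
      by (intro tendsto_intros u)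
    then have "(\<Sum>i\<in>{P<..Q}. (cmod (u i))\<^sup>2) = 1" using y(2) by (simp add: LIMSEQ_const_iff)
    then show "u \<noteq> (\<lambda>i. 0)" by auto
    show "layer \<beta> 0 (layer \<beta> 1 u) i = z * u i" if "i \<in> {P<..Q}" for i
    proof -
      have "(\<lambda>j. layer (\<gamma> ((r \<circ> s) j)) 0 (layer (\<gamma> ((r \<circ> s) j)) 1 (y ((r \<circ> s) j))) i - z * y ((r \<circ> s) j) i)
          \<longlonglongrightarrow> layer \<beta> 0 (layer \<beta> 1 u) i - z * u i"
        by (intro tendsto_intros tendsto_layer \<beta> u)
      moreover have "(\<lambda>j. layer (\<gamma> ((r \<circ> s) j)) 0 (layer (\<gamma> ((r \<circ> s) j)) 1 (y ((r \<circ> s) j))) i - z * y ((r \<circ> s) j) i)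
          \<longlonglongrightarrow> 0"
        using LIMSEQ_subseq_LIMSEQ[OF res[OF that] rs] by (simp add: o_def)
      ultimately show ?thesis using LIMSEQ_unique by fastforce
    qed
  qed
qed

section \<open>The finite blocks\<close>

text \<open>Both factors of \<open>C_tilde\<close> for both parities of k in one definition, t = 0
  for the left and t = 1 for the right factor; they then obey a single entry formula.\<close>

definition factor :: "nat \<Rightarrow> nat \<Rightarrow> (nat \<Rightarrow> complex) \<Rightarrow> complex mat" where
  "factor t k a =
     (if t = 0
      then diag_block_mat (map (\<lambda>m. Theta (a m)) (filter odd [1..<k])
             @ (if even k then [] else [unit1 (cnj (a k))]))
      else diag_block_mat ([unit1 (- a 0)] @ map (\<lambda>m. Theta (a m)) (filter even [1..<k])
             @ (if even k then [unit1 (cnj (a k))] else [])))"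

lemma C_tilde_factor: "C_tilde k a = factor 0 k a * factor 1 k a"
  by (simp add: C_tilde_def factor_def Let_def)

lemma filter_odd_upt: "filter odd [1..<k] = map (\<lambda>i. 2 * i + 1) [0..<k div 2]"
proof (induction k)
  case (Suc k)
  then show ?case by (cases "k = 0"; cases "even k") (auto elim!: oddE evenE)
qed simp

lemma filter_even_upt: "filter even [1..<k] = map (\<lambda>i. 2 * i + 2) [0..<(k - 1) div 2]"
proof (induction k)
  case (Suc k)
  consider "k = 0" | d where "k = 2 * Suc d" | d where "k = Suc (2 * d)"
    by (metis evenE oddE Suc_eq_plus1 mult_0_right not0_implies_Suc)
  then show ?case
  proof cases
    case (2 d)
    have d: "(k - 1) div 2 = d" "(Suc k - 1) div 2 = Suc d" "even k" "1 \<le> k" using 2 by auto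
    have "filter even [1..<Suc k] = map (\<lambda>i. 2 * i + 2) [0..<d] @ [k]"
      using Suc.IH d by simp
    then show ?thesis unfolding d(2) using 2 by simp
  next
    case (3 d)
    then show ?thesis using Suc.IH by simp
  qed simp
qed simp

definition theta_sum :: "(nat \<Rightarrow> complex) \<Rightarrow> nat \<Rightarrow> nat \<Rightarrow> complex mat" where
  "theta_sum a c m = diag_block_mat (map (\<lambda>i. Theta (a (2 * i + c))) [0..<m])"

lemma dim_theta_sum [simp]:
  "dim_row (theta_sum a c m) = 2 * m" "dim_col (theta_sum a c m) = 2 * m"
  unfolding theta_sum_def dim_diag_block_mat by (induction m) auto

lemma double_eq_Suc: "2 * m = Suc i \<Longrightarrow> odd i"
  by presburger

lemma theta_sum_entry:
  "i < 2 * m \<Longrightarrow> j < 2 * m \<Longrightarrow> theta_sum a c m $$ (i, j) =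
      (if even i then if j = i then cnj (a (i + c)) else if j = Suc i then rho (a (i + c)) else 0
       else if j = i then - a (i - 1 + c) else if Suc j = i then rho (a (i - 1 + c)) else 0)"
proof (induction m)
  case (Suc m)
  have T: "theta_sum a c (Suc m) = four_block_mat (theta_sum a c m) (0\<^sub>m (2 * m) 2) (0\<^sub>m 2 (2 * m)) (Theta (a (2 * m + c)))"
    using dim_theta_sum[of a c m] by (simp add: theta_sum_def diag_block_mat_last Let_def)
  have cases: "i < 2 * m \<or> i = 2 * m \<or> i = Suc (2 * m)" "j < 2 * m \<or> j = 2 * m \<or> j = Suc (2 * m)"
    using Suc.prems by auto
  show ?case unfolding T using cases Suc.IH
    by (elim disjE) (auto dest: double_eq_Suc)
qed simp

lemma unit1_simps [simp]: "dim_row (unit1 c) = 1" "dim_col (unit1 c) = 1" "unit1 c $$ (0, 0) = c"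
  by (simp_all add: unit1_def)

lemma factor_theta_sum:
  "factor 0 k a = (if even k then theta_sum a 1 (k div 2)
     else four_block_mat (theta_sum a 1 (k div 2)) (0\<^sub>m (2 * (k div 2)) 1) (0\<^sub>m 1 (2 * (k div 2)))
            (unit1 (cnj (a k))))"
  "factor 1 k a = four_block_mat (unit1 (- a 0)) (0\<^sub>m 1 (k - 1)) (0\<^sub>m (k - 1) 1)
     (if odd k then theta_sum a 2 ((k - 1) div 2)
      else four_block_mat (theta_sum a 2 ((k - 1) div 2)) (0\<^sub>m (2 * ((k - 1) div 2)) 1)
            (0\<^sub>m 1 (2 * ((k - 1) div 2))) (unit1 (cnj (a k))))" if "1 \<le> k"
proof -
  show "factor 0 k a = (if even k then theta_sum a 1 (k div 2)
     else four_block_mat (theta_sum a 1 (k div 2)) (0\<^sub>m (2 * (k div 2)) 1) (0\<^sub>m 1 (2 * (k div 2)))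
            (unit1 (cnj (a k))))"
    using dim_theta_sum[of a 1 "k div 2"]
    unfolding factor_def filter_odd_upt map_map o_def theta_sum_def by (simp add: diag_block_mat_last Let_def)
  have *: "diag_block_mat (map (\<lambda>m. Theta (a m)) (filter even [1..<k])) = theta_sum a 2 ((k - 1) div 2)"
    unfolding filter_even_upt map_map o_def theta_sum_def ..
  have "(\<exists>m. k = Suc (Suc (2 * m))) \<or> (\<exists>m. k = Suc (2 * m))"
    using that by presburger
  then show "factor 1 k a = four_block_mat (unit1 (- a 0)) (0\<^sub>m 1 (k - 1)) (0\<^sub>m (k - 1) 1)
     (if odd k then theta_sum a 2 ((k - 1) div 2)
      else four_block_mat (theta_sum a 2 ((k - 1) div 2)) (0\<^sub>m (2 * ((k - 1) div 2)) 1)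
            (0\<^sub>m 1 (2 * ((k - 1) div 2))) (unit1 (cnj (a k))))"
    unfolding factor_def using *
    by (elim disjE exE) (simp_all add: diag_block_mat_last Let_def)
qed

lemma factor_carrier:
  assumes "1 \<le> k" "t \<le> 1"
  shows "factor t k a \<in> carrier_mat k k"
proof -
  have "even k \<Longrightarrow> Suc (2 * ((k - 1) div 2)) = k - 1" "odd k \<Longrightarrow> 2 * ((k - 1) div 2) = k - 1"
    "even k \<Longrightarrow> 2 * (k div 2) = k" "odd k \<Longrightarrow> Suc (2 * (k div 2)) = k"
    using assms by presburger+
  moreover have "t = 0 \<or> t = 1" using assms(2) by linarith
  ultimately show ?thesis
    using assms(1) factor_theta_sum[of k a] by (cases "even k") auto
qed

text \<open>The 1 by 1 blocks fit the pattern of the others: \<open>- a 0\<close> and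
  \<open>cnj (a k)\<close> are the corners of \<open>Theta (a 0)\<close> and
  \<open>Theta (a k)\<close> that lie inside the block.\<close>

lemma factor_entry:
  assumes "t \<le> 1" "i < k" "j < k"
  shows "factor t k a $$ (i, j) =
     (if even (i + t) then if j = i then cnj (a (Suc i)) else if j = Suc i then rho (a (Suc i)) else 0
      else if j = i then - a i else if Suc j = i then rho (a i) else 0)"
proof -
  have k: "1 \<le> k" using assms by linarith
  consider "t = 0" "even k" | m where "t = 0" "k = Suc (2 * m)"
    | m where "t = 1" "k = Suc (2 * m)" | m where "t = 1" "k = Suc (Suc (2 * m))"
  proof -
    have "even k \<Longrightarrow> \<exists>m. k = Suc (Suc (2 * m))" using k by presburger
    moreover have "odd k \<Longrightarrow> \<exists>m. k = Suc (2 * m)" by presburger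
    moreover have "t = 0 \<or> t = 1" using assms(1) by linarith
    ultimately show ?thesis using that by blast
  qed
  then show ?thesis
  proof cases
    case 1
    then show ?thesis
      using assms factor_theta_sum(1)[OF k, of a] by (auto simp: theta_sum_entry dest: double_eq_Suc)
  next
    case (2 m)
    have "factor t k a = four_block_mat (theta_sum a 1 m) (0\<^sub>m (2 * m) 1) (0\<^sub>m 1 (2 * m)) (unit1 (cnj (a k)))"
      using 2 factor_theta_sum(1)[OF k, of a] by simp
    moreover have "i < 2 * m \<or> i = 2 * m" "j < 2 * m \<or> j = 2 * m" using assms 2 by auto
    ultimately show ?thesis using 2 by (elim disjE) (auto simp: theta_sum_entry dest: double_eq_Suc)
  next
    case (3 m)
    have F: "factor t k a = four_block_mat (unit1 (- a 0)) (0\<^sub>m 1 (2 * m)) (0\<^sub>m (2 * m) 1) (theta_sum a 2 m)"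
      using 3 factor_theta_sum(2)[OF k, of a] by simp
    show ?thesis unfolding F using 3 assms
      by (cases i; cases j) (auto simp: theta_sum_entry dest: double_eq_Suc)
  next
    case (4 m)
    have F: "factor t k a = four_block_mat (unit1 (- a 0)) (0\<^sub>m 1 (Suc (2 * m))) (0\<^sub>m (Suc (2 * m)) 1)
        (four_block_mat (theta_sum a 2 m) (0\<^sub>m (2 * m) 1) (0\<^sub>m 1 (2 * m)) (unit1 (cnj (a k))))"
      using 4 factor_theta_sum(2)[OF k, of a] by simp
    have cases: "i = 0 \<or> (\<exists>i'<2 * m. i = Suc i') \<or> i = Suc (2 * m)"
      "j = 0 \<or> (\<exists>j'<2 * m. j = Suc j') \<or> j = Suc (2 * m)"
      using assms 4 by (cases i; cases j; auto)+
    show ?thesis unfolding F using cases 4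
      by (elim disjE exE conjE) (auto simp: theta_sum_entry dest: double_eq_Suc)
  qed
qed

lemma sum_two_terms:
  fixes f :: "nat \<Rightarrow> complex"
  assumes "i < k" "i \<noteq> p"
  shows "(\<Sum>j\<in>{0..<k}. (if j = i then x else if j = p then y else 0) * f j)
       = x * f i + (if p < k then y * f p else 0)"
proof -
  have "(\<Sum>j\<in>{0..<k}. (if j = i then x else if j = p then y else 0) * f j)
      = (\<Sum>j\<in>{0..<k}. (if j = i then x * f j else 0) + (if j = p then y * f j else 0))"
    using assms by (intro sum.cong) auto
  then show ?thesis using assms by (simp add: sum.distrib)
qed

text \<open>Component 0 goes to site n + 1: the n-th coefficient couples the sites n and n + 1, so a
  unimodular one cuts between them.\<close>

definition emb :: "nat \<Rightarrow> complex vec \<Rightarrow> nat \<Rightarrow> complex" where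
  "emb n v s = (if n < s \<and> s \<le> n + dim_vec v then v $ (s - n - 1) else 0)"

text \<open>Row i of the block is the site s = n + 1 + i. The parity assumption says that s + c is
  even exactly when i + t is, so the rows of the layer and of the factor have the same type.\<close>

lemma layer_emb:
  assumes "cmod (\<beta> n) = 1" "cmod (\<beta> (n + k)) = 1" "t \<le> 1" "odd (n + c + t)"
    and v: "v \<in> carrier_vec k" and "1 \<le> k"
  shows "layer \<beta> c (emb n v) = emb n (factor t k (\<lambda>m. \<beta> (n + m)) *\<^sub>v v)"
proof
  fix s
  let ?a = "\<lambda>m. \<beta> (n + m)"
  let ?f = "\<lambda>j. v $ j"
  have dv: "dim_vec v = k" using v by simp
  have dF: "dim_row (factor t k ?a) = k" "dim_col (factor t k ?a) = k"
    using factor_carrier[OF \<open>1 \<le> k\<close> \<open>t \<le> 1\<close>, of ?a] by auto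
  have r: "rho (\<beta> n) = 0" "rho (\<beta> (n + k)) = 0" using assms(1,2) by (simp_all add: rho_eq_0_iff)
  show "layer \<beta> c (emb n v) s = emb n (factor t k ?a *\<^sub>v v) s"
  proof (cases "n < s \<and> s \<le> n + k")
    case False
    have x: "emb n w s = 0" if "dim_vec w = k" for w using False that by (auto simp: emb_def)
    have "complex_of_real (rho (\<beta> s)) * emb n v (Suc s) = 0"
      using False dv r by (cases "s = n") (auto simp: emb_def)
    moreover have "complex_of_real (rho (\<beta> (s - 1))) * emb n v (s - 1) = 0"
      using False dv r by (cases "s - 1 = n + k") (auto simp: emb_def)
    ultimately have "layer \<beta> c (emb n v) s = 0"
      unfolding layer_def glay_def using x[OF dv] by (cases "s = 0") simp_all
    then show ?thesis using x dF by simp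
  next
    case True
    define i where "i = s - n - 1"
    have i: "s = n + Suc i" "i < k" using True by (auto simp: i_def)
    have par: "even (s + c) \<longleftrightarrow> even (i + t)" using assms(4) i(1) by auto
    have "emb n (factor t k ?a *\<^sub>v v) s = (\<Sum>j\<in>{0..<k}. factor t k ?a $$ (i, j) * v $ j)"
      using i dF dv by (simp add: emb_def scalar_prod_def)
    also have "\<dots> = layer \<beta> c (emb n v) s"
    proof (cases "even (i + t)")
      case True
      have "(\<Sum>j\<in>{0..<k}. factor t k ?a $$ (i, j) * v $ j)
          = (\<Sum>j\<in>{0..<k}. (if j = i then cnj (?a (Suc i)) else if j = Suc i then complex_of_real (rho (?a (Suc i))) else 0) * v $ j)"
        using True i(2) assms(3) by (intro sum.cong) (auto simp: factor_entry)
      also have "\<dots> = cnj (?a (Suc i)) * v $ i + (if Suc i < k then rho (?a (Suc i)) * v $ Suc i else 0)"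
        using i(2) by (intro sum_two_terms) auto
      also have "\<dots> = layer \<beta> c (emb n v) s"
        using True par i dv by (subst layer_even) (auto simp: emb_def)
      finally show ?thesis .
    next
      case False
      show ?thesis
      proof (cases i)
        case 0
        \<comment> \<open>The first row has no left neighbour; the void clause for
          \<open>j = k\<close> gives the sum the shape of \<open>sum_two_terms\<close>.\<close>
        have "(\<Sum>j\<in>{0..<k}. factor t k ?a $$ (i, j) * v $ j)
            = (\<Sum>j\<in>{0..<k}. (if j = 0 then - ?a 0 else if j = k then 0 else 0) * v $ j)"
          using False i(2) 0 assms(3) by (intro sum.cong) (auto simp: factor_entry)
        also have "\<dots> = - ?a 0 * v $ 0" using i(2) 0 by (subst sum_two_terms) auto
        also have "\<dots> = layer \<beta> c (emb n v) s"
          using False par i dv 0 r by (subst layer_odd) (auto simp: emb_def)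
        finally show ?thesis .
      next
        case (Suc p)
        have "(\<Sum>j\<in>{0..<k}. factor t k ?a $$ (i, j) * v $ j)
            = (\<Sum>j\<in>{0..<k}. (if j = i then - ?a i else if j = p then complex_of_real (rho (?a i)) else 0) * v $ j)"
          using False i(2) Suc assms(3) by (intro sum.cong) (auto simp: factor_entry)
        also have "\<dots> = - ?a i * v $ i + (if p < k then complex_of_real (rho (?a i)) * v $ p else 0)"
          using i(2) Suc by (intro sum_two_terms) auto
        also have "\<dots> = layer \<beta> c (emb n v) s"
          using False par i dv Suc by (subst layer_odd) (auto simp: emb_def)
        finally show ?thesis .
      qed
    qed
    finally show ?thesis by simp
  qed
qed

lemma C_tilde_carrier: "1 \<le> k \<Longrightarrow> C_tilde k a \<in> carrier_mat k k"
  unfolding C_tilde_factor by (intro mult_carrier_mat[where n = k] factor_carrier) auto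

lemma emb_smult: "emb n (c \<cdot>\<^sub>v v) = (\<lambda>s. c * emb n v s)"
  by (intro ext) (auto simp: emb_def)

lemma emb_inj:
  assumes "v \<in> carrier_vec k" "w \<in> carrier_vec k" "emb n v = emb n w"
  shows "v = w"
proof (rule eq_vecI)
  fix i assume "i < dim_vec w"
  moreover have "emb n v (n + Suc i) = emb n w (n + Suc i)" using assms(3) by simp
  ultimately show "v $ i = w $ i" using assms(1,2) by (simp add: emb_def)
qed (use assms in auto)

lemma emb_surj:
  assumes "\<And>s. s \<notin> {n<..n + k} \<Longrightarrow> x s = 0"
  shows "x = emb n (vec k (\<lambda>i. x (n + Suc i)))"
  using assms by (intro ext) (auto simp: emb_def)

lemma emb_zero: "emb n (0\<^sub>v k) = (\<lambda>s. 0)"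
  by (intro ext) (auto simp: emb_def)

lemma emb_eq_0_iff: "v \<in> carrier_vec k \<Longrightarrow> emb n v = (\<lambda>s. 0) \<longleftrightarrow> v = 0\<^sub>v k"
  using emb_inj[of v k "0\<^sub>v k" n] by (auto simp: emb_zero)

lemma layer_eq_0:
  assumes "\<And>i. cmod (\<alpha> i) \<le> 1" "layer \<alpha> c x = (\<lambda>i. 0)"
  shows "x = (\<lambda>i. 0)"
  using layer_inverse[of \<alpha> c x, OF assms(1)] unfolding assms(2) layer_zero by simp

text \<open>For odd \<open>n\<close> the block acts by the product \<open>A B\<close> of the two factors, for even \<open>n\<close> by \<open>B A\<close>, which has
  the same eigenvalues.\<close>

lemma eigenvalue_C_tilde_iff:
  assumes le1: "\<And>i. cmod (\<beta> i) \<le> 1"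
    and \<beta>: "cmod (\<beta> n) = 1" "cmod (\<beta> (n + k)) = 1" and "1 \<le> k"
  shows "eigenvalue (C_tilde k (\<lambda>m. \<beta> (n + m))) z \<longleftrightarrow>
     (\<exists>x. (\<forall>s. s \<notin> {n<..n + k} \<longrightarrow> x s = 0) \<and> x \<noteq> (\<lambda>s. 0)
        \<and> layer \<beta> 0 (layer \<beta> 1 x) = (\<lambda>s. z * x s))" (is "_ \<longleftrightarrow> (\<exists>x. ?P x)")
proof -
  define A where "A = factor 0 k (\<lambda>m. \<beta> (n + m))"
  define B where "B = factor 1 k (\<lambda>m. \<beta> (n + m))"
  have A: "A \<in> carrier_mat k k" and B: "B \<in> carrier_mat k k"
    unfolding A_def B_def using \<open>1 \<le> k\<close> by (auto intro: factor_carrier)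
  have AB: "(A * B) *\<^sub>v v = A *\<^sub>v (B *\<^sub>v v)" if "v \<in> carrier_vec k" for v
    using A B that by (rule assoc_mult_mat_vec)
  have lA: "layer \<beta> c (emb n v) = emb n (A *\<^sub>v v)" if "odd (n + c)" "v \<in> carrier_vec k" for c v
    unfolding A_def using \<beta> that \<open>1 \<le> k\<close> by (intro layer_emb) auto
  have lB: "layer \<beta> c (emb n v) = emb n (B *\<^sub>v v)" if "even (n + c)" "v \<in> carrier_vec k" for c v
    unfolding B_def using \<beta> that \<open>1 \<le> k\<close> by (intro layer_emb) auto
  have Av: "A *\<^sub>v v \<in> carrier_vec k" and Bv: "B *\<^sub>v v \<in> carrier_vec k" if "v \<in> carrier_vec k" for v
    using A B that by auto
  \<comment> \<open>\<open>Suc n\<close> has the parity for which the layer acts on the block by A,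
    so A inherits injectivity from the invertible layer; for B this is the parity of n.\<close>
  have injA: "A *\<^sub>v v \<noteq> 0\<^sub>v k" if "v \<in> carrier_vec k" "v \<noteq> 0\<^sub>v k" for v
  proof
    assume "A *\<^sub>v v = 0\<^sub>v k"
    then have "layer \<beta> (Suc n) (emb n v) = (\<lambda>s. 0)"
      using lA[of "Suc n" v] that by (simp add: emb_zero)
    from layer_eq_0[OF le1 this] that show False by (simp add: emb_eq_0_iff)
  qed
  have injB: "B *\<^sub>v v \<noteq> 0\<^sub>v k" if "v \<in> carrier_vec k" "v \<noteq> 0\<^sub>v k" for v
  proof
    assume "B *\<^sub>v v = 0\<^sub>v k"
    then have "layer \<beta> n (emb n v) = (\<lambda>s. 0)"
      using lB[of n v] that by (simp add: emb_zero)
    from layer_eq_0[OF le1 this] that show False by (simp add: emb_eq_0_iff)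
  qed
  have ev: "eigenvalue (C_tilde k (\<lambda>m. \<beta> (n + m))) z
      \<longleftrightarrow> (\<exists>v\<in>carrier_vec k. v \<noteq> 0\<^sub>v k \<and> A *\<^sub>v (B *\<^sub>v v) = z \<cdot>\<^sub>v v)"
  proof -
    have "dim_row (A * B) = k" using A by simp
    then have "eigenvalue (C_tilde k (\<lambda>m. \<beta> (n + m))) z
        \<longleftrightarrow> (\<exists>v. v \<in> carrier_vec k \<and> v \<noteq> 0\<^sub>v k \<and> (A * B) *\<^sub>v v = z \<cdot>\<^sub>v v)"
      by (simp only: eigenvalue_def eigenvector_def C_tilde_factor A_def B_def)
    also have "\<dots> \<longleftrightarrow> (\<exists>v\<in>carrier_vec k. v \<noteq> 0\<^sub>v k \<and> A *\<^sub>v (B *\<^sub>v v) = z \<cdot>\<^sub>v v)"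
      unfolding Bex_def by (intro ex_cong1 conj_cong refl) (simp add: AB)
    finally show ?thesis .
  qed
  have Px: "(\<exists>x. ?P x) \<longleftrightarrow> (\<exists>v\<in>carrier_vec k. v \<noteq> 0\<^sub>v k
      \<and> layer \<beta> 0 (layer \<beta> 1 (emb n v)) = emb n (z \<cdot>\<^sub>v v))"
  proof
    assume "\<exists>x. ?P x"
    then obtain x where x: "?P x" ..
    define v where "v = vec k (\<lambda>i. x (n + Suc i))"
    have v: "v \<in> carrier_vec k" by (simp add: v_def)
    have xv: "x = emb n v" unfolding v_def using x by (intro emb_surj) blast
    show "\<exists>v\<in>carrier_vec k. v \<noteq> 0\<^sub>v k \<and> layer \<beta> 0 (layer \<beta> 1 (emb n v)) = emb n (z \<cdot>\<^sub>v v)"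
    proof (intro bexI conjI)
      show "v \<noteq> 0\<^sub>v k" using x emb_eq_0_iff[OF v, of n] unfolding xv by simp
      show "layer \<beta> 0 (layer \<beta> 1 (emb n v)) = emb n (z \<cdot>\<^sub>v v)" using x unfolding xv emb_smult by simp
    qed (rule v)
  next
    assume "\<exists>v\<in>carrier_vec k. v \<noteq> 0\<^sub>v k \<and> layer \<beta> 0 (layer \<beta> 1 (emb n v)) = emb n (z \<cdot>\<^sub>v v)"
    then obtain v where v: "v \<in> carrier_vec k" "v \<noteq> 0\<^sub>v k"
      "layer \<beta> 0 (layer \<beta> 1 (emb n v)) = emb n (z \<cdot>\<^sub>v v)" by (elim bexE conjE)
    have "?P (emb n v)"
    proof (intro conjI)
      show "\<forall>s. s \<notin> {n<..n + k} \<longrightarrow> emb n v s = 0" using v(1) by (auto simp: emb_def)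
      show "emb n v \<noteq> (\<lambda>s. 0)" using v(2) emb_eq_0_iff[OF v(1), of n] by simp
      show "layer \<beta> 0 (layer \<beta> 1 (emb n v)) = (\<lambda>s. z * emb n v s)" using v(3) by (simp only: emb_smult)
    qed
    then show "\<exists>x. ?P x" by (rule exI[where P = ?P])
  qed
  show ?thesis
  proof (cases "even n")
    case False
    have "layer \<beta> 0 (layer \<beta> 1 (emb n v)) = emb n (A *\<^sub>v (B *\<^sub>v v))" if "v \<in> carrier_vec k" for v
      using False that lA[of 0 "B *\<^sub>v v"] lB[of 1 v] Bv by simp
    moreover have "emb n (A *\<^sub>v (B *\<^sub>v v)) = emb n (z \<cdot>\<^sub>v v) \<longleftrightarrow> A *\<^sub>v (B *\<^sub>v v) = z \<cdot>\<^sub>v v"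
      if "v \<in> carrier_vec k" for v
      using that emb_inj[of "A *\<^sub>v (B *\<^sub>v v)" k "z \<cdot>\<^sub>v v" n] Av Bv by auto
    ultimately show ?thesis unfolding ev Px by (intro bex_cong refl conj_cong) simp
  next
    case True
    have "layer \<beta> 0 (layer \<beta> 1 (emb n v)) = emb n (B *\<^sub>v (A *\<^sub>v v))" if "v \<in> carrier_vec k" for v
      using True that lB[of 0 "A *\<^sub>v v"] lA[of 1 v] Av by simp
    moreover have "emb n (B *\<^sub>v (A *\<^sub>v v)) = emb n (z \<cdot>\<^sub>v v) \<longleftrightarrow> B *\<^sub>v (A *\<^sub>v v) = z \<cdot>\<^sub>v v"
      if "v \<in> carrier_vec k" for v
      using that emb_inj[of "B *\<^sub>v (A *\<^sub>v v)" k "z \<cdot>\<^sub>v v" n] Av Bv by auto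
    ultimately have "(\<exists>x. ?P x) \<longleftrightarrow> (\<exists>v\<in>carrier_vec k. v \<noteq> 0\<^sub>v k \<and> B *\<^sub>v (A *\<^sub>v v) = z \<cdot>\<^sub>v v)"
      unfolding Px by (intro bex_cong refl conj_cong) simp
    \<comment> \<open>A and B intertwine the two products and, being injective, carry eigenvectors
      to eigenvectors.\<close>
    also have "\<dots> \<longleftrightarrow> (\<exists>v\<in>carrier_vec k. v \<noteq> 0\<^sub>v k \<and> A *\<^sub>v (B *\<^sub>v v) = z \<cdot>\<^sub>v v)"
    proof
      assume "\<exists>v\<in>carrier_vec k. v \<noteq> 0\<^sub>v k \<and> B *\<^sub>v (A *\<^sub>v v) = z \<cdot>\<^sub>v v"
      then obtain v where v: "v \<in> carrier_vec k" "v \<noteq> 0\<^sub>v k" "B *\<^sub>v (A *\<^sub>v v) = z \<cdot>\<^sub>v v" by (elim bexE conjE)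
      have "A *\<^sub>v (B *\<^sub>v (A *\<^sub>v v)) = z \<cdot>\<^sub>v (A *\<^sub>v v)"
        unfolding v(3) using A v(1) by (rule mult_mat_vec)
      then show "\<exists>v\<in>carrier_vec k. v \<noteq> 0\<^sub>v k \<and> A *\<^sub>v (B *\<^sub>v v) = z \<cdot>\<^sub>v v"
        using Av[OF v(1)] injA[OF v(1,2)] by (intro bexI[of _ "A *\<^sub>v v"] conjI)
    next
      assume "\<exists>v\<in>carrier_vec k. v \<noteq> 0\<^sub>v k \<and> A *\<^sub>v (B *\<^sub>v v) = z \<cdot>\<^sub>v v"
      then obtain v where v: "v \<in> carrier_vec k" "v \<noteq> 0\<^sub>v k" "A *\<^sub>v (B *\<^sub>v v) = z \<cdot>\<^sub>v v" by (elim bexE conjE)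
      have "B *\<^sub>v (A *\<^sub>v (B *\<^sub>v v)) = z \<cdot>\<^sub>v (B *\<^sub>v v)"
        unfolding v(3) using B v(1) by (rule mult_mat_vec)
      then show "\<exists>v\<in>carrier_vec k. v \<noteq> 0\<^sub>v k \<and> B *\<^sub>v (A *\<^sub>v v) = z \<cdot>\<^sub>v v"
        using Bv[OF v(1)] injB[OF v(1,2)] by (intro bexI[of _ "B *\<^sub>v v"] conjI)
    qed
    finally show ?thesis unfolding ev by simp
  qed
qed

section \<open>Approximate eigenvectors and limit matrices\<close>

definition weyl :: "(nat \<Rightarrow> complex) \<Rightarrow> complex \<Rightarrow> bool" where
  "weyl \<alpha> z \<longleftrightarrow> (\<forall>N. \<forall>e>0. \<exists>x\<in>tail N. norm x = 1 \<and> norm (Cmv \<alpha> x - z *\<^sub>C x) < e)"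

lemma prod_linear:
  assumes "finite \<Lambda>"
  shows "degree (\<Prod>z\<in>\<Lambda>. [:-z, 1:]) = card \<Lambda>"
    and "lead_coeff (\<Prod>z\<in>\<Lambda>. [:-z, 1:]) = 1"
    and "(\<And>z. z \<in> \<Lambda> \<Longrightarrow> cmod z = 1) \<Longrightarrow> cmod (coeff (\<Prod>z\<in>\<Lambda>. [:-z, 1:]) 0) = 1"
proof -
  show "degree (\<Prod>z\<in>\<Lambda>. [:-z, 1:]) = card \<Lambda>"
    by (subst degree_prod_eq_sum_degree) auto
  show "lead_coeff (\<Prod>z\<in>\<Lambda>. [:-z, 1:]) = 1"
    by (simp add: lead_coeff_prod)
  assume "\<And>z. z \<in> \<Lambda> \<Longrightarrow> cmod z = 1"
  then show "cmod (coeff (\<Prod>z\<in>\<Lambda>. [:-z, 1:]) 0) = 1"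
    by (simp add: poly_0_coeff_0[symmetric] poly_prod prod_norm[symmetric])
qed

lemma prod_rho_tendsto_0:
  assumes le1: "\<And>i. cmod (\<alpha> i) \<le> 1"
    and fin: "finite \<Lambda>" and ne: "\<Lambda> \<noteq> {}" and unit: "\<And>z. z \<in> \<Lambda> \<Longrightarrow> cmod z = 1"
    and spec: "\<And>z. weyl \<alpha> z \<Longrightarrow> z \<in> \<Lambda>"
  shows "(\<lambda>n. \<Prod>i<card \<Lambda>. rho (\<alpha> (n + i))) \<longlonglongrightarrow> 0"
proof (rule LIMSEQ_I)
  fix r :: real assume "0 < r"
  interpret filtered_isometry "Cmv \<alpha>" tail using le1 by (rule filtered_isometry_Cmv)
  have "z \<in> \<Lambda>" if "approx_spec z" for z
    using spec[of z] that unfolding approx_spec_def weyl_def .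
  then obtain N where N: "\<forall>x\<in>tail N. norm (polyop (Cmv \<alpha>) (\<Prod>z\<in>\<Lambda>. [:-z, 1:]) x) \<le> r / 2 * norm x"
    using polyop_small[OF fin ne unit, of "r / 2"] \<open>0 < r\<close> by auto
  have "norm ((\<Prod>i<card \<Lambda>. rho (\<alpha> (n + i))) - 0) < r" if "n \<ge> N" for n
  proof -
    have "unitv n \<in> tail N" using that by (simp add: tail_def)
    then have "norm (polyop (Cmv \<alpha>) (\<Prod>z\<in>\<Lambda>. [:-z, 1:]) (unitv n)) \<le> r / 2 * norm (unitv n)"
      using N by blast
    then have "(\<Prod>i<card \<Lambda>. rho (\<alpha> (n + i))) \<le> r / 2"
      using prod_rho_le_norm_polyop[of \<alpha>, OF le1 prod_linear(2)[OF fin] prod_linear(3)[OF fin unit], where n = n]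
      by (simp add: prod_linear(1)[OF fin])
    moreover have "0 \<le> (\<Prod>i<card \<Lambda>. rho (\<alpha> (n + i)))"
      by (intro prod_nonneg ballI rho_nonneg le1)
    ultimately show ?thesis using \<open>0 < r\<close> by simp
  qed
  then show "\<exists>no. \<forall>n\<ge>no. norm ((\<Prod>i<card \<Lambda>. rho (\<alpha> (n + i))) - 0) < r" by blast
qed

lemma C_tilde_cong:
  assumes "1 \<le> k" "\<And>m. m \<le> k \<Longrightarrow> a m = b m"
  shows "C_tilde k a = C_tilde k b"
proof -
  have "factor t k a = factor t k b" if "t \<le> 1" for t
  proof (rule eq_matI)
    note F = factor_carrier[OF assms(1) that]
    fix i j assume "i < dim_row (factor t k b)" "j < dim_col (factor t k b)"
    then show "factor t k a $$ (i, j) = factor t k b $$ (i, j)"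
      using that F[of b] assms(2)[of i] assms(2)[of "Suc i"] by (auto simp: factor_entry)
  qed (use factor_carrier[OF assms(1) that, of a] factor_carrier[OF assms(1) that, of b] in auto)
  then show ?thesis by (simp add: C_tilde_factor)
qed

lemma layer_block_support:
  assumes "cmod (\<beta> n) = 1" "cmod (\<beta> (n + k)) = 1" "\<And>s. s \<notin> {n<..n + k} \<Longrightarrow> x s = 0"
    and "s \<notin> {n<..n + k}"
  shows "layer \<beta> c x s = 0"
proof -
  have r: "rho (\<beta> n) = 0" "rho (\<beta> (n + k)) = 0" using assms(1,2) by (simp_all add: rho_eq_0_iff)
  have "x s = 0" using assms by blast
  moreover have "complex_of_real (rho (\<beta> s)) * x (Suc s) = 0"
    using assms(3)[of "Suc s"] assms(4) r by (cases "s = n") auto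
  moreover have "complex_of_real (rho (\<beta> (s - 1))) * x (s - 1) = 0"
  proof -
    have "s - 1 = n + k \<or> s - 1 \<notin> {n<..n + k}" using assms(4) by auto
    then show ?thesis using assms(3)[of "s - 1"] r by (elim disjE) simp_all
  qed
  ultimately show ?thesis unfolding layer_def glay_def by (cases "s = 0") simp_all
qed

lemma ell2_block:
  assumes "\<And>s. s \<notin> {n<..n + k} \<Longrightarrow> x s = 0"
  shows "x \<in> ell2"
proof (rule ell2_finite_support)
  have "{s. x s \<noteq> 0} \<subseteq> {n<..n + k}"
  proof
    fix s assume "s \<in> {s. x s \<noteq> 0}"
    then show "s \<in> {n<..n + k}" using assms[of s] by (cases "s \<in> {n<..n + k}") simp_all
  qed
  then show "finite {s. x s \<noteq> 0}" by (rule finite_subset) simp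
qed

lemma block_eigenvector_l2:
  assumes le1: "\<And>i. cmod (\<beta> i) \<le> 1"
    and "cmod (\<beta> n) = 1" "cmod (\<beta> (n + k)) = 1" "1 \<le> k"
    and "eigenvalue (C_tilde k (\<lambda>m. \<beta> (n + m))) z"
  obtains x where "x \<in> tail (Suc n)" "norm x = 1" "Cmv \<beta> x = z *\<^sub>C x"
proof -
  have "\<exists>x. (\<forall>s. s \<notin> {n<..n + k} \<longrightarrow> x s = 0) \<and> x \<noteq> (\<lambda>s. 0)
        \<and> layer \<beta> 0 (layer \<beta> 1 x) = (\<lambda>s. z * x s)"
    using eigenvalue_C_tilde_iff[OF assms(1-4)] assms(5) by simp
  then obtain x where x: "\<And>s. s \<notin> {n<..n + k} \<Longrightarrow> x s = 0" "x \<noteq> (\<lambda>s. 0)"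
    "layer \<beta> 0 (layer \<beta> 1 x) = (\<lambda>s. z * x s)" by blast
  have x_ell2: "x \<in> ell2" using x(1) by (rule ell2_block)
  define X where "X = Abs_l2 x"
  have cX: "coord X = x" unfolding X_def using x_ell2 by (rule coord_Abs)
  have "X \<noteq> 0" using x(2) cX by (auto simp: fun_eq_iff)
  have "Cmv \<beta> X = z *\<^sub>C X"
    by (rule l2_eqI) (simp only: coord_Cmv[OF le1] cX x(3) coord_cscale)
  then have "Cmv \<beta> (complex_of_real (1 / norm X) *\<^sub>C X) = z *\<^sub>C complex_of_real (1 / norm X) *\<^sub>C X"
    by (simp only: Cmv_cscale[OF le1]) (simp add: mult.commute)
  moreover have "norm (complex_of_real (1 / norm X) *\<^sub>C X) = 1" using \<open>X \<noteq> 0\<close> by (simp add: norm_divide)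
  moreover have "complex_of_real (1 / norm X) *\<^sub>C X \<in> tail (Suc n)"
    using x(1) by (simp add: tail_def cX)
  ultimately show thesis by (intro that)
qed

text \<open>Were there fewer than k eigenvalues, the polynomial p with a simple root at each would
  give p(C) = 0 on the block. But on the unit vector at site 1, the first of the block, p(C) has
  norm at least a product of fewer than k factors \<open>rho (a 1)\<close>,
  \<open>rho (a 2)\<close>, ..., none of which is 0.\<close>

lemma card_spectrum_C_tilde:
  assumes "1 \<le> k" "cmod (a 0) = 1" "cmod (a k) = 1" "\<And>m. m \<in> {1..<k} \<Longrightarrow> cmod (a m) < 1"
  shows "card (spectrum (C_tilde k a)) = k"
proof -
  define \<beta> where "\<beta> i = (if i \<le> k then a i else 0)" for i
  have "cmod (a m) \<le> 1" if "m \<le> k" for m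
  proof -
    have "m = 0 \<or> m = k \<or> m \<in> {1..<k}" using that by auto
    then show ?thesis using assms(2,3) assms(4)[of m] by (elim disjE) simp_all
  qed
  then have le1: "cmod (\<beta> i) \<le> 1" for i by (simp add: \<beta>_def)
  have \<beta>0: "cmod (\<beta> 0) = 1" "cmod (\<beta> (0 + k)) = 1" using assms by (simp_all add: \<beta>_def)
  have C: "C_tilde k a = C_tilde k (\<lambda>m. \<beta> (0 + m))"
    using assms(1) by (intro C_tilde_cong) (simp_all add: \<beta>_def)
  define S where "S = {x :: l2. \<forall>s. s \<notin> {0<..0 + k} \<longrightarrow> coord x s = 0}"
  \<comment> \<open>The block is cut off on both sides, hence invariant, and serves as a constant
    family of subspaces.\<close>
  interpret filtered_isometry "Cmv \<beta>" "\<lambda>_. S"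
  proof
    show "Cmv \<beta> x \<in> S" if "x \<in> S" for x
      unfolding S_def mem_Collect_eq coord_Cmv[OF le1]
    proof (intro allI impI)
      fix s assume s: "s \<notin> {0<..0 + k}"
      have "coord x s = 0" if "s \<notin> {0<..0 + k}" for s using \<open>x \<in> S\<close> that unfolding S_def by blast
      then show "layer \<beta> 0 (layer \<beta> 1 (coord x)) s = 0"
        by (intro layer_block_support[OF \<beta>0 layer_block_support[OF \<beta>0 _] s])
    qed
  qed (simp_all add: Cmv_add Cmv_cscale norm_Cmv le1 S_def)
  define \<Lambda> where "\<Lambda> = spectrum (C_tilde k a)"
  have car: "C_tilde k a \<in> carrier_mat k k" using assms(1) by (rule C_tilde_carrier)
  have fin: "finite \<Lambda>" and card: "card \<Lambda> \<le> k"
    using card_finite_spectrum[OF car] by (simp_all add: \<Lambda>_def)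
  have ne: "\<Lambda> \<noteq> {}" unfolding \<Lambda>_def using spectrum_non_empty[OF car] assms(1) by simp
  have unit: "cmod z = 1" if "z \<in> \<Lambda>" for z
  proof -
    have "eigenvalue (C_tilde k (\<lambda>m. \<beta> (0 + m))) z"
      using that unfolding \<Lambda>_def spectrum_def C by simp
    then obtain x where "norm x = 1" "Cmv \<beta> x = z *\<^sub>C x"
      by (rule block_eigenvector_l2[OF le1 \<beta>0 assms(1)])
    then show ?thesis using norm_U[of x] by simp
  qed
  \<comment> \<open>On a finite block an approximate eigenvalue is an eigenvalue:
    \<open>limit_eigenvector\<close> is applied with the same coefficients at every index.\<close>
  have spec: "z \<in> \<Lambda>" if "approx_spec z" for z
  proof -
    have "\<exists>x. x \<in> S \<and> norm x = 1 \<and> norm (Cmv \<beta> x - z *\<^sub>C x) < inverse (real (Suc j))" for j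
      using that unfolding approx_spec_def by (metis inverse_positive_iff_positive of_nat_0_less_iff zero_less_Suc)
    then obtain X where X: "\<And>j. X j \<in> S" "\<And>j. norm (X j) = 1"
      "\<And>j. norm (Cmv \<beta> (X j) - z *\<^sub>C X j) < inverse (real (Suc j))" by metis
    have supp: "coord (X j) i = 0" if "i \<notin> {0<..0 + k}" for i j
      using X(1)[of j] that unfolding S_def by blast
    have nrm: "(\<Sum>i\<in>{0<..0 + k}. (cmod (coord (X j) i))\<^sup>2) = 1" for j
    proof -
      have "(norm (X j))\<^sup>2 = (\<Sum>i\<in>{0<..0 + k}. (cmod (coord (X j) i))\<^sup>2)"
        unfolding norm_l2_sq by (rule suminf_finite) (simp_all add: supp)
      then show ?thesis using X(2)[of j] by simp
    qed
    have res: "(\<lambda>j. layer \<beta> 0 (layer \<beta> 1 (coord (X j))) i - z * coord (X j) i) \<longlonglongrightarrow> 0" for i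
    proof (rule tendsto_0_le[where K = 1])
      show "(\<lambda>j. inverse (real (Suc j))) \<longlonglongrightarrow> 0" by (rule LIMSEQ_inverse_real_of_nat)
      have "norm (layer \<beta> 0 (layer \<beta> 1 (coord (X j))) i - z * coord (X j) i) \<le> norm (inverse (real (Suc j))) * 1" for j
        using norm_coord_le[of "Cmv \<beta> (X j) - z *\<^sub>C X j" i] X(3)[of j] by (simp add: coord_Cmv[OF le1])
      then show "\<forall>\<^sub>F j in sequentially. norm (layer \<beta> 0 (layer \<beta> 1 (coord (X j))) i - z * coord (X j) i)
          \<le> norm (inverse (real (Suc j))) * 1" by (intro always_eventually allI)
    qed
    have \<beta>k: "\<beta> i = 0" if "i > 0 + k" for i using that by (simp add: \<beta>_def)
    obtain r :: "nat \<Rightarrow> nat" and \<beta>' u where "strict_mono r" and u: "\<And>i. (\<lambda>j::nat. \<beta> i) \<longlonglongrightarrow> \<beta>' i" "\<And>i. i \<notin> {0<..0 + k} \<Longrightarrow> u i = 0"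
      "u \<noteq> (\<lambda>i. 0)" "\<And>i. i \<in> {0<..0 + k} \<Longrightarrow> layer \<beta>' 0 (layer \<beta>' 1 u) i = z * u i"
      by (rule limit_eigenvector[of "\<lambda>_. \<beta>" "0 + k" 0 "\<lambda>j. coord (X j)" z, OF le1 \<beta>k supp nrm res])
        (assumption | rule that)+
    have "\<beta>' = \<beta>" using u(1) by (simp add: LIMSEQ_const_iff fun_eq_iff)
    have eq: "layer \<beta> 0 (layer \<beta> 1 u) = (\<lambda>s. z * u s)"
    proof
      fix s
      show "layer \<beta> 0 (layer \<beta> 1 u) s = z * u s"
      proof (cases "s \<in> {0<..0 + k}")
        case True then show ?thesis using u(4) \<open>\<beta>' = \<beta>\<close> by simp
      next
        case False
        have "layer \<beta> 0 (layer \<beta> 1 u) s = 0"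
          by (rule layer_block_support[OF \<beta>0 layer_block_support[OF \<beta>0 u(2)] False])
        then show ?thesis using u(2)[OF False] by simp
      qed
    qed
    have "eigenvalue (C_tilde k (\<lambda>m. \<beta> (0 + m))) z"
      unfolding eigenvalue_C_tilde_iff[OF le1 \<beta>0 assms(1)]
      by (rule exI[of _ u], intro conjI allI impI u(2,3) eq)
    then show ?thesis unfolding \<Lambda>_def spectrum_def C by simp
  qed
  have "\<not> card \<Lambda> < k"
  proof
    assume less: "card \<Lambda> < k"
    have "unitv 1 \<in> S" using assms(1) by (simp add: S_def)
    have "norm (polyop (Cmv \<beta>) (\<Prod>z\<in>\<Lambda>. [:-z, 1:]) (unitv 1)) \<le> 0 + e" if "0 < e" for e
    proof -
      have "\<exists>N::nat. \<forall>x\<in>S. norm (polyop (Cmv \<beta>) (\<Prod>z\<in>\<Lambda>. [:-z, 1:]) x) \<le> e * norm x"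
        using fin ne unit spec that by (rule polyop_small)
      then have "norm (polyop (Cmv \<beta>) (\<Prod>z\<in>\<Lambda>. [:-z, 1:]) (unitv 1)) \<le> e * norm (unitv 1)"
        using \<open>unitv 1 \<in> S\<close> by blast
      then show ?thesis by simp
    qed
    then have "norm (polyop (Cmv \<beta>) (\<Prod>z\<in>\<Lambda>. [:-z, 1:]) (unitv 1)) \<le> 0"
      by (rule field_le_epsilon)
    then have "(\<Prod>i<card \<Lambda>. rho (\<beta> (1 + i))) \<le> 0"
      using prod_rho_le_norm_polyop[of \<beta>, OF le1 prod_linear(2)[OF fin] prod_linear(3)[OF fin unit], where n = 1]
      by (simp add: prod_linear(1)[OF fin])
    moreover have "0 < (\<Prod>i<card \<Lambda>. rho (\<beta> (1 + i)))"
    proof (intro prod_pos ballI)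
      fix i assume "i \<in> {..<card \<Lambda>}"
      then have "1 + i \<in> {1..<k}" using less by simp
      then have "cmod (\<beta> (1 + i)) < 1" using assms(4)[of "1 + i"] by (simp add: \<beta>_def)
      then show "0 < rho (\<beta> (1 + i))" by (simp add: rho_def power_less_one_iff)
    qed
    ultimately show False by simp
  qed
  then show ?thesis using card by (simp add: \<Lambda>_def)
qed

lemma limit_dataD:
  assumes lt1: "\<And>i. cmod (\<alpha> i) < 1" and L: "limit_data \<alpha> k n a"
  shows "\<And>m. m \<le> k \<Longrightarrow> cmod (a m) \<le> 1" "cmod (a 0) = 1" "cmod (a k) = 1"
    and "\<And>m. m \<in> {1..<k} \<Longrightarrow> cmod (a m) < 1"
    and "\<And>m. m \<le> k \<Longrightarrow> (\<lambda>j. \<alpha> (n j + m)) \<longlonglongrightarrow> a m" "filterlim n at_top sequentially"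
proof -
  show lim: "(\<lambda>j. \<alpha> (n j + m)) \<longlonglongrightarrow> a m" if "m \<le> k" for m
    using L that by (simp add: limit_data_def)
  show "filterlim n at_top sequentially" using L by (simp add: limit_data_def)
  show le: "cmod (a m) \<le> 1" if "m \<le> k" for m
    using tendsto_norm[OF lim[OF that]]
    by (rule LIMSEQ_le_const2) (use lt1 in \<open>auto intro: less_imp_le\<close>)
  have "(\<lambda>j. rho (\<alpha> (n j + 0))) \<longlonglongrightarrow> 0" "(\<lambda>j. rho (\<alpha> (n j + k))) \<longlonglongrightarrow> 0"
    using L by (simp_all add: limit_data_def)
  from LIMSEQ_unique[OF this(1) tendsto_rho[OF lim]] LIMSEQ_unique[OF this(2) tendsto_rho[OF lim]]
  have "rho (a 0) = 0" "rho (a k) = 0" by simp_all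
  then show "cmod (a 0) = 1" "cmod (a k) = 1" by (simp_all add: rho_eq_0_iff)
  show "cmod (a m) < 1" if "m \<in> {1..<k}" for m
  proof -
    have "cmod (a m) \<noteq> 1" using L that unfolding limit_data_def by blast
    moreover have "m \<le> k" using that by simp
    ultimately show ?thesis using le[of m] by simp
  qed
qed

text \<open>Overwriting the coefficients from n j to n j + k by their limits cuts the block out
  exactly. An eigenvector of the modified operator on this block is supported beyond n j and solves
  the original equation up to a small error.\<close>

lemma eigenvalue_C_tilde_weyl:
  assumes lt1: "\<And>i. cmod (\<alpha> i) < 1" and "1 \<le> k" and L: "limit_data \<alpha> k n a"
    and ev: "eigenvalue (C_tilde k a) z"
  shows "weyl \<alpha> z"
  unfolding weyl_def
proof (intro allI impI)
  fix N and e :: real assume "0 < e"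
  note D = limit_dataD[OF lt1 L]
  have le1: "cmod (\<alpha> i) \<le> 1" for i using lt1[of i] by simp
  \<comment> \<open>\<open>Cmv_perturb\<close> turns a coefficient error d into an operator error
    \<open>4 * d\<close>, here e / 2.\<close>
  define d where "d = e / 8"
  have "d > 0" using \<open>0 < e\<close> by (simp add: d_def)
  have "\<forall>\<^sub>F j in sequentially. cmod (\<alpha> (n j + m) - a m) < d \<and> \<bar>rho (\<alpha> (n j + m)) - rho (a m)\<bar> < d"
    if "m \<in> {..k}" for m
    using tendstoD[OF D(5) \<open>d > 0\<close>, of m] tendstoD[OF tendsto_rho[OF D(5)] \<open>d > 0\<close>, of m] that
    by (simp add: dist_norm eventually_conj)
  then have "\<forall>\<^sub>F j in sequentially. \<forall>m\<in>{..k}. cmod (\<alpha> (n j + m) - a m) < d \<and> \<bar>rho (\<alpha> (n j + m)) - rho (a m)\<bar> < d"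
    by (intro eventually_ball_finite finite_atMost ballI)
  moreover have "\<forall>\<^sub>F j in sequentially. N \<le> n j"
    using D(6) by (simp add: filterlim_at_top)
  ultimately have "\<forall>\<^sub>F j in sequentially. (\<forall>m\<in>{..k}. cmod (\<alpha> (n j + m) - a m) < d
      \<and> \<bar>rho (\<alpha> (n j + m)) - rho (a m)\<bar> < d) \<and> N \<le> n j" by (rule eventually_conj)
  then have "\<exists>j. (\<forall>m\<in>{..k}. cmod (\<alpha> (n j + m) - a m) < d
      \<and> \<bar>rho (\<alpha> (n j + m)) - rho (a m)\<bar> < d) \<and> N \<le> n j"
    by (rule eventually_happens'[OF sequentially_bot])
  then obtain j where j: "\<And>m. m \<le> k \<Longrightarrow> cmod (\<alpha> (n j + m) - a m) < d"
    "\<And>m. m \<le> k \<Longrightarrow> \<bar>rho (\<alpha> (n j + m)) - rho (a m)\<bar> < d" "N \<le> n j" by auto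
  define \<beta> where "\<beta> i = (if n j \<le> i \<and> i \<le> n j + k then a (i - n j) else \<alpha> i)" for i
  have \<beta>le1: "cmod (\<beta> i) \<le> 1" for i using le1[of i] D(1)[of "i - n j"] by (auto simp: \<beta>_def)
  have \<beta>a: "\<beta> (n j + m) = a m" if "m \<le> k" for m using that by (simp add: \<beta>_def)
  have c1: "cmod (\<beta> (n j)) = 1" "cmod (\<beta> (n j + k)) = 1"
    using D(2,3) \<beta>a[of 0] \<beta>a[of k] by simp_all
  have "eigenvalue (C_tilde k (\<lambda>m. \<beta> (n j + m))) z"
    using ev C_tilde_cong[OF \<open>1 \<le> k\<close>, of "\<lambda>m. \<beta> (n j + m)" a] \<beta>a by simp
  then obtain x where x: "x \<in> tail (Suc (n j))" "norm x = 1" "Cmv \<beta> x = z *\<^sub>C x"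
    by (rule block_eigenvector_l2[OF \<beta>le1 c1 \<open>1 \<le> k\<close>])
  have "norm (Cmv \<alpha> x - Cmv \<beta> x) \<le> 4 * d * norm x"
  proof (rule Cmv_perturb[OF le1 \<beta>le1])
    fix i
    have "cmod (\<alpha> i - \<beta> i) \<le> d \<and> \<bar>rho (\<alpha> i) - rho (\<beta> i)\<bar> \<le> d"
    proof (cases "n j \<le> i \<and> i \<le> n j + k")
      case True
      then have "i - n j \<le> k" by auto
      from j(1)[OF this] j(2)[OF this] show ?thesis using True by (simp add: \<beta>_def)
    next
      case False
      then have "\<beta> i = \<alpha> i" unfolding \<beta>_def by (rule if_not_P)
      then show ?thesis using \<open>d > 0\<close> by simp
    qed
    then show "cmod (\<alpha> i - \<beta> i) \<le> d" "\<bar>rho (\<alpha> i) - rho (\<beta> i)\<bar> \<le> d" by blast+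
  qed
  then have "norm (Cmv \<alpha> x - z *\<^sub>C x) < e" using x \<open>0 < e\<close> by (simp add: d_def)
  moreover have "x \<in> tail N" using x(1) j(3) by (simp add: tail_def)
  ultimately show "\<exists>x\<in>tail N. norm x = 1 \<and> norm (Cmv \<alpha> x - z *\<^sub>C x) < e"
    using x(2) by (intro bexI[of _ x] conjI)
qed

section \<open>Localizing approximate eigenvectors in blocks\<close>

text \<open>Strong induction over the cut points in K: among the l sites before c there is another
  cut, and \<open>block\<close> controls the sum between the two. It starts where f is still zero;
  the margin l in \<open>N + l\<close> ensures that the earlier cut is at least N.\<close>

lemma sum_le_via_blocks:
  fixes f g :: "nat \<Rightarrow> real"
  assumes K: "\<And>n. N \<le> n \<Longrightarrow> \<exists>m\<in>{n..<n + l}. m \<in> K"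
    and f0: "\<And>i. i < N + l \<Longrightarrow> f i = 0" and g: "\<And>i. 0 \<le> g i"
    and block: "\<And>p q. p \<in> K \<Longrightarrow> q \<in> K \<Longrightarrow> N \<le> p \<Longrightarrow> p < q \<Longrightarrow> q \<le> p + l
      \<Longrightarrow> sum f {p<..q} \<le> sum g {p<..q}"
    and "c \<in> K"
  shows "sum f {..c} \<le> sum g {..c}"
  using \<open>c \<in> K\<close>
proof (induction c rule: less_induct)
  case (less c)
  show ?case
  proof (cases "c < N + l")
    case True
    then have "sum f {..c} = 0" by (intro sum.neutral ballI f0) simp
    then show ?thesis using g by (simp add: sum_nonneg)
  next
    case False
    have "N \<le> c - l" using False by linarith
    from K[OF this] obtain p where p: "p \<in> {c - l..<c - l + l}" "p \<in> K" by blast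
    then have pc: "p < c" "c \<le> p + l" "N \<le> p" using False by auto
    have "{..c} = {..p} \<union> {p<..c}" "{..p} \<inter> {p<..c} = {}" using pc by auto
    then have split: "sum h {..c} = sum h {..p} + sum h {p<..c}" for h :: "nat \<Rightarrow> real"
      by (simp add: sum.union_disjoint)
    have "sum f {..p} \<le> sum g {..p}" by (rule less.IH[OF pc(1) p(2)])
    moreover have "sum f {p<..c} \<le> sum g {p<..c}" by (rule block[OF p(2) less.prems pc(3,1,2)])
    ultimately show ?thesis unfolding split by (rule add_mono)
  qed
qed

text \<open>If every block satisfied the opposite inequality, adding them up would give
  \<open>\<delta> * norm x \<le> norm y\<close>. No constant is lost.\<close>

lemma small_block:
  assumes K: "\<And>n. N \<le> n \<Longrightarrow> \<exists>m\<in>{n..<n + l}. m \<in> K"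
    and x: "x \<in> tail (N + l)" "0 \<le> \<delta>" "norm y < \<delta> * norm x"
  obtains p q where "p \<in> K" "q \<in> K" "N \<le> p" "p < q" "q \<le> p + l"
    "(\<Sum>i\<in>{p<..q}. (cmod (coord y i))\<^sup>2) < \<delta>\<^sup>2 * (\<Sum>i\<in>{p<..q}. (cmod (coord x i))\<^sup>2)"
proof (rule ccontr)
  note that_block = that
  assume neg: "\<not> thesis"
  let ?f = "\<lambda>i. \<delta>\<^sup>2 * (cmod (coord x i))\<^sup>2" and ?g = "\<lambda>i. (cmod (coord y i))\<^sup>2"
  have block: "sum ?f {p<..q} \<le> sum ?g {p<..q}"
    if "p \<in> K" "q \<in> K" "N \<le> p" "p < q" "q \<le> p + l" for p q
  proof (rule ccontr)
    assume "\<not> sum ?f {p<..q} \<le> sum ?g {p<..q}"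
    then have "sum ?g {p<..q} < \<delta>\<^sup>2 * (\<Sum>i\<in>{p<..q}. (cmod (coord x i))\<^sup>2)"
      unfolding sum_distrib_left[symmetric] by simp
    with that_block[OF that] neg show False by blast
  qed
  have f0: "?f i = 0" if "i < N + l" for i using x(1) that by (simp add: tail_def)
  have "sum ?f {..<M} \<le> (norm y)\<^sup>2" for M
  proof -
    obtain c where c: "c \<in> {max N M..<max N M + l}" "c \<in> K" using K[of "max N M"] by auto
    have "sum ?f {..<M} \<le> sum ?f {..c}" using c(1) by (intro sum_mono2) auto
    also have "\<dots> \<le> sum ?g {..c}" by (rule sum_le_via_blocks[OF K f0 _ block c(2)]) simp_all
    also have "\<dots> \<le> (norm y)\<^sup>2" by (intro sum_coord_le) simp
    finally show ?thesis .
  qed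
  then have "(\<Sum>n<M. (cmod (coord (\<delta> *\<^sub>R x) n))\<^sup>2) \<le> (norm y)\<^sup>2" for M
    by (simp add: power_mult_distrib)
  then have "norm (\<delta> *\<^sub>R x) \<le> norm y" by (rule norm_l2_leI) simp
  then show False using x(2,3) by simp
qed

text \<open>The window \<open>p, \<dots>, p + k\<close> is translated to \<open>\<pi>, \<dots>, \<pi> + k\<close> with \<open>\<pi> = p mod 2\<close>: the layers are invariant
  only under even translations.\<close>

definition local_data ::
    "(nat \<Rightarrow> complex) \<Rightarrow> complex \<Rightarrow> nat \<Rightarrow> nat \<Rightarrow> real \<Rightarrow> nat \<Rightarrow> (nat \<Rightarrow> complex) \<Rightarrow> (nat \<Rightarrow> complex) \<Rightarrow> bool" where
  "local_data \<alpha> z \<pi> k e p \<gamma> y \<longleftrightarrow>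
     (\<forall>i. cmod (\<gamma> i) \<le> 1) \<and> (\<forall>i>\<pi> + k. \<gamma> i = 0)
     \<and> (\<forall>m\<le>k. cmod (\<gamma> (\<pi> + m) - \<alpha> (p + m)) \<le> e)
     \<and> cmod (\<gamma> \<pi>) = 1 \<and> cmod (\<gamma> (\<pi> + k)) = 1
     \<and> (\<forall>i. i \<notin> {\<pi><..\<pi> + k} \<longrightarrow> y i = 0) \<and> (\<Sum>i\<in>{\<pi><..\<pi> + k}. (cmod (y i))\<^sup>2) = 1
     \<and> (\<forall>i\<in>{\<pi><..\<pi> + k}. cmod (layer \<gamma> 0 (layer \<gamma> 1 y) i - z * y i) \<le> 5 * e)"

lemma local_dataD:
  assumes "local_data \<alpha> z \<pi> k e p \<gamma> y"
  shows "cmod (\<gamma> i) \<le> 1" "\<pi> + k < i \<Longrightarrow> \<gamma> i = 0"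
    "m \<le> k \<Longrightarrow> cmod (\<gamma> (\<pi> + m) - \<alpha> (p + m)) \<le> e"
    "cmod (\<gamma> \<pi>) = 1" "cmod (\<gamma> (\<pi> + k)) = 1"
    "i \<notin> {\<pi><..\<pi> + k} \<Longrightarrow> y i = 0" "(\<Sum>i\<in>{\<pi><..\<pi> + k}. (cmod (y i))\<^sup>2) = 1"
    "i \<in> {\<pi><..\<pi> + k} \<Longrightarrow> cmod (layer \<gamma> 0 (layer \<gamma> 1 y) i - z * y i) \<le> 5 * e"
  using assms by (simp_all add: local_data_def)

lemma local_data_mono:
  assumes D: "local_data \<alpha> z \<pi> k e p \<gamma> y" and "e \<le> e'"
  shows "local_data \<alpha> z \<pi> k e' p \<gamma> y"
proof -
  have "cmod (\<gamma> (\<pi> + m) - \<alpha> (p + m)) \<le> e'" if "m \<le> k" for m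
  proof -
    have "cmod (\<gamma> (\<pi> + m) - \<alpha> (p + m)) \<le> e" using D that unfolding local_data_def by blast
    then show ?thesis using \<open>e \<le> e'\<close> by linarith
  qed
  moreover have "cmod (layer \<gamma> 0 (layer \<gamma> 1 y) i - z * y i) \<le> 5 * e'" if "i \<in> {\<pi><..\<pi> + k}" for i
  proof -
    have "cmod (layer \<gamma> 0 (layer \<gamma> 1 y) i - z * y i) \<le> 5 * e"
      using D that unfolding local_data_def by blast
    then show ?thesis using \<open>e \<le> e'\<close> by linarith
  qed
  ultimately show ?thesis using D unfolding local_data_def by simp
qed

text \<open>The radial projection moves a by 1 - |a|, and 1 - |a| \<le> 1 - |a|^2 = rho^2 \<le> rho.
  The bound \<open>e \<le> 1\<close> excludes a = 0, where \<open>rho\<close> is 1.\<close>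

lemma sgn_close:
  assumes "cmod a < 1" "rho a < e" "e \<le> 1"
  shows "cmod (sgn a) = 1" "cmod (sgn a - a) \<le> e"
proof -
  have "a \<noteq> 0" using assms(2,3) by (auto simp: rho_def)
  then show "cmod (sgn a) = 1" by (simp add: norm_sgn)
  have "sgn a - a = complex_of_real (1 - cmod a) * sgn a"
    using \<open>a \<noteq> 0\<close> by (simp add: sgn_div_norm scaleR_conv_of_real algebra_simps)
  then have "cmod (sgn a - a) = \<bar>1 - cmod a\<bar> * cmod (sgn a)"
    by (simp only: norm_mult norm_of_real)
  also have "\<dots> = 1 - cmod a" using assms(1) \<open>cmod (sgn a) = 1\<close> by simp
  also have "\<dots> \<le> (rho a)\<^sup>2"
    using assms(1) power_decreasing[of 1 2 "cmod a"] by (simp add: rho_sq)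
  also have "\<dots> \<le> rho a"
    using rho_nonneg[of a] rho_le_1[of a] assms(1) by (simp add: power2_eq_square mult_left_le)
  finally show "cmod (sgn a - a) \<le> e" using assms(2) by simp
qed

lemma layer_local2:
  assumes "cmod (\<beta> p) = 1" "cmod (\<beta> q) = 1" "p < i" "i \<le> q" "even s" "s \<le> p"
    and \<beta>': "\<And>m. p \<le> m \<Longrightarrow> m \<le> q \<Longrightarrow> \<beta>' (m - s) = \<beta> m"
    and x': "\<And>m. p < m \<Longrightarrow> m \<le> q \<Longrightarrow> x' (m - s) = x m"
  shows "layer \<beta> 0 (layer \<beta> 1 x) i = layer \<beta>' 0 (layer \<beta>' 1 x') (i - s)"
proof (rule layer_local[OF assms(1-6) \<beta>'])
  fix m assume "p < m" "m \<le> q"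
  show "layer \<beta>' 1 x' (m - s) = layer \<beta> 1 x m"
    by (rule layer_local[where \<beta> = \<beta> and \<beta>' = \<beta>' and x = x and x' = x' and i = m and s = s,
          OF assms(1,2) \<open>p < m\<close> \<open>m \<le> q\<close> assms(5,6) \<beta>' x', symmetric])
qed

lemma weyl_local_data:
  assumes lt1: "\<And>i. cmod (\<alpha> i) < 1"
    and lim: "(\<lambda>n. \<Prod>i<l. rho (\<alpha> (n + i))) \<longlonglongrightarrow> 0"
    and W: "weyl \<alpha> z" and e: "0 < e" "e \<le> 1"
  shows "\<exists>p\<ge>j. \<exists>k\<in>{1..l}. \<exists>\<gamma> y. local_data \<alpha> z (p mod 2) k e p \<gamma> y"
proof -
  define K where "K = {m. rho (\<alpha> m) < e}"
  have le1: "cmod (\<alpha> i) \<le> 1" for i using lt1[of i] by simp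
  \<comment> \<open>The threshold is \<open>e ^ l\<close>: if l consecutive \<open>rho\<close> were
    all at least e, their product could not be smaller. So K meets every l consecutive sites far
    out.\<close>
  obtain N0 where N0: "\<And>n. n \<ge> N0 \<Longrightarrow> norm ((\<Prod>i<l. rho (\<alpha> (n + i))) - 0) < e ^ l"
    using LIMSEQ_D[OF lim, of "e ^ l"] e by auto
  define N where "N = max N0 j"
  have K: "\<exists>m\<in>{n..<n + l}. m \<in> K" if "N \<le> n" for n
  proof (rule ccontr)
    assume neg: "\<not> (\<exists>m\<in>{n..<n + l}. m \<in> K)"
    have "(\<Prod>i<l. e) \<le> (\<Prod>i<l. rho (\<alpha> (n + i)))"
    proof (intro prod_mono conjI)
      fix i assume "i \<in> {..<l}"
      then have "n + i \<in> {n..<n + l}" by simp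
      then have "n + i \<notin> K" using neg by blast
      then show "e \<le> rho (\<alpha> (n + i))" by (simp add: K_def)
    qed (use e in simp)
    moreover have "(\<Prod>i<l. rho (\<alpha> (n + i))) < e ^ l" using N0[of n] that by (simp add: N_def)
    ultimately show False by simp
  qed
  obtain x where x: "x \<in> tail (N + l)" "norm x = 1" "norm (Cmv \<alpha> x - z *\<^sub>C x) < e"
    using W e(1) unfolding weyl_def by blast
  \<comment> \<open>Coefficients with small \<open>rho\<close> are moved radially onto the unit
    circle, which decouples the operator exactly at the sites of K.\<close>
  define \<beta> where "\<beta> i = (if i \<in> K then sgn (\<alpha> i) else \<alpha> i)" for i
  have K1: "cmod (\<beta> i) = 1" if "i \<in> K" for i
    using that sgn_close(1)[OF lt1] e(2) by (simp add: K_def \<beta>_def)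
  have \<beta>\<alpha>: "cmod (\<beta> i - \<alpha> i) \<le> e" for i
    using sgn_close(2)[OF lt1, of i e] e by (auto simp: K_def \<beta>_def)
  have \<beta>le1: "cmod (\<beta> i) \<le> 1" for i using K1[of i] le1[of i] by (cases "i \<in> K") (simp_all add: \<beta>_def)
  have "norm (Cmv \<beta> x - Cmv \<alpha> x) \<le> 4 * e * norm x"
  proof (rule Cmv_perturb[OF \<beta>le1 le1 \<beta>\<alpha>])
    fix i
    show "\<bar>rho (\<beta> i) - rho (\<alpha> i)\<bar> \<le> e"
    proof (cases "i \<in> K")
      case True
      then have "rho (\<beta> i) = 0" using K1 by (simp add: rho_eq_0_iff)
      then show ?thesis using True rho_nonneg[OF le1[of i]] by (simp add: K_def)
    next
      case False
      then show ?thesis using e by (simp add: \<beta>_def)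
    qed
  qed
  moreover have "norm (Cmv \<beta> x - z *\<^sub>C x) \<le> norm (Cmv \<beta> x - Cmv \<alpha> x) + norm (Cmv \<alpha> x - z *\<^sub>C x)"
    using norm_triangle_ineq[of "Cmv \<beta> x - Cmv \<alpha> x" "Cmv \<alpha> x - z *\<^sub>C x"] by simp
  \<comment> \<open>The 5 is 4 from the change of coefficients plus 1 from the choice of x.\<close>
  ultimately have small: "norm (Cmv \<beta> x - z *\<^sub>C x) < 5 * e * norm x" using x by simp
  have "0 \<le> 5 * e" using e by simp
  from K x(1) this small obtain p q where pq: "p \<in> K" "q \<in> K" "N \<le> p" "p < q" "q \<le> p + l"
    "(\<Sum>i\<in>{p<..q}. (cmod (coord (Cmv \<beta> x - z *\<^sub>C x) i))\<^sup>2) < (5 * e)\<^sup>2 * (\<Sum>i\<in>{p<..q}. (cmod (coord x i))\<^sup>2)"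
    by (rule small_block)
  define k where "k = q - p"
  define \<pi> where "\<pi> = p mod 2"
  define s where "s = p - \<pi>"
  define c where "c = sqrt (\<Sum>i\<in>{p<..q}. (cmod (coord x i))\<^sup>2)"
  have s: "even s" "s \<le> p" "p = \<pi> + s" "q = \<pi> + k + s"
    unfolding s_def \<pi>_def k_def using pq(4) by (auto simp: minus_mod_eq_mult_div)
  have k: "k \<in> {1..l}" using pq(4,5) by (auto simp: k_def)
  have c2: "c\<^sup>2 = (\<Sum>i\<in>{p<..q}. (cmod (coord x i))\<^sup>2)"
    unfolding c_def by (intro real_sqrt_pow2 sum_nonneg) simp
  have "0 \<le> (\<Sum>i\<in>{p<..q}. (cmod (coord (Cmv \<beta> x - z *\<^sub>C x) i))\<^sup>2)" by (intro sum_nonneg) simp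
  \<comment> \<open>The strict inequality forces x to be nonzero on the block, so its restriction
    can be normalized.\<close>
  with pq(6) have "0 < (5 * e)\<^sup>2 * c\<^sup>2" unfolding c2 by (rule le_less_trans[rotated])
  moreover have "0 \<le> c" unfolding c_def by (intro real_sqrt_ge_zero sum_nonneg) simp
  ultimately have c: "0 < c" by (cases "c = 0") auto
  define \<gamma> where "\<gamma> i = (if i \<le> \<pi> + k then \<beta> (i + s) else 0)" for i
  define u where "u i = (if i \<in> {\<pi><..\<pi> + k} then coord x (i + s) else 0)" for i
  define y where "y i = complex_of_real (1 / c) * u i" for i
  have shift: "(\<Sum>i\<in>{\<pi><..\<pi> + k}. h (i + s)) = (\<Sum>i\<in>{p<..q}. h i)" for h :: "nat \<Rightarrow> real"
    by (rule sum.reindex_bij_witness[of _ "\<lambda>i. i - s" "\<lambda>i. i + s"]) (use s in auto)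
  have res: "cmod (layer \<gamma> 0 (layer \<gamma> 1 y) i - z * y i) \<le> 5 * e" if i: "i \<in> {\<pi><..\<pi> + k}" for i
  proof -
    have iq: "p < i + s" "i + s \<le> q" using i s by auto
    have "layer \<beta> 0 (layer \<beta> 1 (coord x)) (i + s) = layer \<gamma> 0 (layer \<gamma> 1 u) (i + s - s)"
    proof (rule layer_local2[OF K1[OF pq(1)] K1[OF pq(2)] iq s(1,2)])
      show "\<gamma> (m - s) = \<beta> m" if "p \<le> m" "m \<le> q" for m
        using that s by (auto simp: \<gamma>_def)
      show "u (m - s) = coord x m" if "p < m" "m \<le> q" for m
        using that s by (auto simp: u_def)
    qed
    then have L: "layer \<gamma> 0 (layer \<gamma> 1 u) i - z * u i = coord (Cmv \<beta> x - z *\<^sub>C x) (i + s)"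
      using i by (simp add: coord_Cmv[OF \<beta>le1] u_def)
    have "(cmod (coord (Cmv \<beta> x - z *\<^sub>C x) (i + s)))\<^sup>2 \<le> (\<Sum>i\<in>{p<..q}. (cmod (coord (Cmv \<beta> x - z *\<^sub>C x) i))\<^sup>2)"
      using iq by (intro member_le_sum) auto
    also have "\<dots> \<le> (5 * e * c)\<^sup>2" using pq(6) unfolding c2[symmetric] by (simp add: power_mult_distrib)
    finally have cle: "cmod (coord (Cmv \<beta> x - z *\<^sub>C x) (i + s)) \<le> 5 * e * c"
      by (rule power2_le_imp_le) (use e c in simp)
    have "layer \<gamma> 0 (layer \<gamma> 1 y) i - z * y i
        = complex_of_real (1 / c) * (layer \<gamma> 0 (layer \<gamma> 1 u) i - z * u i)"
      unfolding y_def layer_scale by (simp add: algebra_simps)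
    then have "cmod (layer \<gamma> 0 (layer \<gamma> 1 y) i - z * y i)
        = \<bar>1 / c\<bar> * cmod (coord (Cmv \<beta> x - z *\<^sub>C x) (i + s))"
      by (simp only: L norm_mult norm_of_real)
    also have "\<dots> \<le> \<bar>1 / c\<bar> * (5 * e * c)" using cle by (rule mult_left_mono) simp
    also have "\<dots> = 5 * e" using c by simp
    finally show ?thesis .
  qed
  have "(\<Sum>i\<in>{\<pi><..\<pi> + k}. (cmod (y i))\<^sup>2) = (\<Sum>i\<in>{\<pi><..\<pi> + k}. (cmod (coord x (i + s)))\<^sup>2) / c\<^sup>2"
    unfolding sum_divide_distrib
    by (intro sum.cong) (simp_all add: y_def u_def norm_divide power_divide)
  then have nrm: "(\<Sum>i\<in>{\<pi><..\<pi> + k}. (cmod (y i))\<^sup>2) = 1"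
    unfolding shift[of "\<lambda>i. (cmod (coord x i))\<^sup>2"] c2[symmetric] using c by simp
  have "local_data \<alpha> z \<pi> k e p \<gamma> y"
    unfolding local_data_def
  proof (intro conjI allI impI ballI)
    show "cmod (\<gamma> i) \<le> 1" for i using \<beta>le1 by (simp add: \<gamma>_def)
    show "\<gamma> i = 0" if "\<pi> + k < i" for i using that by (simp add: \<gamma>_def)
    show "cmod (\<gamma> (\<pi> + m) - \<alpha> (p + m)) \<le> e" if "m \<le> k" for m
      using \<beta>\<alpha>[of "p + m"] that s(3) by (simp add: \<gamma>_def add.commute add.left_commute)
    show "cmod (\<gamma> \<pi>) = 1" using K1[OF pq(1)] s(3) by (simp add: \<gamma>_def)
    show "cmod (\<gamma> (\<pi> + k)) = 1" using K1[OF pq(2)] s(4) by (simp add: \<gamma>_def)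
    show "y i = 0" if "i \<notin> {\<pi><..\<pi> + k}" for i using that by (simp only: y_def u_def if_False mult_zero_right)
  qed (rule nrm res, assumption?)+
  moreover have "j \<le> p" using pq(3) by (simp add: N_def)
  ultimately show ?thesis using k unfolding \<pi>_def by blast
qed

text \<open>Pigeonhole: if each k failed at some index, all would fail at the largest of these. It
  serves to fix one block length and one parity for all accuracies at once.\<close>

lemma finite_antimono_choice:
  fixes P :: "nat \<Rightarrow> 'a \<Rightarrow> bool"
  assumes "finite K" "\<And>j. \<exists>k\<in>K. P j k" "\<And>j j' k. P j' k \<Longrightarrow> j \<le> j' \<Longrightarrow> P j k"
  shows "\<exists>k\<in>K. \<forall>j. P j k"
proof (rule ccontr)
  assume "\<not> ?thesis"
  then have "\<forall>k\<in>K. \<exists>j. \<not> P j k" by blast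
  then obtain f where f: "\<And>k. k \<in> K \<Longrightarrow> \<not> P (f k) k" by metis
  obtain k where k: "k \<in> K" "P (Max (f ` K)) k" using assms(2) by blast
  then have "P (f k) k" using assms(1) by (intro assms(3)[OF k(2)]) simp
  then show False using f k(1) by blast
qed

text \<open>The windows from \<open>weyl_local_data\<close> have at most l lengths and two parities,
  so one such pair serves for all accuracies 1/(j+1) while the windows move to infinity. A
  convergent subsequence yields an eigenvector u of a limit window.\<close>

lemma weyl_eigenvalue:
  assumes lt1: "\<And>i. cmod (\<alpha> i) < 1"
    and lim: "(\<lambda>n. \<Prod>i<l. rho (\<alpha> (n + i))) \<longlonglongrightarrow> 0"
    and W: "weyl \<alpha> z"
  shows "\<exists>k\<in>{1..l}. \<exists>n a. limit_data \<alpha> k n a \<and> eigenvalue (C_tilde k a) z"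
proof -
  define P where "P j t \<longleftrightarrow> (\<exists>p\<ge>j. p mod 2 = snd t \<and>
      (\<exists>\<gamma> y. local_data \<alpha> z (snd t) (fst t) (inverse (real (Suc j))) p \<gamma> y))" for j and t :: "nat \<times> nat"
  have "\<exists>t\<in>{1..l} \<times> {0, 1}. \<forall>j. P j t"
  proof (rule finite_antimono_choice)
    fix j
    have "0 < inverse (real (Suc j))" "inverse (real (Suc j)) \<le> 1" by (simp_all add: inverse_le_1_iff)
    from weyl_local_data[OF lt1 lim W this, of j] obtain p k \<gamma> y where
      *: "j \<le> p" "k \<in> {1..l}" "local_data \<alpha> z (p mod 2) k (inverse (real (Suc j))) p \<gamma> y"
      by (elim exE bexE conjE)
    have "P j (k, p mod 2)" unfolding P_def fst_conv snd_conv
      by (intro exI[of _ p] conjI exI[of _ \<gamma>] exI[of _ y] refl *)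
    moreover have "(k, p mod 2) \<in> {1..l} \<times> {0, 1}" using *(2) by auto
    ultimately show "\<exists>t\<in>{1..l} \<times> {0, 1}. P j t" by (rule bexI)
  next
    fix j j' t assume "P j' t" "j \<le> j'"
    then obtain p \<gamma> y where *: "j' \<le> p" "p mod 2 = snd t"
      "local_data \<alpha> z (snd t) (fst t) (inverse (real (Suc j'))) p \<gamma> y" unfolding P_def by (elim exE conjE)
    have "inverse (real (Suc j')) \<le> inverse (real (Suc j))"
      using \<open>j \<le> j'\<close> by (intro le_imp_inverse_le) simp_all
    from local_data_mono[OF *(3) this] have "local_data \<alpha> z (snd t) (fst t) (inverse (real (Suc j))) p \<gamma> y" .
    moreover have "j \<le> p" using *(1) \<open>j \<le> j'\<close> by simp
    ultimately show "P j t" unfolding P_def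
      by (intro exI[of _ p] conjI exI[of _ \<gamma>] exI[of _ y] *(2))
  qed simp
  then obtain t where t: "t \<in> {1..l} \<times> {0, 1}" "\<And>j. P j t" by (elim bexE) (rule that, assumption, erule spec)
  define k where "k = fst t"
  define \<pi> where "\<pi> = snd t"
  have k: "k \<in> {1..l}" using t(1) by (auto simp: k_def)
  have "\<exists>w. j \<le> fst w \<and> local_data \<alpha> z \<pi> k (inverse (real (Suc j))) (fst w) (fst (snd w)) (snd (snd w))" for j
  proof -
    from t(2)[of j] obtain p \<gamma> y where "j \<le> p" "local_data \<alpha> z \<pi> k (inverse (real (Suc j))) p \<gamma> y"
      unfolding P_def k_def \<pi>_def by (elim exE conjE)
    then show ?thesis by (intro exI[of _ "(p, \<gamma>, y)"]) simp
  qed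
  then have "\<exists>w. \<forall>j. j \<le> fst (w j)
      \<and> local_data \<alpha> z \<pi> k (inverse (real (Suc j))) (fst (w j)) (fst (snd (w j))) (snd (snd (w j)))"
    by (intro choice allI)
  then obtain w where w: "\<And>j. j \<le> fst (w j)"
    "\<And>j. local_data \<alpha> z \<pi> k (inverse (real (Suc j))) (fst (w j)) (fst (snd (w j))) (snd (snd (w j)))" by auto
  define p where "p j = fst (w j)" for j
  define \<gamma> where "\<gamma> j = fst (snd (w j))" for j
  define y where "y j = snd (snd (w j))" for j
  have p: "j \<le> p j" and D: "local_data \<alpha> z \<pi> k (inverse (real (Suc j))) (p j) (\<gamma> j) (y j)" for j
    using w[of j] by (simp_all only: p_def \<gamma>_def y_def)
  have \<gamma>le1: "cmod (\<gamma> j i) \<le> 1" and \<gamma>0: "\<pi> + k < i \<Longrightarrow> \<gamma> j i = 0"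
    and \<gamma>\<alpha>: "m \<le> k \<Longrightarrow> cmod (\<gamma> j (\<pi> + m) - \<alpha> (p j + m)) \<le> inverse (real (Suc j))"
    and \<gamma>1: "cmod (\<gamma> j \<pi>) = 1" "cmod (\<gamma> j (\<pi> + k)) = 1"
    and y0: "i \<notin> {\<pi><..\<pi> + k} \<Longrightarrow> y j i = 0" and y1: "(\<Sum>i\<in>{\<pi><..\<pi> + k}. (cmod (y j i))\<^sup>2) = 1"
    and yr: "i \<in> {\<pi><..\<pi> + k} \<Longrightarrow> cmod (layer (\<gamma> j) 0 (layer (\<gamma> j) 1 (y j)) i - z * y j i) \<le> 5 * inverse (real (Suc j))"
    for i j m
    by (rule local_dataD[OF D[of j]]; assumption)+
  have inv0: "(\<lambda>j. inverse (real (Suc j))) \<longlonglongrightarrow> 0" by (rule LIMSEQ_inverse_real_of_nat)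
  have res: "(\<lambda>j. layer (\<gamma> j) 0 (layer (\<gamma> j) 1 (y j)) i - z * y j i) \<longlonglongrightarrow> 0" if "i \<in> {\<pi><..\<pi> + k}" for i
  proof (rule tendsto_0_le[OF inv0, where K = 5])
    show "\<forall>\<^sub>F j in sequentially. norm (layer (\<gamma> j) 0 (layer (\<gamma> j) 1 (y j)) i - z * y j i)
        \<le> norm (inverse (real (Suc j))) * 5"
      using yr[OF that] by (intro always_eventually allI) (simp add: mult.commute)
  qed
  obtain r :: "nat \<Rightarrow> nat" and \<beta> u where r: "strict_mono r"
    and \<beta>: "\<And>i. (\<lambda>j. \<gamma> (r j) i) \<longlonglongrightarrow> \<beta> i"
    and u0: "\<And>i. i \<notin> {\<pi><..\<pi> + k} \<Longrightarrow> u i = 0" and u: "u \<noteq> (\<lambda>i. 0)"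
    and eq: "\<And>i. i \<in> {\<pi><..\<pi> + k} \<Longrightarrow> layer \<beta> 0 (layer \<beta> 1 u) i = z * u i"
    by (rule limit_eigenvector[of \<gamma> "\<pi> + k" \<pi> y z, OF \<gamma>le1 \<gamma>0 y0 y1 res]) (assumption | rule that)+
  have \<beta>le1: "cmod (\<beta> i) \<le> 1" for i
    using tendsto_norm[OF \<beta>[of i]] by (rule LIMSEQ_le_const2) (use \<gamma>le1 in auto)
  have \<beta>1: "cmod (\<beta> \<pi>) = 1" "cmod (\<beta> (\<pi> + k)) = 1"
    using tendsto_norm[OF \<beta>[of \<pi>]] tendsto_norm[OF \<beta>[of "\<pi> + k"]] by (simp_all add: \<gamma>1 LIMSEQ_const_iff)
  have \<alpha>lim: "(\<lambda>j. \<alpha> (p (r j) + m)) \<longlonglongrightarrow> \<beta> (\<pi> + m)" if "m \<le> k" for m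
  proof -
    have "(\<lambda>j. \<gamma> j (\<pi> + m) - \<alpha> (p j + m)) \<longlonglongrightarrow> 0"
      using \<gamma>\<alpha>[OF that] by (intro tendsto_0_le[OF inv0, where K = 1] always_eventually allI) simp
    from LIMSEQ_subseq_LIMSEQ[OF this r] have "(\<lambda>j. \<gamma> (r j) (\<pi> + m) - \<alpha> (p (r j) + m)) \<longlonglongrightarrow> 0"
      by (simp add: o_def)
    from tendsto_diff[OF \<beta>[of "\<pi> + m"] this] show ?thesis by simp
  qed
  obtain m0 where m0: "u m0 \<noteq> 0" using u by auto
  then have m0_in: "\<pi> < m0" "m0 \<le> \<pi> + k" using u0[of m0] by (cases "m0 \<in> {\<pi><..\<pi> + k}"; auto)+
  \<comment> \<open>p0 and q0 are the closest unimodular coefficients around a site m0 at which u is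
    nonzero. The coefficient at m0 itself counts on the right, because the window cut out by p0 and
    q0 is \<open>{p0<..q0}\<close>.\<close>
  define p0 where "p0 = Max {i. \<pi> \<le> i \<and> i < m0 \<and> cmod (\<beta> i) = 1}"
  define q0 where "q0 = Min {i. m0 \<le> i \<and> i \<le> \<pi> + k \<and> cmod (\<beta> i) = 1}"
  have fin: "finite {i. \<pi> \<le> i \<and> i < m0 \<and> cmod (\<beta> i) = 1}" "finite {i. m0 \<le> i \<and> i \<le> \<pi> + k \<and> cmod (\<beta> i) = 1}"
    by (rule finite_subset[of _ "{..\<pi> + k}"], use m0_in in auto)+
  have p0: "\<pi> \<le> p0" "p0 < m0" "cmod (\<beta> p0) = 1"
  proof -
    have "\<pi> \<in> {i. \<pi> \<le> i \<and> i < m0 \<and> cmod (\<beta> i) = 1}" using m0_in \<beta>1 by simp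
    then have "p0 \<in> {i. \<pi> \<le> i \<and> i < m0 \<and> cmod (\<beta> i) = 1}"
      unfolding p0_def by (intro Max_in fin) auto
    then show "\<pi> \<le> p0" "p0 < m0" "cmod (\<beta> p0) = 1" by simp_all
  qed
  have q0: "m0 \<le> q0" "q0 \<le> \<pi> + k" "cmod (\<beta> q0) = 1"
  proof -
    have "\<pi> + k \<in> {i. m0 \<le> i \<and> i \<le> \<pi> + k \<and> cmod (\<beta> i) = 1}" using m0_in \<beta>1 by simp
    then have "q0 \<in> {i. m0 \<le> i \<and> i \<le> \<pi> + k \<and> cmod (\<beta> i) = 1}"
      unfolding q0_def by (intro Min_in fin) auto
    then show "m0 \<le> q0" "q0 \<le> \<pi> + k" "cmod (\<beta> q0) = 1" by simp_all
  qed
  have between: "cmod (\<beta> i) \<noteq> 1" if "p0 < i" "i < q0" for i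
  proof
    assume i: "cmod (\<beta> i) = 1"
    show False
    proof (cases "i < m0")
      case True
      then have "i \<le> p0" unfolding p0_def using fin(1) i that p0(1) by (intro Max_ge) auto
      then show False using that by simp
    next
      case False
      then have "q0 \<le> i" unfolding q0_def using fin(2) i that q0(2) by (intro Min_le) auto
      then show False using that by simp
    qed
  qed
  define k' where "k' = q0 - p0"
  have k': "1 \<le> k'" "p0 + k' = q0" "k' \<le> k" using p0 q0 m0_in by (simp_all add: k'_def)
  have c1: "cmod (\<beta> p0) = 1" "cmod (\<beta> (p0 + k')) = 1" using p0 q0 k' by simp_all
  \<comment> \<open>Cutting u down to the smaller window keeps the eigenvalue equation, since
    \<open>rho\<close> vanishes at both ends.\<close>
  define v where "v i = (if i \<in> {p0<..p0 + k'} then u i else 0)" for i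
  have v0: "v i = 0" if "i \<notin> {p0<..p0 + k'}" for i using that unfolding v_def by (rule if_not_P)
  have "layer \<beta> 0 (layer \<beta> 1 v) = (\<lambda>s. z * v s)"
  proof
    fix i
    show "layer \<beta> 0 (layer \<beta> 1 v) i = z * v i"
    proof (cases "i \<in> {p0<..p0 + k'}")
      case True
      then have i: "p0 < i" "i \<le> p0 + k'" "i \<in> {\<pi><..\<pi> + k}" using p0 q0 k' by auto
      have "layer \<beta> 0 (layer \<beta> 1 u) i = layer \<beta> 0 (layer \<beta> 1 v) (i - 0)"
        by (rule layer_local2[OF c1 i(1,2)]) (simp_all add: v_def)
      then show ?thesis using eq[OF i(3)] True by (simp add: v_def)
    next
      case False
      have "layer \<beta> 0 (layer \<beta> 1 v) i = 0"
        by (rule layer_block_support[OF c1 layer_block_support[OF c1 v0] False])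
      then show ?thesis using v0[OF False] by simp
    qed
  qed
  moreover have "v \<noteq> (\<lambda>i. 0)"
  proof
    assume "v = (\<lambda>i. 0)"
    then have "v m0 = 0" by simp
    then show False using m0 p0 q0 k' by (simp add: v_def)
  qed
  ultimately have "eigenvalue (C_tilde k' (\<lambda>m. \<beta> (p0 + m))) z"
    unfolding eigenvalue_C_tilde_iff[OF \<beta>le1 c1 k'(1)]
    using v0 by (intro exI[of _ v] conjI allI impI)
  \<comment> \<open>Index \<pi> stands for the site p (r j), so index p0 stands for
    \<open>p (r j) + (p0 - \<pi>)\<close>.\<close>
  moreover have "limit_data \<alpha> k' (\<lambda>j. p (r j) + (p0 - \<pi>)) (\<lambda>m. \<beta> (p0 + m))"
    unfolding limit_data_def
  proof (intro conjI allI impI ballI)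
    have "j \<le> p (r j) + (p0 - \<pi>)" for j
      using p[of "r j"] seq_suble[OF r, of j] by simp
    then show "filterlim (\<lambda>j. p (r j) + (p0 - \<pi>)) at_top sequentially"
      by (intro filterlim_at_top_mono[OF filterlim_ident] always_eventually allI)
    show a: "(\<lambda>j. \<alpha> (p (r j) + (p0 - \<pi>) + m)) \<longlonglongrightarrow> \<beta> (p0 + m)" if "m \<le> k'" for m
    proof -
      have "p0 - \<pi> + m \<le> k" using that k' q0 p0 by simp
      from \<alpha>lim[OF this] show ?thesis using p0(1) by (simp add: add.assoc)
    qed
    show "(\<lambda>j. rho (\<alpha> (p (r j) + (p0 - \<pi>)))) \<longlonglongrightarrow> 0"
      using tendsto_rho[OF a[of 0]] p0(3) by (simp add: rho_eq_0_iff[THEN iffD2])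
    show "(\<lambda>j. rho (\<alpha> (p (r j) + (p0 - \<pi>) + k'))) \<longlonglongrightarrow> 0"
      using tendsto_rho[OF a[of k']] c1(2) by (simp add: rho_eq_0_iff[THEN iffD2])
    show "cmod (\<beta> (p0 + m)) \<noteq> 1" if "m \<in> {1..<k'}" for m
      using between[of "p0 + m"] that k'(2) by auto
  qed
  moreover have "k' \<in> {1..l}" using k' k by simp
  ultimately show ?thesis
    by (intro bexI[of _ k'] exI[of _ "\<lambda>j. p (r j) + (p0 - \<pi>)"] exI[of _ "\<lambda>m. \<beta> (p0 + m)"] conjI)
qed

section \<open>The essential spectrum\<close>

text \<open>If v is outside the closed subspace S, its distance d to S is positive and controls
  coefficients: \<open>cmod a * d \<le> norm (s + a *\<^sub>C v)\<close>. Hence the c j form a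
  Cauchy sequence, and f converges as well.\<close>

lemma closed_add_line:
  fixes S :: "l2 set" and v :: l2
  assumes closed: "\<And>f y. (\<And>j::nat. f j \<in> S) \<Longrightarrow> f \<longlonglongrightarrow> y \<Longrightarrow> y \<in> S"
    and add: "\<And>x y. x \<in> S \<Longrightarrow> y \<in> S \<Longrightarrow> x + y \<in> S"
    and scale: "\<And>x c. x \<in> S \<Longrightarrow> c *\<^sub>C x \<in> S"
    and f: "\<And>j::nat. f j \<in> S" and lim: "(\<lambda>j. f j + c j *\<^sub>C v) \<longlonglongrightarrow> y"
  shows "\<exists>s\<in>S. \<exists>d. y = s + d *\<^sub>C v"
proof (cases "v \<in> S")
  case True
  have "y \<in> S" by (rule closed[OF add[OF f scale[OF True]] lim])
  then show ?thesis by (intro bexI[of _ y] exI[of _ 0]) simp_all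
next
  case False
  have "\<exists>d>0. \<forall>s\<in>S. d \<le> norm (v - s)"
  proof (rule ccontr)
    assume neg: "\<not> ?thesis"
    have "\<exists>s. s \<in> S \<and> norm (v - s) < inverse (real (Suc j))" for j
    proof (rule ccontr)
      assume "\<not> (\<exists>s. s \<in> S \<and> norm (v - s) < inverse (real (Suc j)))"
      then have "\<forall>s\<in>S. inverse (real (Suc j)) \<le> norm (v - s)" by (simp add: not_less Ball_def)
      moreover have "0 < inverse (real (Suc j))" by simp
      ultimately show False using neg by blast
    qed
    then obtain g where g: "\<And>j. g j \<in> S" "\<And>j. norm (v - g j) < inverse (real (Suc j))" by metis
    have "(\<lambda>j. v - g j) \<longlonglongrightarrow> 0"
      using g(2) by (intro tendsto_0_le[OF LIMSEQ_inverse_real_of_nat, where K = 1] always_eventually allI)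
        (simp add: less_imp_le)
    from tendsto_diff[OF tendsto_const[of v] this] have "g \<longlonglongrightarrow> v" by simp
    with g(1) have "v \<in> S" by (rule closed)
    then show False using False by simp
  qed
  then obtain d where d: "0 < d" "\<And>s. s \<in> S \<Longrightarrow> d \<le> norm (v - s)" by blast
  have bound: "cmod a * d \<le> norm (s + a *\<^sub>C v)" if "s \<in> S" for a s
  proof (cases "a = 0")
    case False
    have "d \<le> norm (v - (- inverse a) *\<^sub>C s)" by (rule d(2)[OF scale[OF that]])
    moreover have "s + a *\<^sub>C v = a *\<^sub>C (v - (- inverse a) *\<^sub>C s)" using False by simp
    ultimately show ?thesis by (simp only: norm_cscale mult_left_mono norm_ge_zero)
  qed simp
  have "Cauchy c"
  proof (rule metric_CauchyI)
    fix e :: real assume "0 < e"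
    then obtain M where M: "\<And>i j. i \<ge> M \<Longrightarrow> j \<ge> M \<Longrightarrow> dist (f i + c i *\<^sub>C v) (f j + c j *\<^sub>C v) < e * d"
      using metric_CauchyD[OF LIMSEQ_imp_Cauchy[OF lim], of "e * d"] d(1) by auto
    have "dist (c i) (c j) < e" if "i \<ge> M" "j \<ge> M" for i j
    proof -
      have "(f i + c i *\<^sub>C v) - (f j + c j *\<^sub>C v) = (f i + (-1) *\<^sub>C f j) + (c i - c j) *\<^sub>C v"
        by (simp add: cscale_diff_left)
      moreover have "f i + (-1) *\<^sub>C f j \<in> S" by (intro add scale f)
      ultimately have "cmod (c i - c j) * d \<le> norm ((f i + c i *\<^sub>C v) - (f j + c j *\<^sub>C v))"
        by (simp only: bound)
      also have "\<dots> < e * d" using M[OF that] by (simp add: dist_norm)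
      finally show ?thesis using d(1) by (simp add: dist_norm)
    qed
    then show "\<exists>M. \<forall>i\<ge>M. \<forall>j\<ge>M. dist (c i) (c j) < e" by blast
  qed
  then obtain c0 where c0: "c \<longlonglongrightarrow> c0" using Cauchy_convergent_iff convergent_def by blast
  have "(\<lambda>j. c j *\<^sub>C v) \<longlonglongrightarrow> c0 *\<^sub>C v"
  proof (rule tendsto_norm_zero_cancel[THEN LIM_zero_cancel])
    have "(\<lambda>j. norm (c j - c0) * norm v) \<longlonglongrightarrow> 0 * norm v"
      by (intro tendsto_intros tendsto_norm_zero LIM_zero c0)
    then show "(\<lambda>j. norm (c j *\<^sub>C v - c0 *\<^sub>C v)) \<longlonglongrightarrow> 0"
      by (simp add: cscale_diff_left[symmetric])
  qed
  from tendsto_diff[OF lim this] have "f \<longlonglongrightarrow> y - c0 *\<^sub>C v" by simp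
  with f have "y - c0 *\<^sub>C v \<in> S" by (rule closed)
  then show ?thesis by (intro bexI[of _ "y - c0 *\<^sub>C v"] exI[of _ c0]) simp_all
qed

text \<open>Banach's fixed point theorem for the map sending x to
  \<open>x - t *\<^sub>R (A x - y)\<close>, which coercivity makes a contraction for a suitable
  t.\<close>

lemma coercive_surj:
  fixes A :: "l2 \<Rightarrow> l2"
  assumes add: "\<And>x y. A (x - y) = A x - A y"
    and bnd: "\<And>x. norm (A x) \<le> M * norm x"
    and coer: "\<And>x. c * (norm x)\<^sup>2 \<le> inner (A x) x" and "0 < c"
  shows "\<exists>x. A x = y"
proof -
  \<comment> \<open>Enlarging the bound to at least c gives \<open>0 < M'\<close> and keeps q
    nonnegative.\<close>
  define M' where "M' = max M c"
  have M': "c \<le> M'" "0 < M'" "\<And>x. norm (A x) \<le> M' * norm x"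
  proof -
    show "c \<le> M'" "0 < M'" using \<open>0 < c\<close> by (simp_all add: M'_def)
    show "norm (A x) \<le> M' * norm x" for x
    proof -
      have "M * norm x \<le> M' * norm x" unfolding M'_def by (intro mult_right_mono) auto
      then show ?thesis using bnd[of x] by linarith
    qed
  qed
  \<comment> \<open>t minimizes \<open>1 - 2 * t * c + t\<^sup>2 * M'\<^sup>2\<close>, the bound for
    the squared contraction factor; the minimum is q.\<close>
  define t where "t = c / M'\<^sup>2"
  define q where "q = 1 - c\<^sup>2 / M'\<^sup>2"
  have t: "0 < t" using \<open>0 < c\<close> M' by (simp add: t_def)
  have q: "0 \<le> q" "q < 1"
    using \<open>0 < c\<close> M' power_mono[of c M' 2] by (simp_all add: q_def)
  have shrink: "norm (x - t *\<^sub>R A x) \<le> sqrt q * norm x" for x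
  proof -
    have "(norm (x - t *\<^sub>R A x))\<^sup>2 = (norm x)\<^sup>2 + t\<^sup>2 * (norm (A x))\<^sup>2 - 2 * (t * inner (A x) x)"
      unfolding power2_norm_eq_inner by (simp add: inner_diff inner_commute power2_eq_square)
    also have "\<dots> \<le> (norm x)\<^sup>2 + t\<^sup>2 * (M' * norm x)\<^sup>2 - 2 * (t * (c * (norm x)\<^sup>2))"
    proof (intro diff_mono add_left_mono mult_left_mono order_refl)
      show "(norm (A x))\<^sup>2 \<le> (M' * norm x)\<^sup>2" using M'(3) by (intro power_mono) auto
    qed (use t coer in auto)
    also have "\<dots> = q * (norm x)\<^sup>2"
      using M'(2) by (simp add: t_def q_def field_simps power2_eq_square)
    also have "\<dots> = (sqrt q * norm x)\<^sup>2" using q by (simp add: power_mult_distrib)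
    finally show ?thesis by (rule power2_le_imp_le) (use q in simp)
  qed
  have contr: "dist (x - t *\<^sub>R (A x - y)) (x' - t *\<^sub>R (A x' - y)) \<le> sqrt q * dist x x'" for x x'
  proof -
    have eq: "(x - t *\<^sub>R (A x - y)) - (x' - t *\<^sub>R (A x' - y)) = (x - x') - t *\<^sub>R A (x - x')"
      by (simp add: add algebra_simps)
    show ?thesis unfolding dist_norm eq by (rule shrink)
  qed
  have "\<exists>!x. x - t *\<^sub>R (A x - y) = x"
    by (rule banach_fix_type[of "sqrt q"]) (use q contr in auto)
  then obtain x where "x - t *\<^sub>R (A x - y) = x" by blast
  then have "t *\<^sub>R (A x - y) = 0" by simp
  then show ?thesis using t by (intro exI[of _ x]) simp
qed

section \<open>Kernel and range of C - z\<close>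

locale cmv_operator =
  fixes \<alpha> :: "nat \<Rightarrow> complex" and z :: complex
  assumes lt1: "\<And>i. cmod (\<alpha> i) < 1"
begin

lemma le1: "cmod (\<alpha> i) \<le> 1" using lt1[of i] by simp

definition T :: "l2 \<Rightarrow> l2" where "T x = Cmv \<alpha> x - z *\<^sub>C x"

text \<open>The same operator on arbitrary sequences: the form in which \<open>ess_spectrum\<close>
  sees it, and the one that makes sense for formal solutions outside \<open>ell2\<close>.\<close>

definition Traw :: "(nat \<Rightarrow> complex) \<Rightarrow> nat \<Rightarrow> complex" where
  "Traw x n = cmv \<alpha> x n - z * x n"

lemma coord_T: "coord (T x) n = Traw (coord x) n"
  by (simp add: T_def Traw_def coord_Cmv_cmv le1)

lemma T_add: "T (x + y) = T x + T y"
  by (simp add: T_def Cmv_add le1)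

lemma T_cscale: "T (c *\<^sub>C x) = c *\<^sub>C T x"
  by (simp add: T_def Cmv_cscale le1 mult.commute)

lemma T_diff: "T (x - y) = T x - T y"
  using T_add[of "x - y" y] by (simp add: algebra_simps)

lemma norm_T: "norm (T x) \<le> (1 + cmod z) * norm x"
  using norm_triangle_ineq4[of "Cmv \<alpha> x" "z *\<^sub>C x"] by (simp add: T_def norm_Cmv le1 algebra_simps)

lemma T_tendsto: "f \<longlonglongrightarrow> x \<Longrightarrow> (\<lambda>j. T (f j)) \<longlonglongrightarrow> T x"
proof (rule LIM_zero_cancel)
  assume "f \<longlonglongrightarrow> x"
  then have "(\<lambda>j. f j - x) \<longlonglongrightarrow> 0" by (rule LIM_zero)
  then show "(\<lambda>j. T (f j) - T x) \<longlonglongrightarrow> 0"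
    by (rule tendsto_0_le[where K = "1 + cmod z"])
       (intro always_eventually allI, simp add: T_diff[symmetric] norm_T mult.commute)
qed

text \<open>The kernel is at most one-dimensional even among all sequences: the equation
  \<open>M v = z L\<^sup>* v\<close> is a recursion that determines \<open>v\<close> by \<open>v 0\<close>.\<close>

lemma formal_kernel:
  assumes "Traw v = (\<lambda>n. 0)" "v 0 = 0" "z \<noteq> 0"
  shows "v = (\<lambda>n. 0)"
proof -
  let ?c = "\<lambda>i. cnj (\<alpha> i)"
  have "layer \<alpha> 0 (layer \<alpha> 1 v) = (\<lambda>n. z * v n)"
    using assms(1) by (auto simp: Traw_def cmv_layer fun_eq_iff)
  then have "layer ?c 0 (layer \<alpha> 0 (layer \<alpha> 1 v)) = (\<lambda>n. z * layer ?c 0 v n)"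
    by (simp only: layer_scale)
  then have eq: "layer \<alpha> 1 v n = z * layer ?c 0 v n" for n
    using layer_inverse[of \<alpha> 0 "layer \<alpha> 1 v", OF le1] by (simp add: fun_eq_iff)
  have rho: "complex_of_real (rho (\<alpha> n)) \<noteq> 0" for n using lt1[of n] rho_eq_0_iff[of "\<alpha> n"] by simp
  have "v n = 0" for n
  proof (induction n rule: less_induct)
    case (less n)
    show ?case
    proof (cases n)
      case (Suc m)
      have v: "v m = 0" "v (m - 1) = 0" using less.IH[of m] less.IH[of "m - 1"] Suc by simp_all
      \<comment> \<open>Row m of exactly one of the two layers contains v (m + 1), with the nonzero
        factor \<open>rho (\<alpha> m)\<close>: that of the adjoint of L for even m, that of M for
        odd m. All other terms vanish by induction.\<close>
      show ?thesis
      proof (cases "even m")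
        case True
        have "layer \<alpha> 1 v m = 0"
          using True v assms(2) by (simp add: layer_def glay_def)
        moreover have "layer ?c 0 v m = complex_of_real (rho (\<alpha> m)) * v (Suc m)"
          using True v assms(2) by (simp add: layer_def glay_def)
        ultimately show ?thesis using eq[of m] rho[of m] assms(3) Suc by simp
      next
        case False
        have "layer \<alpha> 1 v m = complex_of_real (rho (\<alpha> m)) * v (Suc m)"
          using False v assms(2) by (simp add: layer_def glay_def)
        moreover have "layer ?c 0 v m = 0"
          using False v assms(2) by (simp add: layer_def glay_def)
        ultimately show ?thesis using eq[of m] rho[of m] Suc by simp
      qed
    qed (simp add: assms(2))
  qed
  then show ?thesis by auto
qed

lemma Traw_linear: "Traw (\<lambda>n. a * x n + b * y n) = (\<lambda>n. a * Traw x n + b * Traw y n)"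
  unfolding Traw_def cmv_layer layer_add layer_scale by (auto simp: algebra_simps)

lemma kernel_finite_dim: "\<exists>F. finite F \<and> F \<subseteq> ell2 \<and> {x \<in> ell2. Traw x = (\<lambda>n. 0)} \<subseteq> lin_span F"
proof (cases "\<exists>x0\<in>ell2. Traw x0 = (\<lambda>n. 0) \<and> x0 0 \<noteq> 0 \<and> z \<noteq> 0")
  case True
  then obtain x0 where x0: "x0 \<in> ell2" "Traw x0 = (\<lambda>n. 0)" "x0 0 \<noteq> 0" "z \<noteq> 0" by blast
  have "{x \<in> ell2. Traw x = (\<lambda>n. 0)} \<subseteq> lin_span {x0}"
  proof
    fix x assume "x \<in> {x \<in> ell2. Traw x = (\<lambda>n. 0)}"
    then have x: "Traw x = (\<lambda>n. 0)" by simp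
    define c where "c = x 0 / x0 0"
    have "Traw (\<lambda>n. 1 * x n + (- c) * x0 n) = (\<lambda>n. 0)"
      unfolding Traw_linear x x0(2) by simp
    then have "(\<lambda>n. 1 * x n + (- c) * x0 n) = (\<lambda>n. 0)"
      by (rule formal_kernel) (use x0(3,4) in \<open>simp_all add: c_def\<close>)
    from fun_cong[OF this] have "x n = c * x0 n" for n by simp
    then have "x = (\<lambda>n. \<Sum>f\<in>{x0}. c * f n)" by (intro ext) simp
    then show "x \<in> lin_span {x0}"
      unfolding lin_span_def by (intro CollectI exI[of _ "\<lambda>_. c"])
  qed
  then show ?thesis using x0(1) by (intro exI[of _ "{x0}"]) simp
next
  case no: False
  have "x = (\<lambda>n. 0)" if x: "x \<in> ell2" "Traw x = (\<lambda>n. 0)" for x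
  proof (cases "z = 0")
    case True
    have "T (Abs_l2 x) = 0"
      by (rule l2_eqI) (simp only: coord_T coord_Abs[OF x(1)] x(2) coord_zero)
    then have "Cmv \<alpha> (Abs_l2 x) - z *\<^sub>C Abs_l2 x = 0" by (simp only: T_def)
    then have "Cmv \<alpha> (Abs_l2 x) = 0" using True by simp
    then have "norm (Abs_l2 x) = 0" using norm_Cmv[of \<alpha> "Abs_l2 x", OF le1] by simp
    then have "coord (Abs_l2 x) n = 0" for n by simp
    then show ?thesis by (intro ext) (simp only: coord_Abs[OF x(1)])
  next
    case False
    then have "x 0 = 0" using no x by (cases "x 0 = 0") (simp, fast)
    then show ?thesis using formal_kernel x(2) False by blast
  qed
  then show ?thesis by (intro exI[of _ "{}"]) (simp add: lin_span_def subset_iff)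
qed

lemma trunc_decomposition: "x = trunc N x + (x - trunc N x)" "x - trunc N x \<in> tail N"
  by (simp_all add: tail_def)

lemma trunc_Suc: "x \<in> tail N \<Longrightarrow> x - coord x N *\<^sub>C unitv N \<in> tail (Suc N)"
  by (auto simp: tail_def less_Suc_eq)

context
  fixes N :: nat and e :: real
  assumes e: "0 < e" and below: "\<And>x. x \<in> tail N \<Longrightarrow> e * norm x \<le> norm (T x)"
begin

text \<open>T is bounded below on the tail, so the preimages of a convergent sequence form a Cauchy
  sequence.\<close>

lemma closed_T_tail:
  assumes f: "\<And>j::nat. f j \<in> T ` tail N" and lim: "f \<longlonglongrightarrow> y"
  shows "y \<in> T ` tail N"
proof -
  have "\<forall>j. \<exists>x. x \<in> tail N \<and> f j = T x" using f unfolding image_iff Bex_def by (rule allI)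
  from choice[OF this] obtain x where x': "\<forall>j. x j \<in> tail N \<and> f j = T (x j)" ..
  have x: "x j \<in> tail N" "f j = T (x j)" for j using spec[OF x', of j] by simp_all
  have diff: "x i - x j \<in> tail N" for i j using x(1)[of i] x(1)[of j] by (simp add: tail_def)
  have "Cauchy x"
  proof (rule metric_CauchyI)
    fix r :: real assume "0 < r"
    then obtain M where M: "\<And>i j. i \<ge> M \<Longrightarrow> j \<ge> M \<Longrightarrow> dist (f i) (f j) < e * r"
      using metric_CauchyD[OF LIMSEQ_imp_Cauchy[OF lim], of "e * r"] e by auto
    have "dist (x i) (x j) < r" if "i \<ge> M" "j \<ge> M" for i j
    proof -
      have "e * norm (x i - x j) \<le> norm (T (x i - x j))" by (rule below[OF diff])
      also have "\<dots> < e * r" using M[OF that] by (simp add: dist_norm x(2) T_diff)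
      finally show ?thesis using e by (simp add: dist_norm)
    qed
    then show "\<exists>M. \<forall>i\<ge>M. \<forall>j\<ge>M. dist (x i) (x j) < r" by blast
  qed
  then obtain x0 where x0: "x \<longlonglongrightarrow> x0" using Cauchy_convergent_iff convergent_def by blast
  have "coord x0 i = 0" if "i < N" for i
  proof -
    have "(\<lambda>j. x j - x0) \<longlonglongrightarrow> 0" using x0 by (rule LIM_zero)
    then have "(\<lambda>j. coord (x j) i - coord x0 i) \<longlonglongrightarrow> 0"
    proof (rule tendsto_0_le[where K = 1])
      show "\<forall>\<^sub>F j in sequentially. norm (coord (x j) i - coord x0 i) \<le> norm (x j - x0) * 1"
      proof (intro always_eventually allI)
        show "norm (coord (x j) i - coord x0 i) \<le> norm (x j - x0) * 1" for j
          using norm_coord_le[of "x j - x0" i] by simp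
      qed
    qed
    moreover have "coord (x j) i = 0" for j using x(1)[of j] that by (simp add: tail_def)
    ultimately show ?thesis by (simp add: LIMSEQ_const_iff)
  qed
  then have "x0 \<in> tail N" by (simp add: tail_def)
  moreover have "f = (\<lambda>j. T (x j))" by (rule ext) (rule x(2))
  then have "f \<longlonglongrightarrow> T x0" using T_tendsto[OF x0] by (simp only:)
  with lim have "y = T x0" by (rule LIMSEQ_unique)
  ultimately show ?thesis by (simp only: imageI)
qed

text \<open>\<open>tail n\<close> is \<open>tail (Suc n)\<close> plus the line through
  \<open>unitv n\<close>, and adding the image of a line keeps the image of the tail closed. At m =
  N the whole range is reached.\<close>

lemma closed_T_tail_le:
  "m \<le> N \<Longrightarrow> (\<And>j::nat. f j \<in> T ` tail (N - m)) \<Longrightarrow> f \<longlonglongrightarrow> y \<Longrightarrow> y \<in> T ` tail (N - m)"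
proof (induction m arbitrary: f y)
  case 0
  have "f j \<in> T ` tail N" for j using "0.prems"(2)[of j] by simp
  from closed_T_tail[OF this "0.prems"(3)] show ?case by simp
next
  case (Suc m)
  define n where "n = N - Suc m"
  have n: "N - m = Suc n" using Suc.prems(1) by (simp add: n_def)
  let ?S = "T ` tail (Suc n)"
  have "\<exists>s c. s \<in> ?S \<and> f j = s + c *\<^sub>C T (unitv n)" for j
  proof -
    obtain x where x: "x \<in> tail n" "f j = T x" using Suc.prems(2)[of j] unfolding n_def by blast
    have "f j = T (x - coord x n *\<^sub>C unitv n) + coord x n *\<^sub>C T (unitv n)"
      by (simp add: x(2) T_diff T_cscale)
    then show ?thesis using trunc_Suc[OF x(1)]
      by (intro exI[of _ "T (x - coord x n *\<^sub>C unitv n)"] exI[of _ "coord x n"] conjI imageI)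
  qed
  then have "\<forall>j. \<exists>w. fst w \<in> ?S \<and> f j = fst w + snd w *\<^sub>C T (unitv n)" by simp
  from choice[OF this] obtain w where w: "\<forall>j. fst (w j) \<in> ?S \<and> f j = fst (w j) + snd (w j) *\<^sub>C T (unitv n)" ..
  define g where "g j = fst (w j)" for j
  define c where "c j = snd (w j)" for j
  have g: "g j \<in> ?S" "f j = g j + c j *\<^sub>C T (unitv n)" for j
    using spec[OF w, of j] by (simp_all only: g_def c_def)
  have fg: "(\<lambda>j. g j + c j *\<^sub>C T (unitv n)) = f" by (rule ext) (rule g(2)[symmetric])
  have "\<exists>s\<in>?S. \<exists>d. y = s + d *\<^sub>C T (unitv n)"
  proof (rule closed_add_line)
    show "y' \<in> ?S" if "\<And>j::nat. f' j \<in> ?S" "f' \<longlonglongrightarrow> y'" for f' y'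
      using Suc.IH[of f' y'] Suc.prems(1) that unfolding n by simp
    show "a + b \<in> ?S" if ab: "a \<in> ?S" "b \<in> ?S" for a b
    proof -
      obtain a' b' where "a' \<in> tail (Suc n)" "b' \<in> tail (Suc n)" "a = T a'" "b = T b'" using ab by fast
      moreover from this have "a' + b' \<in> tail (Suc n)" by (simp add: tail_def)
      ultimately show ?thesis by (simp add: T_add[symmetric])
    qed
    show "d *\<^sub>C a \<in> ?S" if a: "a \<in> ?S" for a d
    proof -
      obtain a' where "a' \<in> tail (Suc n)" "a = T a'" using a by fast
      moreover from this have "d *\<^sub>C a' \<in> tail (Suc n)" by (simp add: tail_def)
      ultimately show ?thesis by (simp add: T_cscale[symmetric])
    qed
    show "(\<lambda>j. g j + c j *\<^sub>C T (unitv n)) \<longlonglongrightarrow> y" using Suc.prems(3) unfolding fg .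
  qed (rule g)
  then obtain x d where x: "x \<in> tail (Suc n)" "y = T x + d *\<^sub>C T (unitv n)"
    by (elim bexE exE imageE) (rule that, assumption, simp only:)
  have "x + d *\<^sub>C unitv n \<in> tail n" using x(1) by (simp add: tail_def)
  moreover have "y = T (x + d *\<^sub>C unitv n)" by (simp add: x(2) T_add T_cscale)
  ultimately show ?case unfolding n_def[symmetric] by (simp only: imageI)
qed

lemma closed_range:
  assumes "\<And>j::nat. f j \<in> range T" "f \<longlonglongrightarrow> y"
  shows "y \<in> range T"
proof -
  have "tail (N - N) = UNIV" by (simp add: tail_def)
  then show ?thesis using closed_T_tail_le[of N f y] assms by simp
qed

lemma range_finite_codim: "\<exists>x w. y = T x + trunc N w"
proof -
  \<comment> \<open>The adjoint of T, as the inverse of a surjective isometry is its adjoint. It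
    commutes with T, which puts \<open>T' (T x)\<close> into the range of T.\<close>
  define T' where "T' x = Cmv_inv \<alpha> x - cnj z *\<^sub>C x" for x
  let ?U = "Cmv \<alpha>" and ?V = "Cmv_inv \<alpha>"
  interpret filtered_isometry ?U tail using le1 by (rule filtered_isometry_Cmv)
  have V: "?V (?U x) = x" "?U (?V x) = x" for x by (simp_all add: Cmv_inverse le1)
  have V_diff: "?V (x - y) = ?V x - ?V y" for x y
    using arg_cong[OF U_diff[of "?V x" "?V y"], of ?V] by (simp only: V)
  have V_cscale: "?V (c *\<^sub>C x) = c *\<^sub>C ?V x" for c x
    using arg_cong[OF U_cscale[of c "?V x"], of ?V] by (simp only: V)
  have adj: "inner (T' x) y = inner x (T y)" for x y
  proof -
    have "inner (?V x) y = inner x (?U y)" using inner_U[of "?V x" y] by (simp add: V)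
    moreover have "inner (cnj z *\<^sub>C x) y = inner x (z *\<^sub>C y)" by (simp add: inner_cscale)
    ultimately show ?thesis by (simp add: T'_def T_def inner_diff_left inner_diff_right)
  qed
  have comm: "T' (T x) = T (T' x)" for x
    by (simp add: T'_def T_def V V_diff V_cscale U_diff U_cscale mult.commute)
  have norm_T': "norm (T' x) \<le> (1 + cmod z) * norm x" for x
    using norm_triangle_ineq4[of "?V x" "cnj z *\<^sub>C x"] norm_U[of "?V x"]
    by (simp add: T'_def V algebra_simps)
  define A where "A x = T' (T x) + trunc N x" for x
  have trunc_diff: "trunc N (x - y) = trunc N x - trunc N y" for x y by (rule l2_eqI) simp
  have norm_trunc: "norm (trunc N x) \<le> norm x" for x
  proof (rule norm_l2_leI)
    fix M
    have "(\<Sum>n<M. (cmod (coord (trunc N x) n))\<^sup>2) \<le> (\<Sum>n<M. (cmod (coord x n))\<^sup>2)"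
      by (intro sum_mono) simp
    also have "\<dots> \<le> (norm x)\<^sup>2" by (intro sum_coord_le) simp
    finally show "(\<Sum>n<M. (cmod (coord (trunc N x) n))\<^sup>2) \<le> (norm x)\<^sup>2" .
  qed simp
  have "inner (coord (trunc N x) n) (coord x n) = inner (coord (trunc N x) n) (coord (trunc N x) n)" for x n
    by simp
  then have inner_trunc: "inner (trunc N x) x = (norm (trunc N x))\<^sup>2" for x
    unfolding power2_norm_eq_inner inner_l2.rep_eq by (rule arg_cong[where f = suminf, OF ext])
  \<comment> \<open>With m the square root of \<open>inner (A x) x\<close>, both T x and
    \<open>trunc N x\<close> have norm at most m, and e times the norm of
    \<open>x - trunc N x\<close> is at most \<open>m + (1 + cmod z) * m\<close>. Adding up gives
    \<open>norm x \<le> (1 / e + k) * m\<close>.\<close>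
  define k where "k = 1 + (1 + cmod z) / e"
  define c where "c = 1 / (1 / e + k)\<^sup>2"
  have k: "0 < k" "0 < 1 / e + k" using e by (simp_all add: k_def add_pos_nonneg)
  then have "0 < c" by (simp add: c_def)
  have coer: "c * (norm x)\<^sup>2 \<le> inner (A x) x" for x
  proof -
    define m where "m = sqrt ((norm (T x))\<^sup>2 + (norm (trunc N x))\<^sup>2)"
    have m: "norm (T x) \<le> m" "norm (trunc N x) \<le> m" "0 \<le> m"
      by (simp_all add: m_def real_le_rsqrt)
    have "e * norm (x - trunc N x) \<le> norm (T (x - trunc N x))" by (rule below[OF trunc_decomposition(2)])
    also have "\<dots> \<le> norm (T x) + norm (T (trunc N x))" unfolding T_diff by (rule norm_triangle_ineq4)
    also have "\<dots> \<le> m + (1 + cmod z) * m"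
    proof (rule add_mono[OF m(1)])
      have "(1 + cmod z) * norm (trunc N x) \<le> (1 + cmod z) * m" by (intro mult_left_mono m(2)) simp
      with norm_T[of "trunc N x"] show "norm (T (trunc N x)) \<le> (1 + cmod z) * m" by (rule order_trans)
    qed
    finally have "norm (x - trunc N x) \<le> (m + (1 + cmod z) * m) / e" using e by (simp add: field_simps)
    moreover have "norm x \<le> norm (trunc N x) + norm (x - trunc N x)"
      using norm_triangle_ineq[of "trunc N x" "x - trunc N x"] by simp
    ultimately have "norm x \<le> m + (m + (1 + cmod z) * m) / e" using m by linarith
    also have "\<dots> = (1 / e + k) * m" by (simp add: k_def add_divide_distrib algebra_simps)
    finally have "(norm x)\<^sup>2 \<le> ((1 / e + k) * m)\<^sup>2" by (intro power_mono) auto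
    then have "c * (norm x)\<^sup>2 \<le> c * ((1 / e + k) * m)\<^sup>2" using \<open>0 < c\<close> by simp
    also have "\<dots> = m\<^sup>2" using k by (simp add: c_def power_mult_distrib)
    also have "\<dots> = inner (A x) x"
      by (simp add: m_def A_def inner_add_left adj inner_trunc power2_norm_eq_inner)
    finally show ?thesis .
  qed
  have "\<exists>x. A x = y"
  proof (rule coercive_surj[OF _ _ coer \<open>0 < c\<close>])
    show "A (x - y) = A x - A y" for x y
      by (simp add: A_def T_diff trunc_diff) (simp add: T'_def V_diff)
    show "norm (A x) \<le> ((1 + cmod z) * (1 + cmod z) + 1) * norm x" for x
    proof -
      have "norm (T' (T x)) \<le> (1 + cmod z) * ((1 + cmod z) * norm x)"
        using norm_T'[of "T x"] mult_left_mono[OF norm_T[of x], of "1 + cmod z"] by simp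
      then show ?thesis using norm_triangle_ineq[of "T' (T x)" "trunc N x"] norm_trunc[of x]
        unfolding A_def by (simp add: algebra_simps)
    qed
  qed
  then obtain x where "A x = y" ..
  then show ?thesis unfolding A_def comm by (intro exI[of _ "T' x"] exI[of _ x]) simp
qed

end

end

section \<open>The Fredholm property on raw sequences\<close>

context cmv_operator
begin

lemma Abs_l2_range:
  assumes "g \<in> Traw ` ell2"
  shows "g \<in> ell2" "Abs_l2 g \<in> range T"
proof -
  obtain x where x: "x \<in> ell2" "g = Traw x" using assms by (rule imageE)
  have g: "g = coord (T (Abs_l2 x))"
    by (rule ext) (simp only: coord_T coord_Abs[OF x(1)] x(2))
  show "g \<in> ell2" unfolding g by (rule coord_ell2)
  show "Abs_l2 g \<in> range T" unfolding g coord_inverse by (rule rangeI)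
qed

lemma coord_range: "y \<in> range T \<Longrightarrow> coord y \<in> Traw ` ell2"
proof (elim imageE)
  fix x assume "y = T x"
  then have "coord y = Traw (coord x)" by (intro ext) (simp only: coord_T)
  then show "coord y \<in> Traw ` ell2" using imageI[OF coord_ell2, of Traw x] by simp
qed

lemma ell2_closed_iff:
  "ell2_closed (Traw ` ell2) \<longleftrightarrow> (\<forall>f y. (\<forall>j::nat. f j \<in> range T) \<longrightarrow> f \<longlonglongrightarrow> y \<longrightarrow> y \<in> range T)"
proof
  assume closed: "ell2_closed (Traw ` ell2)"
  show "\<forall>f y. (\<forall>j::nat. f j \<in> range T) \<longrightarrow> f \<longlonglongrightarrow> y \<longrightarrow> y \<in> range T"
  proof (intro allI impI)
    fix f :: "nat \<Rightarrow> l2" and y assume f: "\<forall>j. f j \<in> range T" and lim: "f \<longlonglongrightarrow> y"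
    have "(\<lambda>j. norm (f j - y)) \<longlonglongrightarrow> 0" by (rule tendsto_norm_zero, rule LIM_zero, rule lim)
    moreover have "norm (f j - y) = ell2_norm (\<lambda>n. coord (f j) n - coord y n)" for j
      unfolding norm_l2_ell2_norm by (rule arg_cong[where f = ell2_norm], rule ext) simp
    ultimately have "(\<lambda>j. ell2_norm (\<lambda>n. coord (f j) n - coord y n)) \<longlonglongrightarrow> 0" by simp
    moreover have "\<forall>j. coord (f j) \<in> Traw ` ell2" by (rule allI, rule coord_range, rule spec[OF f])
    ultimately have "(\<forall>j. coord (f j) \<in> Traw ` ell2) \<and> coord y \<in> ell2
        \<and> (\<lambda>j. ell2_norm (\<lambda>n. coord (f j) n - coord y n)) \<longlonglongrightarrow> 0"
      by (intro conjI coord_ell2)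
    then have "coord y \<in> Traw ` ell2" by (rule closed[unfolded ell2_closed_def, rule_format])
    then show "y \<in> range T" using Abs_l2_range(2)[of "coord y"] by (simp only: coord_inverse)
  qed
next
  assume closed: "\<forall>f y. (\<forall>j::nat. f j \<in> range T) \<longrightarrow> f \<longlonglongrightarrow> y \<longrightarrow> y \<in> range T"
  show "ell2_closed (Traw ` ell2)"
    unfolding ell2_closed_def
  proof (intro allI impI, elim conjE)
    fix f :: "nat \<Rightarrow> nat \<Rightarrow> complex" and y
    assume f: "\<forall>j. f j \<in> Traw ` ell2" and y: "y \<in> ell2"
      and lim: "(\<lambda>j. ell2_norm (\<lambda>n. f j n - y n)) \<longlonglongrightarrow> 0"
    have fj: "f j \<in> ell2" for j by (rule Abs_l2_range(1), rule spec[OF f])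
    have nrm: "norm (Abs_l2 (f j) - Abs_l2 y) = ell2_norm (\<lambda>n. f j n - y n)" for j
      unfolding norm_l2_ell2_norm
      by (rule arg_cong[where f = ell2_norm], rule ext) (simp only: coord_diff coord_Abs[OF fj] coord_Abs[OF y])
    have "(\<lambda>j. norm (Abs_l2 (f j) - Abs_l2 y)) \<longlonglongrightarrow> 0" using lim by (simp only: nrm)
    then have "(\<lambda>j. Abs_l2 (f j) - Abs_l2 y) \<longlonglongrightarrow> 0" by (rule tendsto_norm_zero_cancel)
    then have lim': "(\<lambda>j. Abs_l2 (f j)) \<longlonglongrightarrow> Abs_l2 y" by (rule LIM_zero_cancel)
    have "\<forall>j. Abs_l2 (f j) \<in> range T" by (rule allI, rule Abs_l2_range(2), rule spec[OF f])
    with lim' have "Abs_l2 y \<in> range T" by (intro closed[THEN spec, THEN spec, THEN mp, THEN mp])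
    from coord_range[OF this] show "y \<in> Traw ` ell2" by (simp only: coord_Abs[OF y])
  qed
qed

text \<open>\<open>lin_span\<close> indexes coefficients by the vectors themselves, so the
  coefficient must be recovered from f: pairing f with w over the first N coordinates returns
  \<open>coord w m\<close> when f is the m-th unit vector.\<close>

lemma trunc_lin_span: "coord (trunc N w) \<in> lin_span ((\<lambda>m. coord (unitv m)) ` {..<N})"
proof -
  have inj: "inj_on (\<lambda>m. coord (unitv m)) {..<N}"
  proof (rule inj_onI)
    fix m m' assume "coord (unitv m) = coord (unitv m')"
    from fun_cong[OF this, of m] show "m = m'" by (simp split: if_splits)
  qed
  have "coord (trunc N w) n = (\<Sum>f\<in>(\<lambda>m. coord (unitv m)) ` {..<N}. (\<Sum>m<N. f m * coord w m) * f n)" for n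
  proof -
    have "(\<Sum>f\<in>(\<lambda>m. coord (unitv m)) ` {..<N}. (\<Sum>m<N. f m * coord w m) * f n)
        = (\<Sum>p<N. (\<Sum>m<N. coord (unitv p) m * coord w m) * coord (unitv p) n)"
      by (subst sum.reindex[OF inj]) simp
    also have "\<dots> = (\<Sum>p<N. if p = n then coord w n else 0)"
      by (intro sum.cong refl) (simp add: if_distrib[where f = "\<lambda>x. x * _"] cong: if_cong)
    also have "\<dots> = coord (trunc N w) n" by simp
    finally show ?thesis by simp
  qed
  then show ?thesis unfolding lin_span_def
    by (intro CollectI exI[of _ "\<lambda>f. \<Sum>m<N. f m * coord w m"] ext)
qed

lemma fredholm_if_not_weyl:
  assumes "\<not> weyl \<alpha> z"
  shows "ell2_fredholm Traw"
proof -
  from assms obtain N e where "0 < e"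
    and 1: "\<And>x. x \<in> tail N \<Longrightarrow> norm x = 1 \<Longrightarrow> e \<le> norm (T x)"
    unfolding weyl_def T_def[symmetric] by (meson not_le)
  have below: "e * norm x \<le> norm (T x)" if "x \<in> tail N" for x
  proof (cases "x = 0")
    case False
    let ?c = "complex_of_real (1 / norm x)"
    have c: "cmod ?c = 1 / norm x" by (simp only: norm_of_real) simp
    have "e \<le> norm (T (?c *\<^sub>C x))"
      using False that c by (intro 1) (simp_all add: tail_def)
    also have "\<dots> = norm (T x) / norm x" unfolding T_cscale norm_cscale c by simp
    finally show ?thesis using False by (simp add: pos_le_divide_eq)
  qed simp
  show ?thesis
    unfolding ell2_fredholm_def
  proof (intro conjI)
    show "\<exists>F. finite F \<and> F \<subseteq> ell2 \<and> {x \<in> ell2. Traw x = (\<lambda>n. 0)} \<subseteq> lin_span F"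
      by (rule kernel_finite_dim)
    show "ell2_closed (Traw ` ell2)"
      unfolding ell2_closed_iff
    proof (intro allI impI)
      show "y \<in> range T" if f: "\<forall>j::nat. f j \<in> range T" and "f \<longlonglongrightarrow> y" for f y
        by (rule closed_range[OF \<open>0 < e\<close> below spec[OF f] \<open>f \<longlonglongrightarrow> y\<close>])
    qed
    let ?F = "(\<lambda>m. coord (unitv m)) ` {..<N}"
    have "\<exists>x\<in>ell2. \<exists>w\<in>lin_span ?F. y = (\<lambda>n. Traw x n + w n)" if y: "y \<in> ell2" for y
    proof -
      have "\<exists>x w. Abs_l2 y = T x + trunc N w"
        by (rule range_finite_codim[OF \<open>0 < e\<close>]) (rule below)
      then obtain x w where xw: "Abs_l2 y = T x + trunc N w" by (elim exE)
      have "y n = Traw (coord x) n + coord (trunc N w) n" for n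
        using arg_cong[OF xw, of "\<lambda>u. coord u n"] by (simp only: coord_Abs[OF y] coord_add coord_T)
      then show ?thesis
        by (intro bexI[of _ "coord x"] bexI[of _ "coord (trunc N w)"] ext coord_ell2 trunc_lin_span)
    qed
    then show "\<exists>F. finite F \<and> F \<subseteq> ell2 \<and> (\<forall>y\<in>ell2. \<exists>x\<in>ell2. \<exists>w\<in>lin_span F. y = (\<lambda>n. Traw x n + w n))"
      by (intro exI[of _ ?F] conjI ballI) auto
  qed
qed

text \<open>Two layers reach at most two sites ahead. Hence a formal infinite sum can be replaced by
  a partial sum when \<open>Traw\<close> is evaluated at a coordinate.\<close>

lemma Traw_local: "(\<And>i. i \<le> n + 2 \<Longrightarrow> x i = y i) \<Longrightarrow> Traw x n = Traw y n"
proof -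
  assume xy: "\<And>i. i \<le> n + 2 \<Longrightarrow> x i = y i"
  have L: "layer \<beta> c u i = layer \<beta> c v i" if "u (i - 1) = v (i - 1)" "u i = v i" "u (Suc i) = v (Suc i)"
    for \<beta> c i and u v :: "nat \<Rightarrow> complex"
    using that unfolding layer_def glay_def by (cases "i = 0") simp_all
  have 1: "layer \<alpha> 1 x i = layer \<alpha> 1 y i" if "i \<le> n + 1" for i
    by (rule L) (use that in \<open>simp_all add: xy\<close>)
  have "layer \<alpha> 0 (layer \<alpha> 1 x) n = layer \<alpha> 0 (layer \<alpha> 1 y) n"
    by (rule L) (intro 1, simp)+
  then show ?thesis by (simp add: Traw_def cmv_layer xy)
qed

text \<open>Truncations converge in norm; aiming at e / 2 leaves room for renormalizing a truncation
  of norm above 1/2. Support bound and vector form a pair for a later use of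
  \<open>choice\<close>.\<close>

lemma weyl_finite_support:
  assumes W: "weyl \<alpha> z" and "0 < e"
  shows "\<exists>w. N < fst w \<and> snd w \<in> tail N \<and> (\<forall>i\<ge>fst w. coord (snd w) i = 0)
    \<and> norm (snd w) = 1 \<and> norm (T (snd w)) < e"
proof -
  obtain x where x: "x \<in> tail N" "norm x = 1" "norm (T x) < e / 2"
    using W[unfolded weyl_def, rule_format, of "e / 2" N] \<open>0 < e\<close> unfolding T_def by auto
  have "\<forall>\<^sub>F M in sequentially. norm (T (trunc M x)) < e / 2"
    using tendsto_norm[OF T_tendsto[OF trunc_tendsto[of x]]] x(3) by (rule order_tendstoD)
  moreover have "\<forall>\<^sub>F M in sequentially. 1 / 2 < norm (trunc M x)"
    using tendsto_norm[OF trunc_tendsto[of x]] by (rule order_tendstoD) (simp add: x(2))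
  ultimately have "\<forall>\<^sub>F M in sequentially. norm (T (trunc M x)) < e / 2 \<and> 1 / 2 < norm (trunc M x)"
    by (rule eventually_conj)
  then have "\<forall>\<^sub>F M in sequentially. (norm (T (trunc M x)) < e / 2 \<and> 1 / 2 < norm (trunc M x)) \<and> N < M"
    by (rule eventually_conj) (rule eventually_gt_at_top)
  from eventually_happens'[OF sequentially_bot this] obtain M where
    M: "norm (T (trunc M x)) < e / 2" "1 / 2 < norm (trunc M x)" "N < M" by (elim exE conjE)
  define c where "c = complex_of_real (1 / norm (trunc M x))"
  have c: "cmod c = 1 / norm (trunc M x)" unfolding c_def by (simp only: norm_of_real) simp
  have "norm (c *\<^sub>C trunc M x) = 1" unfolding norm_cscale c using M(2) by auto
  moreover have "norm (T (c *\<^sub>C trunc M x)) < e"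
  proof -
    have "norm (T (c *\<^sub>C trunc M x)) = norm (T (trunc M x)) / norm (trunc M x)"
      unfolding T_cscale norm_cscale c by simp
    also have "\<dots> < e"
    proof -
      have "e * (1 / 2) \<le> e * norm (trunc M x)" using M(2) \<open>0 < e\<close> by (intro mult_left_mono) auto
      then have "norm (T (trunc M x)) < e * norm (trunc M x)" using M(1) by linarith
      moreover have "0 < norm (trunc M x)" using M(2) by linarith
      ultimately show ?thesis by (simp only: pos_divide_less_eq)
    qed
    finally show ?thesis .
  qed
  moreover have "c *\<^sub>C trunc M x \<in> tail N" using x(1) by (simp add: tail_def)
  ultimately show ?thesis using M(3) by (intro exI[of _ "(M, c *\<^sub>C trunc M x)"]) simp
qed

text \<open>Take approximate eigenvectors \<open>x\<^sub>j\<close> with disjoint supports and summable \<open>T x\<^sub>j\<close>.  If the range is closed,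
  then \<open>\<Sum> d\<^sub>j T x\<^sub>j = T w\<close> for bounded \<open>d\<close>, and \<open>w - \<Sum> d\<^sub>j x\<^sub>j\<close> is a formal solution.  As formal solutions form a
  space of dimension at most one, some nontrivial combination of the choices \<open>d = d0\<close> and \<open>d = d1\<close> yields
  \<open>\<Sum> d\<^sub>j x\<^sub>j \<in> \<ell>\<^sup>2\<close>, which is absurd.\<close>

lemma not_closed_if_weyl:
  assumes W: "weyl \<alpha> z"
  shows "\<not> ell2_closed (Traw ` ell2)"
proof
  assume cl: "ell2_closed (Traw ` ell2)"
  have closed: "y \<in> range T" if f: "\<And>j::nat. f j \<in> range T" and lim: "f \<longlonglongrightarrow> y" for f y
    by (rule cl[unfolded ell2_closed_iff, THEN spec, THEN spec, THEN mp, THEN mp, OF allI[OF f] lim])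
  have "z \<noteq> 0"
  proof -
    interpret filtered_isometry "Cmv \<alpha>" tail using le1 by (rule filtered_isometry_Cmv)
    have "approx_spec z" using W unfolding approx_spec_def weyl_def .
    then show ?thesis using approx_spec_norm[of z] by auto
  qed
  have "\<exists>w. N < fst w \<and> snd w \<in> tail N \<and> (\<forall>i\<ge>fst w. coord (snd w) i = 0)
    \<and> norm (snd w) = 1 \<and> norm (T (snd w)) < (1 / 2) ^ j" for N and j :: nat
    by (rule weyl_finite_support[OF W]) simp
  then have "\<forall>Nj. \<exists>w. fst Nj < fst w \<and> snd w \<in> tail (fst Nj) \<and> (\<forall>i\<ge>fst w. coord (snd w) i = 0)
    \<and> norm (snd w) = 1 \<and> norm (T (snd w)) < (1 / 2) ^ snd Nj" by (intro allI)
  from choice[OF this] obtain h where h: "\<And>N j. N < fst (h (N, j))" "\<And>N j. snd (h (N, j)) \<in> tail N"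
    "\<And>N j i. i \<ge> fst (h (N, j)) \<Longrightarrow> coord (snd (h (N, j))) i = 0"
    "\<And>N j. norm (snd (h (N, j))) = 1" "\<And>N j. norm (T (snd (h (N, j)))) < (1 / 2) ^ j" by force
  \<comment> \<open>Each vector starts where the support of the previous one ends, so the supports
    lie in the disjoint intervals from N j to N (Suc j).\<close>
  define N where "N = rec_nat 0 (\<lambda>j n. fst (h (n, j)))"
  define x where "x j = snd (h (N j, j))" for j
  have N_Suc: "N (Suc j) = fst (h (N j, j))" for j by (simp add: N_def)
  have mono: "strict_mono N" unfolding strict_mono_Suc_iff N_Suc using h(1) by blast
  have x: "norm (x j) = 1" "norm (T (x j)) < (1 / 2) ^ j" for j
    unfolding x_def using h(4,5) by simp_all
  have x0: "coord (x j) i = 0" if "i < N j \<or> N (Suc j) \<le> i" for i j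
    using that h(2)[of "N j" j] h(3)[of "N j" j i] unfolding x_def N_Suc tail_def by auto
  have x_far: "coord (x j) i = 0" if "i < j" for i j
  proof -
    have "j \<le> N j" using seq_suble[OF mono] .
    then show ?thesis using that by (intro x0) simp
  qed
  \<comment> \<open>The formal series of the d j x j. It is finite at every coordinate, because x j
    starts at N j, which is at least j.\<close>
  define S where "S d n = (\<Sum>j\<le>n. d j * coord (x j) n)" for d :: "nat \<Rightarrow> complex" and n
  have formal: "\<exists>w. Traw (\<lambda>n. 1 * coord w n + (-1) * S d n) = (\<lambda>n. 0)" if d: "\<And>j. cmod (d j) \<le> 1" for d
  proof -
    define P where "P J = (\<Sum>j<J. d j *\<^sub>C x j)" for J
    have TP: "T (P J) = (\<Sum>j<J. d j *\<^sub>C T (x j))" for J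
    proof (induction J)
      case 0
      have "T 0 = 0" using T_cscale[of 0 0] by simp
      then show ?case by (simp add: P_def)
    next
      case (Suc J)
      have "P (Suc J) = P J + d J *\<^sub>C x J" by (simp add: P_def)
      then show ?case by (simp only: T_add T_cscale Suc.IH sum.lessThan_Suc)
    qed
    have "summable (\<lambda>j. d j *\<^sub>C T (x j))"
    proof (rule summable_comparison_test')
      show "summable (\<lambda>j. (1 / 2 :: real) ^ j)" by (rule summable_geometric) simp
      show "norm (d j *\<^sub>C T (x j)) \<le> (1 / 2) ^ j" if "0 \<le> j" for j
      proof -
        have "cmod (d j) * norm (T (x j)) \<le> 1 * norm (T (x j))" using d by (intro mult_right_mono) auto
        then show ?thesis using x(2)[of j] by simp
      qed
    qed
    then obtain y where "(\<lambda>j. d j *\<^sub>C T (x j)) sums y" by (auto simp: summable_def)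
    then have lim: "(\<lambda>J. T (P J)) \<longlonglongrightarrow> y" unfolding sums_def TP .
    have "y \<in> range T" by (rule closed[OF _ lim]) simp
    then obtain w where w: "y = T w" by (rule imageE)
    \<comment> \<open>At each coordinate T (P J) is eventually constant, so its limit y can be
      compared with the formal series.\<close>
    have "Traw (coord w) n = Traw (S d) n" for n
    proof -
      have ev: "coord (T (P J)) n = Traw (S d) n" if "J > n + 2" for J
        unfolding coord_T
      proof (rule Traw_local)
        fix i assume "i \<le> n + 2"
        then have "{..i} \<subseteq> {..<J}" using that by auto
        then have "(\<Sum>j\<le>i. d j * coord (x j) i) = (\<Sum>j<J. d j * coord (x j) i)"
          by (rule sum.mono_neutral_left[OF finite_lessThan]) (simp add: x_far)
        then show "coord (P J) i = S d i" by (simp add: P_def S_def)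
      qed
      have "(\<lambda>J. T (P J) - y) \<longlonglongrightarrow> 0" using lim by (rule LIM_zero)
      then have "(\<lambda>J. coord (T (P J)) n - coord y n) \<longlonglongrightarrow> 0"
      proof (rule tendsto_0_le[where K = 1])
        show "\<forall>\<^sub>F J in sequentially. norm (coord (T (P J)) n - coord y n) \<le> norm (T (P J) - y) * 1"
        proof (intro always_eventually allI)
          show "norm (coord (T (P J)) n - coord y n) \<le> norm (T (P J) - y) * 1" for J
            using norm_coord_le[of "T (P J) - y" n] by simp
        qed
      qed
      moreover have "\<forall>\<^sub>F J in sequentially. coord (T (P J)) n - coord y n = Traw (S d) n - coord y n"
        using eventually_gt_at_top[of "n + 2"] by (rule eventually_mono) (simp only: ev)
      ultimately have "(\<lambda>J::nat. Traw (S d) n - coord y n) \<longlonglongrightarrow> 0"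
        by (rule Lim_transform_eventually)
      then have "Traw (S d) n - coord y n = 0" by (simp add: LIMSEQ_const_iff)
      then show ?thesis unfolding w coord_T by simp
    qed
    then show ?thesis unfolding Traw_linear by (intro exI[of _ w] ext) simp
  qed
  \<comment> \<open>Even and odd j are selected separately, so that on the j-th interval
    \<open>s * S d0 + t * S d1\<close> is s or t times x j.\<close>
  define d0 :: "nat \<Rightarrow> complex" where "d0 j = (if even j then 1 else 0)" for j
  define d1 :: "nat \<Rightarrow> complex" where "d1 j = (if even j then 0 else 1)" for j
  have "\<exists>w. Traw (\<lambda>n. 1 * coord w n + (-1) * S d0 n) = (\<lambda>n. 0)"
    by (rule formal) (simp add: d0_def)
  then obtain w0 where w0: "Traw (\<lambda>n. 1 * coord w0 n + (-1) * S d0 n) = (\<lambda>n. 0)" ..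
  have "\<exists>w. Traw (\<lambda>n. 1 * coord w n + (-1) * S d1 n) = (\<lambda>n. 0)"
    by (rule formal) (simp add: d1_def)
  then obtain w1 where w1: "Traw (\<lambda>n. 1 * coord w1 n + (-1) * S d1 n) = (\<lambda>n. 0)" ..
  define v0 where "v0 n = 1 * coord w0 n + (-1) * S d0 n" for n
  define v1 where "v1 n = 1 * coord w1 n + (-1) * S d1 n" for n
  have v0: "Traw v0 = (\<lambda>n. 0)" and v1: "Traw v1 = (\<lambda>n. 0)"
    using w0 w1 unfolding v0_def[abs_def] v1_def[abs_def] by simp_all
  \<comment> \<open>Two numbers always admit a nontrivial linear relation; the combined formal
    solution vanishes at 0 and therefore everywhere.\<close>
  obtain s t where st: "s * v0 0 + t * v1 0 = 0" "s \<noteq> 0 \<or> t \<noteq> 0"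
  proof (cases "v0 0 = 0")
    case True
    then show thesis by (intro that[of 1 0]) simp_all
  next
    case False
    then show thesis by (intro that[of "v1 0" "- v0 0"]) (simp_all add: mult.commute)
  qed
  have "Traw (\<lambda>n. s * v0 n + t * v1 n) = (\<lambda>n. 0)" unfolding Traw_linear v0 v1 by simp
  then have "(\<lambda>n. s * v0 n + t * v1 n) = (\<lambda>n. 0)" by (rule formal_kernel) (use st(1) \<open>z \<noteq> 0\<close> in simp_all)
  then have sv: "s * v0 n + t * v1 n = 0" for n by (rule fun_cong)
  define w where "w = s *\<^sub>C w0 + t *\<^sub>C w1"
  have w_S: "coord w n = s * S d0 n + t * S d1 n" for n
    using sv[of n] by (simp add: w_def v0_def v1_def algebra_simps add_eq_0_iff)
  have S_block: "S d i = d j * coord (x j) i" if i: "N j \<le> i" "i < N (Suc j)" for d i j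
  proof -
    have "S d i = (\<Sum>m\<in>{j}. d m * coord (x m) i)"
      unfolding S_def
    proof (rule sum.mono_neutral_right)
      have "j \<le> N j" by (rule seq_suble[OF mono])
      then show "{j} \<subseteq> {..i}" using i by simp
      show "\<forall>m\<in>{..i} - {j}. d m * coord (x m) i = 0"
      proof
        fix m assume "m \<in> {..i} - {j}"
        then consider "m < j" | "j < m" by fastforce
        then have "i < N m \<or> N (Suc m) \<le> i"
        proof cases
          case 1
          then have "N (Suc m) \<le> N j" using mono by (simp add: strict_mono_less_eq)
          then show ?thesis using i by simp
        next
          case 2
          then have "N (Suc j) \<le> N m" using mono by (simp add: strict_mono_less_eq)
          then show ?thesis using i by simp
        qed
        from x0[OF this] show "d m * coord (x m) i = 0" by simp
      qed
    qed simp
    then show ?thesis by simp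
  qed
  \<comment> \<open>The part of w from N j on contains the whole piece s x j or t x j, of norm |s|
    or |t|, whereas these parts tend to 0.\<close>
  have big: "cmod (if even j then s else t) \<le> norm (trunc (N j) w - w)" for j
  proof -
    let ?D = "if even j then s else t" and ?I = "{N j..<N (Suc j)}"
    have wI: "coord w i = ?D * coord (x j) i" if "i \<in> ?I" for i
      using that S_block[of j i d0] S_block[of j i d1] by (simp add: w_S d0_def d1_def)
    have "(norm (x j))\<^sup>2 = (\<Sum>i\<in>?I. (cmod (coord (x j) i))\<^sup>2)"
      unfolding norm_l2_sq by (rule suminf_finite) (auto simp: x0)
    then have "(cmod ?D)\<^sup>2 = (cmod ?D)\<^sup>2 * (\<Sum>i\<in>?I. (cmod (coord (x j) i))\<^sup>2)" by (simp add: x(1))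
    also have "\<dots> = (\<Sum>i\<in>?I. (cmod (coord (trunc (N j) w - w) i))\<^sup>2)"
      unfolding sum_distrib_left
      by (intro sum.cong refl) (simp add: wI norm_mult power_mult_distrib)
    also have "\<dots> \<le> (norm (trunc (N j) w - w))\<^sup>2" by (intro sum_coord_le) simp
    finally show ?thesis by (rule power2_le_imp_le) simp
  qed
  have lim: "(\<lambda>j. norm (trunc (N j) w - w)) \<longlonglongrightarrow> 0"
    using LIMSEQ_subseq_LIMSEQ[OF trunc_tendsto[of w] mono]
    unfolding o_def by (rule tendsto_norm_zero[OF LIM_zero])
  have sub: "cmod a \<le> 0" if "strict_mono f" "\<And>j. cmod a \<le> norm (trunc (N (f j)) w - w)"
    for f :: "nat \<Rightarrow> nat" and a
  proof (rule LIMSEQ_le_const)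
    show "(\<lambda>j. norm (trunc (N (f j)) w - w)) \<longlonglongrightarrow> 0"
      using LIMSEQ_subseq_LIMSEQ[OF lim that(1)] by (simp add: o_def)
  qed (use that(2) in blast)
  have "cmod s \<le> 0" by (rule sub[of "\<lambda>j. 2 * j"]) (use big[of "2 * _"] in \<open>simp_all add: strict_mono_def\<close>)
  moreover have "cmod t \<le> 0"
    by (rule sub[of "\<lambda>j. Suc (2 * j)"]) (use big[of "Suc (2 * _)"] in \<open>simp_all add: strict_mono_def\<close>)
  ultimately show False using st(2) by simp
qed

end

section \<open>The essential spectrum as a set of approximate eigenvalues, and the
  equivalence\<close>

theorem ess_spectrum_cmv:
  assumes "\<And>i. cmod (\<alpha> i) < 1"
  shows "ess_spectrum (cmv \<alpha>) = {z. weyl \<alpha> z}"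
proof -
  have "\<not> ell2_fredholm (\<lambda>x n. cmv \<alpha> x n - z * x n) \<longleftrightarrow> weyl \<alpha> z" for z
  proof -
    interpret cmv_operator \<alpha> z using assms by unfold_locales
    have "(\<lambda>x n. cmv \<alpha> x n - z * x n) = Traw" by (intro ext) (simp only: Traw_def)
    moreover have "\<not> ell2_fredholm Traw" if "weyl \<alpha> z"
      using not_closed_if_weyl[OF that] unfolding ell2_fredholm_def by (rule contrapos_nn) (elim conjE)
    ultimately show ?thesis using fredholm_if_not_weyl by (cases "weyl \<alpha> z") simp_all
  qed
  then show ?thesis by (simp add: ess_spectrum_def)
qed

theorem theorem7p6:
  fixes l :: nat and lam :: "nat \<Rightarrow> complex" and \<alpha> :: "nat \<Rightarrow> complex"
  assumes "1 \<le> l"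
    and "\<forall>i\<in>{1..l}. cmod (lam i) = 1"
    and "inj_on lam {1..l}"
    and "\<forall>n. cmod (\<alpha> n) < 1"
  shows "ess_spectrum (cmv \<alpha>) = lam ` {1..l} \<longleftrightarrow>
     ((\<lambda>n. \<Prod>i<l. rho (\<alpha> (n + i))) \<longlonglongrightarrow> 0) \<and>
     (\<forall>k\<in>{1..l}. \<forall>n a. limit_data \<alpha> k n a \<longrightarrow>
        spectrum (C_tilde k a) \<subseteq> lam ` {1..l} \<and> card (spectrum (C_tilde k a)) = k) \<and>
     (\<forall>i\<in>{1..l}. \<exists>k\<in>{1..l}. \<exists>n a. limit_data \<alpha> k n a \<and>
        eigenvalue (C_tilde k a) (lam i))"
proof -
  have lt1: "\<And>i. cmod (\<alpha> i) < 1" using assms(4) by blast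
  have le1: "\<And>i. cmod (\<alpha> i) \<le> 1" using lt1 by (simp add: less_imp_le)
  define \<Lambda> where "\<Lambda> = lam ` {1..l}"
  \<comment> \<open>Distinctness of the \<open>lam i\<close> enters here: the length of the products
    in (i) is the degree of the polynomial with simple roots \<Lambda>.\<close>
  have card: "card \<Lambda> = l" unfolding \<Lambda>_def using assms(3) by (simp add: card_image)
  have \<Lambda>: "finite \<Lambda>" "\<Lambda> \<noteq> {}" "\<And>z. z \<in> \<Lambda> \<Longrightarrow> cmod z = 1"
    using assms(1,2) unfolding \<Lambda>_def by auto
  have ess: "ess_spectrum (cmv \<alpha>) = {z. weyl \<alpha> z}" using lt1 by (rule ess_spectrum_cmv)
  show ?thesis
    unfolding \<Lambda>_def[symmetric] ess
  proof (intro iffI conjI ballI allI impI)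
    assume W: "{z. weyl \<alpha> z} = \<Lambda>"
    then have W': "weyl \<alpha> z \<longleftrightarrow> z \<in> \<Lambda>" for z by blast
    have "(\<lambda>n. \<Prod>i<card \<Lambda>. rho (\<alpha> (n + i))) \<longlonglongrightarrow> 0"
      by (rule prod_rho_tendsto_0[OF le1 \<Lambda>]) (simp_all only: W')
    then show lim: "(\<lambda>n. \<Prod>i<l. rho (\<alpha> (n + i))) \<longlonglongrightarrow> 0" unfolding card .
    show "\<exists>k\<in>{1..l}. \<exists>n a. limit_data \<alpha> k n a \<and> eigenvalue (C_tilde k a) (lam i)" if "i \<in> {1..l}" for i
    proof (rule weyl_eigenvalue[OF lt1 lim])
      show "weyl \<alpha> (lam i)" unfolding W' \<Lambda>_def using that by (rule imageI)
    qed
  next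
    fix k n a
    assume W: "{z. weyl \<alpha> z} = \<Lambda>" and k: "k \<in> {1..l}" and L: "limit_data \<alpha> k n a"
    have k1: "1 \<le> k" using k by simp
    show "spectrum (C_tilde k a) \<subseteq> \<Lambda>"
    proof
      fix z assume "z \<in> spectrum (C_tilde k a)"
      then have "eigenvalue (C_tilde k a) z" by (simp add: spectrum_def)
      from eigenvalue_C_tilde_weyl[OF lt1 k1 L this] show "z \<in> \<Lambda>" unfolding W[symmetric] by simp
    qed
    note D = limit_dataD[OF lt1 L]
    show "card (spectrum (C_tilde k a)) = k"
      using k1 D(2,3,4) by (rule card_spectrum_C_tilde)
  next
    assume H: "((\<lambda>n. \<Prod>i<l. rho (\<alpha> (n + i))) \<longlonglongrightarrow> 0) \<and>
     (\<forall>k\<in>{1..l}. \<forall>n a. limit_data \<alpha> k n a \<longrightarrow>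
        spectrum (C_tilde k a) \<subseteq> \<Lambda> \<and> card (spectrum (C_tilde k a)) = k) \<and>
     (\<forall>i\<in>{1..l}. \<exists>k\<in>{1..l}. \<exists>n a. limit_data \<alpha> k n a \<and>
        eigenvalue (C_tilde k a) (lam i))"
    from H have lim: "(\<lambda>n. \<Prod>i<l. rho (\<alpha> (n + i))) \<longlonglongrightarrow> 0"
      and sub: "\<And>k n a. k \<in> {1..l} \<Longrightarrow> limit_data \<alpha> k n a \<Longrightarrow> spectrum (C_tilde k a) \<subseteq> \<Lambda>"
      and all: "\<And>i. i \<in> {1..l} \<Longrightarrow> \<exists>k\<in>{1..l}. \<exists>n a. limit_data \<alpha> k n a \<and> eigenvalue (C_tilde k a) (lam i)"
      by simp_all
    show "{z. weyl \<alpha> z} = \<Lambda>"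
    proof (intro equalityI subsetI)
      fix z assume "z \<in> {z. weyl \<alpha> z}"
      then have "weyl \<alpha> z" by simp
      from weyl_eigenvalue[OF lt1 lim this] obtain k n a where
        k: "k \<in> {1..l}" and L: "limit_data \<alpha> k n a" and ev: "eigenvalue (C_tilde k a) z"
        by (elim bexE exE conjE)
      have "z \<in> spectrum (C_tilde k a)" using ev by (simp add: spectrum_def)
      with sub[OF k L] show "z \<in> \<Lambda>" by (rule subsetD)
    next
      fix z assume "z \<in> \<Lambda>"
      then obtain i where i: "i \<in> {1..l}" "z = lam i" unfolding \<Lambda>_def by (elim imageE)
      from all[OF i(1)] obtain k n a where
        k: "k \<in> {1..l}" and L: "limit_data \<alpha> k n a" and ev: "eigenvalue (C_tilde k a) (lam i)"
        by (elim bexE exE conjE)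
      have "1 \<le> k" using k by simp
      from eigenvalue_C_tilde_weyl[OF lt1 this L ev] show "z \<in> {z. weyl \<alpha> z}" unfolding i(2) by simp
    qed
  qed
qed

end
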